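(* Suppose $\mathcal H:\mathbb C\to\mathbb C$ is $k$-Lipschitz for some $k<1$, and $\mathcal H(0)=0$. Then every homeomorphic solution $f\in W^{1,2}_{\mathrm{loc}}(\mathbb C)$ to the nonlinear Beltrami equation $$\overline\partial f(z)=\mathcal H\bigl(\partial f(z)\bigr)\qquad\text{for almost every } z\in\mathbb C$$ is affine; that is, $f(z)=az+\mathcal H(a)\bar z+f(0)$ for some constant $a\in\mathbb C$.
   Context: Here $\partial=\tfrac12(\partial_x-i\partial_y)$ and $\overline\partial=\tfrac12(\partial_x+i\partial_y)$ are the weak (distributional) complex derivatives, $z=x+iy$. A homeomorphic solution is a solution that is a homeomorphism $f:\mathbb C\to\mathbb C$. *)

theory Defs
  imports "HOL-Analysis.Analysis"
begin

primrec C_k :: "nat \<Rightarrow> (complex \<Rightarrow> real) \<Rightarrow> bool" where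
  "C_k 0 \<phi> \<longleftrightarrow> continuous_on UNIV \<phi>"
| "C_k (Suc n) \<phi> \<longleftrightarrow>
     \<phi> differentiable_on UNIV \<and> (\<forall>v. C_k n (\<lambda>z. frechet_derivative \<phi> (at z) v))"

definition test_function :: "(complex \<Rightarrow> real) \<Rightarrow> bool" where
  "test_function \<phi> \<longleftrightarrow> (\<forall>n. C_k n \<phi>) \<and> compact (closure {z. \<phi> z \<noteq> 0})"

definition L1_loc :: "(complex \<Rightarrow> complex) set" where
  "L1_loc = {f. \<forall>K. compact K \<longrightarrow> set_integrable lebesgue K f}"

definition L2_loc :: "(complex \<Rightarrow> complex) set" where
  "L2_loc = {f. f \<in> borel_measurable lebesgue \<and>
     (\<forall>K. compact K \<longrightarrow> set_integrable lebesgue K (\<lambda>z. (norm (f z))\<^sup>2))}"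

text \<open>
  \<open>v = 1\<close> and \<open>v = \<i>\<close> give the partial derivatives in \<open>x\<close> and \<open>y\<close>. Testing against
  real-valued functions is enough: the complex-valued case follows by linearity.
\<close>

definition has_weak_partial ::
    "(complex \<Rightarrow> complex) \<Rightarrow> complex \<Rightarrow> (complex \<Rightarrow> complex) \<Rightarrow> bool" where
  "has_weak_partial f v g \<longleftrightarrow> f \<in> L1_loc \<and> g \<in> L1_loc \<and>
     (\<forall>\<phi>. test_function \<phi> \<longrightarrow>
        (LINT z|lebesgue. frechet_derivative \<phi> (at z) v *\<^sub>R f z) =
        - (LINT z|lebesgue. \<phi> z *\<^sub>R g z))"

text \<open>
  A weak derivative is unique only up to a null set, so \<open>weak_partial\<close> chooses a
  representative; it is meaningful only up to almost-everywhere equality, and only where a weak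
  derivative exists.
\<close>

definition weak_partial :: "(complex \<Rightarrow> complex) \<Rightarrow> complex \<Rightarrow> complex \<Rightarrow> complex" where
  "weak_partial f v = (SOME g. has_weak_partial f v g)"

definition W12_loc :: "(complex \<Rightarrow> complex) set" where
  "W12_loc = {f. f \<in> L2_loc \<and>
     (\<forall>v\<in>{1, \<i>}. (\<exists>g. has_weak_partial f v g) \<and> weak_partial f v \<in> L2_loc)}"

definition weak_dz :: "(complex \<Rightarrow> complex) \<Rightarrow> complex \<Rightarrow> complex" where
  "weak_dz f z = (weak_partial f 1 z - \<i> * weak_partial f \<i> z) / 2"

definition weak_dzbar :: "(complex \<Rightarrow> complex) \<Rightarrow> complex \<Rightarrow> complex" where
  "weak_dzbar f z = (weak_partial f 1 z + \<i> * weak_partial f \<i> z) / 2"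

end

theory Submission imports Defs begin

text \<open>
  Since the equation is autonomous and \<open>H\<close> is \<open>k\<close>-Lipschitz, each difference
  \<open>g z = f (z + h) - f z\<close> satisfies \<open>\<bar>weak_dzbar g\<bar> \<le> k \<bar>weak_dz g\<bar>\<close>, so it is quasiregular, and for \<open>h \<noteq> 0\<close> it
  has no zero because \<open>f\<close> is injective. An energy estimate for \<open>ln \<bar>f - f 0\<bar>\<close> in rings, combined with
  the length-area method, shows that \<open>f\<close>, and hence \<open>g\<close>, grows at most polynomially.

  Therefore \<open>s = log g - log g(0)\<close> has real part at most \<open>M = O(n)\<close> on the square of half-side
  \<open>4\<^sup>n\<close>. The imaginary part of \<open>Ln (2 M - s)\<close> is bounded by \<open>pi\<close>, so its energy is bounded on all
  concentric squares independently of their scale (Caccioppoli); summing over many dyadic rings, the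
  length-area method and the maximum principle make its oscillation small on a square smaller by a
  fixed factor, where consequently \<open>\<bar>s\<bar> \<le> M / 2\<close>. Iterating this halving beats the linear growth of
  \<open>M\<close> and gives \<open>s = 0\<close>. Thus every \<open>g\<close> is constant, and \<open>f - f 0\<close> is additive and continuous.
\<close>

text \<open>\<open>f\<close> is only a Sobolev map, so every estimate is reduced to one identity:
  the Jacobian of the pair \<open>\<phi> a\<close>, \<open>b\<close>, with \<open>\<phi>\<close> a
  cut-off, has integral zero. It involves first derivatives only and survives limits dominated in
  L2. The maximum principle, the Caccioppoli bound and the ring energy estimate differ in the choice
  of \<open>a\<close> and \<open>b\<close>. The growth bound has to start from \<open>f\<close> and
  not from \<open>g\<close>: the length-area argument for it uses that the preimages of a disc and
  of its exterior are connected, which holds for a homeomorphism but need not hold for a difference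
  of two. On a ring around 0 a logarithm of \<open>f\<close> may fail to be single-valued; pairing
  \<open>\<alpha> / f\<close> with \<open>f\<close> replaces pairing \<open>\<alpha>\<close> with
  log f. The price is the winding of \<open>f\<close>, which enters through one fixed constant.
  Squares stand in for discs because their sides are coordinate segments, to which Fubini applies
  without polar coordinates.\<close>

lemma integrable_lborel_shift:
  fixes f :: "complex \<Rightarrow> 'a::{banach,second_countable_topology}"
  assumes "integrable lborel f"
  shows "integrable lborel (\<lambda>z. f (z + w))"
proof -
  have "integrable (distr lborel borel ((+) w)) f"
    using assms by (simp add: lborel_distr_plus)
  then show ?thesis
    by (subst (asm) integrable_distr_eq) (use assms in \<open>auto simp: add.commute\<close>)
qed

lemma integral_lborel_shift:
  fixes f :: "complex \<Rightarrow> 'a::{banach,second_countable_topology}"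
  assumes "f \<in> borel_measurable borel"
  shows "(LINT z|lborel. f (z + w)) = (LINT z|lborel. f z)"
proof -
  have "(LINT z|lborel. f z) = (LINT z|distr lborel borel ((+) w). f z)"
    by (simp add: lborel_distr_plus)
  also have "\<dots> = (LINT z|lborel. f (w + z))"
    by (subst integral_distr) (use assms in auto)
  finally show ?thesis by (simp add: add.commute)
qed

section \<open>The Jacobian of C1 functions\<close>

text \<open>The differential of a planar map whose partial derivatives in x and y are
  \<open>p\<close> and \<open>q\<close>. Keeping this pair as data lets limits of derivatives be
  taken componentwise, whether or not the limit function is differentiable.\<close>

definition rlin :: "complex \<Rightarrow> complex \<Rightarrow> complex \<Rightarrow> complex" where
  "rlin p q v = Re v *\<^sub>R p + Im v *\<^sub>R q"

lemma rlin_simps [simp]: "rlin p q 1 = p" "rlin p q \<i> = q" "rlin p q 0 = 0"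
  by (auto simp: rlin_def)

lemma bounded_linear_rlin: "bounded_linear (rlin p q)"
  unfolding rlin_def by (intro bounded_linear_add bounded_linear_compose[OF bounded_linear_scaleR_left] bounded_linear_Re bounded_linear_Im)

lemma rlin_scaleR: "rlin p q (c *\<^sub>R v) = c *\<^sub>R rlin p q v"
  by (simp add: rlin_def scaleR_add_right)

lemma norm_rlin_le: "norm (rlin p q v) \<le> (norm p + norm q) * norm v"
proof -
  have "norm (rlin p q v) \<le> \<bar>Re v\<bar> * norm p + \<bar>Im v\<bar> * norm q"
    unfolding rlin_def by (rule order_trans[OF norm_triangle_ineq]) simp
  also have "\<dots> \<le> norm v * norm p + norm v * norm q"
    by (intro add_mono mult_right_mono abs_Re_le_cmod abs_Im_le_cmod) auto
  finally show ?thesis by (simp add: algebra_simps)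
qed

definition C1on :: "complex set \<Rightarrow> (complex \<Rightarrow> complex) \<Rightarrow> (complex \<Rightarrow> complex) \<Rightarrow> (complex \<Rightarrow> complex) \<Rightarrow> bool" where
  "C1on S u p q \<longleftrightarrow> (\<forall>z\<in>S. (u has_derivative rlin (p z) (q z)) (at z)) \<and> continuous_on S p \<and> continuous_on S q"

lemma C1on_subset: "C1on S u p q \<Longrightarrow> T \<subseteq> S \<Longrightarrow> C1on T u p q"
  by (auto simp: C1on_def intro: continuous_on_subset)

lemma C1on_continuous: "C1on S u p q \<Longrightarrow> continuous_on S u"
  by (auto simp: C1on_def intro!: has_derivative_continuous_on intro: has_derivative_at_withinI)

lemma C1on_Lipschitz:
  assumes "C1on S u p q" "convex C" "C \<subseteq> S"
    and L: "\<And>z. z \<in> C \<Longrightarrow> norm (p z) \<le> L \<and> norm (q z) \<le> L"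
    and "x \<in> C" "y \<in> C"
  shows "norm (u x - u y) \<le> 2 * L * norm (x - y)"
proof (rule differentiable_bound[OF \<open>convex C\<close> _ _ \<open>x \<in> C\<close> \<open>y \<in> C\<close>])
  fix z assume z: "z \<in> C"
  show "(u has_derivative rlin (p z) (q z)) (at z within C)"
    using assms z by (auto simp: C1on_def intro: has_derivative_at_withinI)
  show "onorm (rlin (p z) (q z)) \<le> 2 * L"
  proof (rule onorm_le)
    fix v
    show "norm (rlin (p z) (q z) v) \<le> 2 * L * norm v"
      by (rule order_trans[OF norm_rlin_le mult_right_mono]) (use L[OF z] in auto)
  qed
qed

lemma symmetric_difference_quotient_tendsto:
  fixes u :: "complex \<Rightarrow> complex"
  assumes u: "(u has_derivative D) (at z)" and t: "t \<longlonglongrightarrow> 0" "\<And>n. t n > 0"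
  shows "(\<lambda>n. (u (z + t n *\<^sub>R v) - u (z - t n *\<^sub>R v)) /\<^sub>R (2 * t n)) \<longlonglongrightarrow> D v"
proof -
  have one: "(\<lambda>n. (u (z + s n *\<^sub>R v) - u z) /\<^sub>R s n) \<longlonglongrightarrow> D v" if s: "s \<longlonglongrightarrow> 0" "\<And>n. s n \<noteq> 0" for s :: "nat \<Rightarrow> real"
  proof -
    have lin: "bounded_linear D" using u by (rule has_derivative_bounded_linear)
    have "((\<lambda>r. u (z + r *\<^sub>R v)) has_derivative (\<lambda>r. D (r *\<^sub>R v))) (at 0)"
      by (rule has_derivative_compose[of "\<lambda>r. z + r *\<^sub>R v" "\<lambda>r. r *\<^sub>R v" 0 UNIV u D, simplified])
         (auto intro!: derivative_eq_intros u)
    then have "((\<lambda>h. norm (u (z + h *\<^sub>R v) - u z - D (h *\<^sub>R v)) / norm h) \<longlongrightarrow> 0) (at 0)"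
      by (simp add: has_derivative_at)
    then have "((\<lambda>h. norm ((u (z + h *\<^sub>R v) - u z) /\<^sub>R h - D v)) \<longlongrightarrow> 0) (at 0)"
    proof (rule Lim_transform_eventually)
      have "norm (u (z + h *\<^sub>R v) - u z - D (h *\<^sub>R v)) / norm h = norm ((u (z + h *\<^sub>R v) - u z) /\<^sub>R h - D v)" if "h \<noteq> 0" for h :: real
      proof -
        have "(u (z + h *\<^sub>R v) - u z) /\<^sub>R h - D v = (u (z + h *\<^sub>R v) - u z - D (h *\<^sub>R v)) /\<^sub>R h"
          using that by (simp add: linear_scale[OF bounded_linear.linear[OF lin]] scaleR_diff_right)
        then show ?thesis by (simp add: divide_inverse mult.commute)
      qed
      then show "\<forall>\<^sub>F h in at 0. norm (u (z + h *\<^sub>R v) - u z - D (h *\<^sub>R v)) / norm h = norm ((u (z + h *\<^sub>R v) - u z) /\<^sub>R h - D v)"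
        by (simp add: eventually_at_filter)
    qed
    then have "((\<lambda>r. (u (z + r *\<^sub>R v) - u z) /\<^sub>R r) \<longlongrightarrow> D v) (at 0)"
      by (simp add: tendsto_norm_zero_iff Lim_null[symmetric])
    then show ?thesis
      by (rule filterlim_compose) (use s in \<open>auto simp: filterlim_at\<close>)
  qed
  have "(\<lambda>n. ((u (z + t n *\<^sub>R v) - u z) /\<^sub>R t n + (u (z + (- t n) *\<^sub>R v) - u z) /\<^sub>R (- t n)) /\<^sub>R 2) \<longlonglongrightarrow> (D v + D v) /\<^sub>R 2"
    by (intro tendsto_intros one) (use t tendsto_minus[OF t(1)] in \<open>auto simp: less_imp_neq[OF t(2), symmetric]\<close>)
  moreover have "((u (z + t n *\<^sub>R v) - u z) /\<^sub>R t n + (u (z + (- t n) *\<^sub>R v) - u z) /\<^sub>R (- t n)) /\<^sub>R 2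
     = (u (z + t n *\<^sub>R v) - u (z - t n *\<^sub>R v)) /\<^sub>R (2 * t n)" for n
    by (simp add: algebra_simps)
  ultimately show ?thesis by (simp flip: scaleR_2)
qed

text \<open>The products of symmetric differences cancel exactly after translation, so no second
  derivatives are needed.\<close>

lemma null_lagrangian:
  assumes S: "open S" and K: "compact K" "K \<subseteq> S"
    and a: "C1on UNIV a a1 a2" and a0: "\<And>z. z \<notin> K \<Longrightarrow> a z = 0" and b: "C1on S b b1 b2"
  shows "(LINT z:S|lborel. a1 z * b2 z - a2 z * b1 z) = 0"
proof -
  obtain e where e: "e > 0" "(\<Union>x\<in>K. cball x e) \<subseteq> S"
    using compact_subset_open_imp_cball_epsilon_subset[OF K(1) S K(2)] by blast
  \<comment> \<open>Closed neighbourhoods of \<open>K\<close>: all shifts stay below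
    \<open>e / 2\<close>, so points moved from \<open>N (e / 2)\<close> remain in
    \<open>N e\<close>, a compact subset of \<open>S\<close> on which the functions and their
    partials are bounded.\<close>
  define N where "N d = (\<Union>x\<in>K. cball x d)" for d
  have cN: "compact (N d)" if "d \<ge> 0" for d
  proof -
    have "N d = {x + y |x y. x \<in> K \<and> y \<in> cball 0 d}"
      by (auto simp: N_def dist_norm norm_minus_commute)
         (metis add.commute diff_add_cancel)+
    then show ?thesis using compact_sums[OF K(1) compact_cball[of 0 d]] by simp
  qed
  have NS: "N e \<subseteq> S" using e by (auto simp: N_def)
  have KN: "K \<subseteq> N e" using e by (auto simp: N_def intro!: bexI)
  define b' where "b' z = (if z \<in> S then b z else 0)" for z
  have contN: "continuous_on (N e) g" if "continuous_on S g" for g :: "complex \<Rightarrow> complex"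
    using that NS continuous_on_subset by blast
  have bdd: "\<exists>B. \<forall>z\<in>N e. norm (g z) \<le> B" if "continuous_on S g" for g :: "complex \<Rightarrow> complex"
    using compact_imp_bounded[OF compact_continuous_image[OF contN[OF that] cN]] e
    by (auto simp: bounded_iff)
  have ca: "continuous_on UNIV a" and cb: "continuous_on S b"
    using a b C1on_continuous by auto
  obtain A where A: "\<And>z. z \<in> N e \<Longrightarrow> norm (a z) \<le> A"
    using bdd[OF continuous_on_subset[OF ca]] by auto
  obtain B where B: "\<And>z. z \<in> N e \<Longrightarrow> norm (b z) \<le> B" using bdd[OF cb] by auto
  have c: "continuous_on S a1" "continuous_on S a2" "continuous_on S b1" "continuous_on S b2"
    using a b unfolding C1on_def by (auto intro: continuous_on_subset)
  obtain L1 L2 L3 L4 where L1234: "\<And>z. z \<in> N e \<Longrightarrow> norm (a1 z) \<le> L1"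
     "\<And>z. z \<in> N e \<Longrightarrow> norm (a2 z) \<le> L2" "\<And>z. z \<in> N e \<Longrightarrow> norm (b1 z) \<le> L3" "\<And>z. z \<in> N e \<Longrightarrow> norm (b2 z) \<le> L4"
    using bdd[OF c(1)] bdd[OF c(2)] bdd[OF c(3)] bdd[OF c(4)] by metis
  define L where "L = \<bar>L1\<bar> + \<bar>L2\<bar> + \<bar>L3\<bar> + \<bar>L4\<bar>"
  have L: "norm (a1 z) \<le> L" "norm (a2 z) \<le> L" "norm (b1 z) \<le> L" "norm (b2 z) \<le> L" if "z \<in> N e" for z
    using L1234[OF that] unfolding L_def by linarith+
  have L0: "L \<ge> 0" by (simp add: L_def)
  have ma: "a \<in> borel_measurable borel" using ca by (rule borel_measurable_continuous_onI)
  have mb: "b' \<in> borel_measurable borel"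
    unfolding b'_def by (rule borel_measurable_continuous_on_if) (use S cb in \<open>auto simp: continuous_on_const\<close>)
  \<comment> \<open>Translation moves both shifts onto \<open>b'\<close>, so a product contributes
    only through the difference \<open>\<beta> - \<alpha>\<close>.\<close>
  have T: "integrable lborel (\<lambda>z. a (z + \<alpha>) * b' (z + \<beta>)) \<and>
     (LINT z|lborel. a (z + \<alpha>) * b' (z + \<beta>)) = (LINT z|lborel. a z * b' (z + (\<beta> - \<alpha>)))"
    if "norm \<alpha> \<le> e / 2" "norm \<beta> \<le> e / 2" for \<alpha> \<beta>
  proof -
    have n: "norm (\<beta> - \<alpha>) \<le> e" using norm_triangle_ineq4[of \<beta> \<alpha>] that by linarith
    have i: "integrable lborel (\<lambda>z. a z * b' (z + (\<beta> - \<alpha>)))"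
    proof (rule Bochner_Integration.integrable_bound)
      show "integrable lborel (\<lambda>z. (A * B) * indicator K z)"
        using K by (auto intro!: integrable_mult_right integrable_real_indicator emeasure_compact_finite borel_compact)
      show "(\<lambda>z. a z * b' (z + (\<beta> - \<alpha>))) \<in> borel_measurable lborel"
        using ma mb by simp
      have "norm (a z * b' (z + (\<beta> - \<alpha>))) \<le> norm ((A * B) * indicator K z)" for z
      proof (cases "z \<in> K")
        case True
        have "z + (\<beta> - \<alpha>) \<in> N e" using True n norm_minus_commute[of \<alpha> \<beta>] by (auto simp: N_def dist_norm intro!: bexI[of _ z])
        moreover have "z \<in> N e" using True KN by auto
        ultimately show ?thesis using True A[of z] B[of "z + (\<beta> - \<alpha>)"] NS
          by (auto simp: b'_def norm_mult abs_mult intro!: mult_mono)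
      qed (simp add: a0)
      then show "AE z in lborel. norm (a z * b' (z + (\<beta> - \<alpha>))) \<le> norm ((A * B) * indicator K z)" by simp
    qed
    from integrable_lborel_shift[OF i, of \<alpha>] integral_lborel_shift[OF _, of "\<lambda>z. a z * b' (z + (\<beta> - \<alpha>))" \<alpha>]
    show ?thesis using ma mb by (simp add: algebra_simps)
  qed
  define t where "t n = e / (real n + 2)" for n
  have t0: "t n > 0" and te: "t n \<le> e / 2" for n using e by (auto simp: t_def field_simps)
  have tlim: "t \<longlonglongrightarrow> 0" unfolding t_def by real_asymp
  define I where "I n z = (a (z + t n *\<^sub>R 1) - a (z - t n *\<^sub>R 1)) * (b' (z + t n *\<^sub>R \<i>) - b' (z - t n *\<^sub>R \<i>))
      - (a (z + t n *\<^sub>R \<i>) - a (z - t n *\<^sub>R \<i>)) * (b' (z + t n *\<^sub>R 1) - b' (z - t n *\<^sub>R 1))" for n z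
  \<comment> \<open>The eight products yield four differences of shifts, combining plus or minus
    \<open>t n\<close> with plus or minus \<open>\<i> t n\<close>; each occurs twice, with opposite
    signs.\<close>
  have I0: "(LINT z|lborel. I n z) = 0" for n
  proof -
    let ?s = "complex_of_real (t n)"
    let ?F = "\<lambda>\<alpha> \<beta> z. a (z + \<alpha>) * b' (z + \<beta>)"
    have nn: "norm ?s \<le> e/2" "norm (-?s) \<le> e/2" "norm (\<i> * ?s) \<le> e/2" "norm (- (\<i> * ?s)) \<le> e/2"
      using t0[of n] te[of n] by (auto simp: norm_mult)
    note [simp] = T[OF nn(1) nn(3)] T[OF nn(1) nn(4)] T[OF nn(2) nn(3)] T[OF nn(2) nn(4)]
      T[OF nn(3) nn(1)] T[OF nn(3) nn(2)] T[OF nn(4) nn(1)] T[OF nn(4) nn(2)]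
    have "I n = (\<lambda>z. (?F ?s (\<i> * ?s) z - ?F ?s (-(\<i> * ?s)) z - ?F (-?s) (\<i> * ?s) z + ?F (-?s) (-(\<i> * ?s)) z)
      - (?F (\<i> * ?s) ?s z - ?F (\<i> * ?s) (-?s) z - ?F (-(\<i> * ?s)) ?s z + ?F (-(\<i> * ?s)) (-?s) z))"
      by (rule ext) (simp add: I_def scaleR_conv_of_real algebra_simps)
    then have "(LINT z|lborel. I n z) = (LINT z|lborel. (?F ?s (\<i> * ?s) z - ?F ?s (-(\<i> * ?s)) z - ?F (-?s) (\<i> * ?s) z + ?F (-?s) (-(\<i> * ?s)) z)
      - (?F (\<i> * ?s) ?s z - ?F (\<i> * ?s) (-?s) z - ?F (-(\<i> * ?s)) ?s z + ?F (-(\<i> * ?s)) (-?s) z))"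
      by simp
    also have "\<dots> = 0"
      by (simp del: add_uminus_conv_diff minus_mult_right) (simp add: algebra_simps)
    finally show ?thesis .
  qed
  have far: "I n z = 0" if "z \<notin> N (e/2)" for n z
  proof -
    have "z + w \<notin> K" if "norm w \<le> e / 2" for w
    proof
      assume "z + w \<in> K"
      then have "z \<in> N (e/2)" using that by (auto simp: N_def dist_norm intro!: bexI[of _ "z + w"])
      with \<open>z \<notin> N (e/2)\<close> show False ..
    qed
    from this[of "t n *\<^sub>R 1"] this[of "- t n *\<^sub>R 1"] this[of "t n *\<^sub>R \<i>"] this[of "- t n *\<^sub>R \<i>"] t0[of n] te[of n]
    show ?thesis by (simp add: I_def a0)
  qed
  have cbN: "cball z (e/2) \<subseteq> N e" if "z \<in> N (e/2)" for z
  proof -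
    from that obtain x where "x \<in> K" "dist x z \<le> e/2" by (auto simp: N_def)
    then show ?thesis by (auto simp: N_def intro!: bexI[of _ x])
       (smt (verit) dist_triangle field_sum_of_halves)
  qed
  have "(\<lambda>n. LINT z|lborel. I n z /\<^sub>R (4 * (t n)\<^sup>2)) \<longlonglongrightarrow> (LINT z|lborel. indicator S z *\<^sub>R (a1 z * b2 z - a2 z * b1 z))"
  proof (rule integral_dominated_convergence)
    show "integrable lborel (\<lambda>z. (8 * L\<^sup>2) * indicator (N (e/2)) z)"
      using cN[of "e/2"] e by (auto intro!: integrable_mult_right integrable_real_indicator emeasure_compact_finite borel_compact)
    show "(\<lambda>z. I n z /\<^sub>R (4 * (t n)\<^sup>2)) \<in> borel_measurable lborel" for n
      unfolding I_def using ma mb by simp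
    show "(\<lambda>z. indicator S z *\<^sub>R (a1 z * b2 z - a2 z * b1 z)) \<in> borel_measurable lborel"
    proof -
      have "(\<lambda>z. indicator S z *\<^sub>R (a1 z * b2 z - a2 z * b1 z)) = (\<lambda>z. if z \<in> S then a1 z * b2 z - a2 z * b1 z else 0)"
        by (auto simp: indicator_def)
      also have "\<dots> \<in> borel_measurable borel"
        by (rule borel_measurable_continuous_on_if) (use S c in \<open>auto intro!: continuous_intros\<close>)
      finally show ?thesis by simp
    qed
    have "(\<lambda>n. I n z /\<^sub>R (4 * (t n)\<^sup>2)) \<longlonglongrightarrow> indicator S z *\<^sub>R (a1 z * b2 z - a2 z * b1 z)" for z
    proof (cases "z \<in> S")
      case True
      have da: "(a has_derivative rlin (a1 z) (a2 z)) (at z)" using a by (auto simp: C1on_def)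
      have "(b has_derivative rlin (b1 z) (b2 z)) (at z)" using b True by (auto simp: C1on_def)
      then have db: "(b' has_derivative rlin (b1 z) (b2 z)) (at z)"
        by (rule has_derivative_transform_within_open[OF _ S True]) (simp add: b'_def)
      have g: "(A /\<^sub>R (2 * s)) * (B /\<^sub>R (2 * s)) - (C /\<^sub>R (2 * s)) * (D /\<^sub>R (2 * s)) = (A*B - C*D) /\<^sub>R (4 * s\<^sup>2)" for A B C D :: complex and s
        by (simp add: power2_eq_square scaleR_diff_right)
      note lim = symmetric_difference_quotient_tendsto[OF _ tlim t0]
      have "(\<lambda>n. ((a (z + t n *\<^sub>R 1) - a (z - t n *\<^sub>R 1)) /\<^sub>R (2 * t n)) * ((b' (z + t n *\<^sub>R \<i>) - b' (z - t n *\<^sub>R \<i>)) /\<^sub>R (2 * t n))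
      - ((a (z + t n *\<^sub>R \<i>) - a (z - t n *\<^sub>R \<i>)) /\<^sub>R (2 * t n)) * ((b' (z + t n *\<^sub>R 1) - b' (z - t n *\<^sub>R 1)) /\<^sub>R (2 * t n)))
        \<longlonglongrightarrow> rlin (a1 z) (a2 z) 1 * rlin (b1 z) (b2 z) \<i> - rlin (a1 z) (a2 z) \<i> * rlin (b1 z) (b2 z) 1"
        by (intro tendsto_intros lim da db)
      then have "(\<lambda>n. I n z /\<^sub>R (4 * (t n)\<^sup>2)) \<longlonglongrightarrow> a1 z * b2 z - a2 z * b1 z"
        unfolding g I_def rlin_simps .
      then show ?thesis
        unfolding indicator_simps(1)[OF True] scaleR_one .
    next
      case False
      have "N (e/2) \<subseteq> N e" using e by (auto simp: N_def)
      with False have "z \<notin> N (e/2)" using NS by blast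
      then show ?thesis using False far by simp
    qed
    then show "AE z in lborel. (\<lambda>n. I n z /\<^sub>R (4 * (t n)\<^sup>2)) \<longlonglongrightarrow> indicator S z *\<^sub>R (a1 z * b2 z - a2 z * b1 z)" by simp
    have "norm (I n z /\<^sub>R (4 * (t n)\<^sup>2)) \<le> (8 * L\<^sup>2) * indicator (N (e/2)) z" for n z
    proof (cases "z \<in> N (e/2)")
      case True
      have tn: "t n > 0" "t n \<le> e/2" using t0 te by auto
      have cb: "cball z (e/2) \<subseteq> N e" "cball z (e/2) \<subseteq> S" using cbN[OF True] NS by auto
      have eqb: "b' x = b x" if "x \<in> cball z (e/2)" for x using that cb by (auto simp: b'_def)
      \<comment> \<open>The Lipschitz constant \<open>2 * L\<close> acts on a segment of length
        \<open>2 * t n\<close>. Two products of such bounds, divided by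
        \<open>4 * (t n)\<^sup>2\<close>, give the dominating constant
        \<open>8 * L\<^sup>2\<close>.\<close>
      have D: "norm (u (z + t n *\<^sub>R v) - u (z - t n *\<^sub>R v)) \<le> 4 * L * t n"
        if u: "C1on S u p q" and pq: "\<And>x. x \<in> N e \<Longrightarrow> norm (p x) \<le> L" "\<And>x. x \<in> N e \<Longrightarrow> norm (q x) \<le> L" and v: "norm v = 1" for u p q v
      proof -
        have "norm (u (z + t n *\<^sub>R v) - u (z - t n *\<^sub>R v)) \<le> 2 * L * norm ((z + t n *\<^sub>R v) - (z - t n *\<^sub>R v))"
          by (rule C1on_Lipschitz[OF u convex_cball cb(2)]) (use pq cb v tn in \<open>auto simp: dist_norm\<close>)
        also have "(z + t n *\<^sub>R v) - (z - t n *\<^sub>R v) = (2 * t n) *\<^sub>R v" by (simp add: scaleR_2 flip: scaleR_scaleR)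
        finally show ?thesis using v tn by simp
      qed
      have Da: "norm (a (z + t n *\<^sub>R v) - a (z - t n *\<^sub>R v)) \<le> 4 * L * t n" if "norm v = 1" for v
        by (rule D[OF C1on_subset[OF a subset_UNIV] L(1) L(2) that])
      have Db: "norm (b' (z + t n *\<^sub>R v) - b' (z - t n *\<^sub>R v)) \<le> 4 * L * t n" if "norm v = 1" for v
        using D[OF b L(3) L(4) that] tn that by (subst (1 2) eqb) (auto simp: dist_norm)
      have "norm (I n z) \<le> (4 * L * t n) * (4 * L * t n) + (4 * L * t n) * (4 * L * t n)"
        unfolding I_def
        by (rule order_trans[OF norm_triangle_ineq4], unfold norm_mult, intro add_mono mult_mono Da Db)
           (use L0 tn in auto)
      also have "\<dots> = 8 * L\<^sup>2 * (4 * (t n)\<^sup>2)" by (simp add: power2_eq_square)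
      finally show ?thesis using True tn by (simp add: field_simps)
    qed (simp add: far)
    then show "AE z in lborel. norm (I n z /\<^sub>R (4 * (t n)\<^sup>2)) \<le> (8 * L\<^sup>2) * indicator (N (e/2)) z" for n by simp
  qed
  then have "(\<lambda>n. 0 :: complex) \<longlonglongrightarrow> (LINT z|lborel. indicator S z *\<^sub>R (a1 z * b2 z - a2 z * b1 z))"
    by (simp add: I0)
  then show ?thesis
    by (simp add: set_lebesgue_integral_def LIMSEQ_const_iff)
qed

section \<open>Continuous Sobolev functions\<close>

abbreviation lborel_on :: "complex set \<Rightarrow> complex measure" where
  "lborel_on S \<equiv> restrict_space lborel S"

lemma continuous_on_measurable_lborel_on:
  "continuous_on S g \<Longrightarrow> g \<in> borel_measurable (lborel_on S)"
  using borel_measurable_continuous_on_restrict[of S g]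
  by (simp add: measurable_def space_restrict_space sets_restrict_space)

lemma finite_measure_lborel_on:
  assumes "open S" "bounded S"
  shows "finite_measure (lborel_on S)"
  by (rule finite_measureI)
     (use assms emeasure_bounded_finite[of S] in \<open>auto simp: emeasure_restrict_space\<close>)

lemma integrable_lborel_on_bounded:
  fixes g :: "complex \<Rightarrow> complex"
  assumes "open S" "bounded S" "g \<in> borel_measurable (lborel_on S)" "\<And>z. z \<in> S \<Longrightarrow> norm (g z) \<le> B"
  shows "integrable (lborel_on S) g"
  by (rule finite_measure.integrable_const_bound[OF finite_measure_lborel_on[OF assms(1,2)], where B = B])
     (use assms in \<open>auto simp: AE_restrict_space_iff\<close>)

text \<open>Continuous \<open>W\<^sup>1\<^sup>,\<^sup>2\<close> functions with partials \<open>p\<close> and \<open>q\<close>, encoded by the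
  approximation that mollification yields locally along a subsequence: dominated convergence then
  replaces all arguments with test functions.\<close>

definition sob :: "complex set \<Rightarrow> (complex \<Rightarrow> complex) \<Rightarrow> (complex \<Rightarrow> complex) \<Rightarrow> (complex \<Rightarrow> complex) \<Rightarrow> bool" where
  "sob S u p q \<longleftrightarrow> p \<in> borel_measurable (lborel_on S) \<and> q \<in> borel_measurable (lborel_on S) \<and>
    (\<exists>U P Q h B. h \<in> borel_measurable (lborel_on S) \<and> (\<forall>n::nat. C1on S (U n) (P n) (Q n)) \<and>
       uniform_limit S U u sequentially \<and>
       (\<forall>n. \<forall>z\<in>S. norm (U n z) \<le> B) \<and>
       (AE z in lborel_on S. \<forall>n. norm (P n z) \<le> h z \<and> norm (Q n z) \<le> h z) \<and>
       (AE z in lborel_on S. (\<lambda>n. P n z) \<longlonglongrightarrow> p z \<and> (\<lambda>n. Q n z) \<longlonglongrightarrow> q z) \<and>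
       integrable (lborel_on S) (\<lambda>z. (h z)\<^sup>2))"

lemma sobE:
  assumes "sob S u p q"
  obtains h U P Q B where "p \<in> borel_measurable (lborel_on S)" "q \<in> borel_measurable (lborel_on S)"
    "(h::complex\<Rightarrow>real) \<in> borel_measurable (lborel_on S)" "\<And>n::nat. C1on S (U n) (P n) (Q n)"
    "uniform_limit S U u sequentially"
    "\<And>n z. z \<in> S \<Longrightarrow> norm (U n z) \<le> B" "AE z in lborel_on S. \<forall>n. norm (P n z) \<le> h z \<and> norm (Q n z) \<le> h z"
    "AE z in lborel_on S. (\<lambda>n. P n z) \<longlonglongrightarrow> p z \<and> (\<lambda>n. Q n z) \<longlonglongrightarrow> q z"
    "integrable (lborel_on S) (\<lambda>z. (h z)\<^sup>2)"
proof -
  obtain h U P Q B where *: "p \<in> borel_measurable (lborel_on S)" "q \<in> borel_measurable (lborel_on S)"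
    "h \<in> borel_measurable (lborel_on S)" "\<forall>n::nat. C1on S (U n) (P n) (Q n)"
    "uniform_limit S U u sequentially"
    "\<forall>n. \<forall>z\<in>S. norm (U n z) \<le> B" "AE z in lborel_on S. \<forall>n. norm (P n z) \<le> h z \<and> norm (Q n z) \<le> h z"
    "AE z in lborel_on S. (\<lambda>n. P n z) \<longlonglongrightarrow> p z \<and> (\<lambda>n. Q n z) \<longlonglongrightarrow> q z"
    "integrable (lborel_on S) (\<lambda>z. (h z)\<^sup>2)"
    using assms unfolding sob_def by blast
  show thesis by (rule that[of h U P Q B]) (use * in auto)
qed

lemma sobI:
  fixes U P Q :: "nat \<Rightarrow> complex \<Rightarrow> complex" and h :: "complex \<Rightarrow> real"
  assumes "p \<in> borel_measurable (lborel_on S)" "q \<in> borel_measurable (lborel_on S)"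
    "h \<in> borel_measurable (lborel_on S)" "\<And>n::nat. C1on S (U n) (P n) (Q n)"
    "uniform_limit S U u sequentially"
    "\<And>n z. z \<in> S \<Longrightarrow> norm (U n z) \<le> B" "AE z in lborel_on S. \<forall>n. norm (P n z) \<le> h z \<and> norm (Q n z) \<le> h z"
    "AE z in lborel_on S. (\<lambda>n. P n z) \<longlonglongrightarrow> p z \<and> (\<lambda>n. Q n z) \<longlonglongrightarrow> q z"
    "integrable (lborel_on S) (\<lambda>z. (h z)\<^sup>2)"
  shows "sob S u p q"
  using assms unfolding sob_def by blast

lemma sob_continuous:
  assumes "sob S u p q" shows "continuous_on S u"
proof -
  obtain U P Q where "\<And>n::nat. C1on S (U n) (P n) (Q n)" "uniform_limit S U u sequentially"
    by (rule sobE[OF assms]) blast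
  then show ?thesis
    by (intro uniform_limit_theorem[where F = sequentially]) (auto intro: always_eventually C1on_continuous)
qed

lemma tendsto_sob:
  assumes "uniform_limit S U u sequentially" "z \<in> S" shows "(\<lambda>n. U n z) \<longlonglongrightarrow> u z"
  using assms by (rule tendsto_uniform_limitI)

lemma sob_bounded:
  assumes "sob S u p q" obtains B where "\<And>z. z \<in> S \<Longrightarrow> norm (u z) \<le> B"
proof -
  obtain U B where "uniform_limit S U u sequentially" "\<And>(n::nat) z. z \<in> S \<Longrightarrow> norm (U n z) \<le> B"
    by (rule sobE[OF assms]) blast
  then show ?thesis
    by (intro that[of B] Lim_bounded[OF tendsto_norm[OF tendsto_sob]]) auto
qed

lemma integrable_square_add:
  assumes "f \<in> borel_measurable M" "g \<in> borel_measurable M"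
    and "integrable M (\<lambda>x. (f x)\<^sup>2)" "integrable M (\<lambda>x. (g x)\<^sup>2)"
  shows "integrable M (\<lambda>x. (c * (f x + g x) :: real)\<^sup>2)"
proof (rule Bochner_Integration.integrable_bound)
  show "integrable M (\<lambda>x. 2 * c\<^sup>2 * ((f x)\<^sup>2 + (g x)\<^sup>2))" using assms by auto
  have "(c * (a + b))\<^sup>2 \<le> 2 * c\<^sup>2 * (a\<^sup>2 + b\<^sup>2)" for a b :: real
  proof -
    have "(a + b)\<^sup>2 \<le> 2 * (a\<^sup>2 + b\<^sup>2)" using sum_squares_bound[of a b] by (simp add: power2_sum)
    from mult_left_mono[OF this zero_le_power2[of c]] show ?thesis by (simp only: power_mult_distrib mult_ac)
  qed
  then show "AE x in M. norm ((c * (f x + g x))\<^sup>2) \<le> norm (2 * c\<^sup>2 * ((f x)\<^sup>2 + (g x)\<^sup>2))"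
    by simp
qed (use assms in auto)

section \<open>Sums, products and compositions of continuous Sobolev functions\<close>

lemma C1on_mult:
  assumes "C1on S u p q" "C1on S v r s"
  shows "C1on S (\<lambda>z. u z * v z) (\<lambda>z. p z * v z + u z * r z) (\<lambda>z. q z * v z + u z * s z)"
proof -
  have "((\<lambda>z. u z * v z) has_derivative rlin (p z * v z + u z * r z) (q z * v z + u z * s z)) (at z)" if "z \<in> S" for z
  proof -
    have "((\<lambda>z. u z * v z) has_derivative (\<lambda>h. u z * rlin (r z) (s z) h + rlin (p z) (q z) h * v z)) (at z)"
      using assms that by (intro has_derivative_mult) (auto simp: C1on_def)
    also have "(\<lambda>h. u z * rlin (r z) (s z) h + rlin (p z) (q z) h * v z) = rlin (p z * v z + u z * r z) (q z * v z + u z * s z)"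
      by (simp add: rlin_def fun_eq_iff algebra_simps scaleR_conv_of_real)
    finally show ?thesis .
  qed
  then show ?thesis using assms C1on_continuous[OF assms(1)] C1on_continuous[OF assms(2)]
    by (auto simp: C1on_def intro!: continuous_intros)
qed

lemma C1on_add:
  assumes "C1on S u p q" "C1on S v r s"
  shows "C1on S (\<lambda>z. u z + v z) (\<lambda>z. p z + r z) (\<lambda>z. q z + s z)"
proof -
  have "rlin (a + c) (b + d) = (\<lambda>h. rlin a b h + rlin c d h)" for a b c d
    by (simp add: rlin_def fun_eq_iff algebra_simps)
  then show ?thesis using assms by (auto simp: C1on_def intro!: continuous_intros has_derivative_add)
qed

lemma rlin_rlin: "rlin a b (rlin p q h) = rlin (rlin a b p) (rlin a b q) h"
  by (simp add: rlin_def algebra_simps)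

lemma C1on_compose:
  assumes "C1on S u p q" "C1on T G A B" "\<And>z. z \<in> S \<Longrightarrow> u z \<in> T"
  shows "C1on S (\<lambda>z. G (u z)) (\<lambda>z. rlin (A (u z)) (B (u z)) (p z)) (\<lambda>z. rlin (A (u z)) (B (u z)) (q z))"
proof -
  have "((\<lambda>z. G (u z)) has_derivative rlin (rlin (A (u z)) (B (u z)) (p z)) (rlin (A (u z)) (B (u z)) (q z))) (at z)" if "z \<in> S" for z
  proof -
    have "((\<lambda>z. G (u z)) has_derivative (\<lambda>h. rlin (A (u z)) (B (u z)) (rlin (p z) (q z) h))) (at z)"
      by (rule has_derivative_compose[of u _ z UNIV G]) (use assms that in \<open>auto simp: C1on_def\<close>)
    then show ?thesis by (simp add: rlin_rlin[abs_def])
  qed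
  moreover have "continuous_on S (\<lambda>z. H (u z))" if "continuous_on T H" for H :: "complex \<Rightarrow> complex"
    by (rule continuous_on_compose2[OF that C1on_continuous[OF assms(1)]]) (use assms in auto)
  ultimately show ?thesis using assms
    unfolding C1on_def by (auto simp: rlin_def intro!: continuous_intros)
qed

lemma sob_C1on:
  assumes S: "open S" "bounded S" and u: "C1on S u p q"
    and B: "\<And>z. z \<in> S \<Longrightarrow> norm (u z) \<le> B" "\<And>z. z \<in> S \<Longrightarrow> norm (p z) \<le> B" "\<And>z. z \<in> S \<Longrightarrow> norm (q z) \<le> B"
  shows "sob S u p q"
proof (rule sobI[of p S q "\<lambda>_. B" "\<lambda>_. u" "\<lambda>_. p" "\<lambda>_. q" u B])
  show "p \<in> borel_measurable (lborel_on S)" "q \<in> borel_measurable (lborel_on S)"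
    using u by (auto intro!: continuous_on_measurable_lborel_on simp: C1on_def)
  show "integrable (lborel_on S) (\<lambda>z. B\<^sup>2)"
    using finite_measure.integrable_const[OF finite_measure_lborel_on[OF S]] .
qed (use assms in \<open>auto simp: uniform_limit_const\<close>)

lemma sob_add:
  assumes "sob S u p q" "sob S v r s"
  shows "sob S (\<lambda>z. u z + v z) (\<lambda>z. p z + r z) (\<lambda>z. q z + s z)"
proof -
  obtain h U P Q B where 1: "p \<in> borel_measurable (lborel_on S)" "q \<in> borel_measurable (lborel_on S)"
    "(h::complex\<Rightarrow>real) \<in> borel_measurable (lborel_on S)" "\<And>n::nat. C1on S (U n) (P n) (Q n)"
    "uniform_limit S U u sequentially"
    "\<And>n z. z \<in> S \<Longrightarrow> norm (U n z) \<le> B" "AE z in lborel_on S. \<forall>n. norm (P n z) \<le> h z \<and> norm (Q n z) \<le> h z"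
    "AE z in lborel_on S. (\<lambda>n. P n z) \<longlonglongrightarrow> p z \<and> (\<lambda>n. Q n z) \<longlonglongrightarrow> q z"
    "integrable (lborel_on S) (\<lambda>z. (h z)\<^sup>2)" by (rule sobE[OF assms(1)]) blast
  obtain k V R T C where 2: "r \<in> borel_measurable (lborel_on S)" "s \<in> borel_measurable (lborel_on S)"
    "(k::complex\<Rightarrow>real) \<in> borel_measurable (lborel_on S)" "\<And>n::nat. C1on S (V n) (R n) (T n)"
    "uniform_limit S V v sequentially"
    "\<And>n z. z \<in> S \<Longrightarrow> norm (V n z) \<le> C" "AE z in lborel_on S. \<forall>n. norm (R n z) \<le> k z \<and> norm (T n z) \<le> k z"
    "AE z in lborel_on S. (\<lambda>n. R n z) \<longlonglongrightarrow> r z \<and> (\<lambda>n. T n z) \<longlonglongrightarrow> s z"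
    "integrable (lborel_on S) (\<lambda>z. (k z)\<^sup>2)" by (rule sobE[OF assms(2)]) blast
  show ?thesis
  proof (rule sobI[of _ S _ "\<lambda>z. 1 * (h z + k z)" "\<lambda>n z. U n z + V n z" "\<lambda>n z. P n z + R n z" "\<lambda>n z. Q n z + T n z" _ "B + C"])
    show "AE z in lborel_on S. (\<lambda>n. P n z + R n z) \<longlonglongrightarrow> p z + r z \<and> (\<lambda>n. Q n z + T n z) \<longlonglongrightarrow> q z + s z"
      using 1(8) 2(8) by eventually_elim (auto intro: tendsto_intros)
    show "integrable (lborel_on S) (\<lambda>z. (1 * (h z + k z))\<^sup>2)" by (rule integrable_square_add) (use 1 2 in auto)
    show "uniform_limit S (\<lambda>n z. U n z + V n z) (\<lambda>z. u z + v z) sequentially"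
      by (intro uniform_limit_intros 1 2)
    show "norm (U n z + V n z) \<le> B + C" if "z \<in> S" for n z
      using norm_triangle_mono[OF 1(6) 2(6)] that by auto
    show "AE z in lborel_on S. \<forall>n. norm (P n z + R n z) \<le> 1 * (h z + k z) \<and> norm (Q n z + T n z) \<le> 1 * (h z + k z)"
      using 1(7) 2(7) by eventually_elim (auto intro: norm_triangle_mono)
  qed (use 1 2 in \<open>auto intro: C1on_add\<close>)
qed

lemma sob_mult:
  assumes "sob S u p q" "sob S v r s"
  shows "sob S (\<lambda>z. u z * v z) (\<lambda>z. p z * v z + u z * r z) (\<lambda>z. q z * v z + u z * s z)"
proof -
  obtain Bu where Bu: "\<And>z. z \<in> S \<Longrightarrow> norm (u z) \<le> Bu" using sob_bounded[OF assms(1)] by blast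
  obtain Bv where Bv: "\<And>z. z \<in> S \<Longrightarrow> norm (v z) \<le> Bv" using sob_bounded[OF assms(2)] by blast
  note [measurable] = continuous_on_measurable_lborel_on[OF sob_continuous[OF assms(1)]]
     continuous_on_measurable_lborel_on[OF sob_continuous[OF assms(2)]]
  obtain h U P Q B where 1: "p \<in> borel_measurable (lborel_on S)" "q \<in> borel_measurable (lborel_on S)"
    "(h::complex\<Rightarrow>real) \<in> borel_measurable (lborel_on S)" "\<And>n::nat. C1on S (U n) (P n) (Q n)"
    "uniform_limit S U u sequentially"
    "\<And>n z. z \<in> S \<Longrightarrow> norm (U n z) \<le> B" "AE z in lborel_on S. \<forall>n. norm (P n z) \<le> h z \<and> norm (Q n z) \<le> h z"
    "AE z in lborel_on S. (\<lambda>n. P n z) \<longlonglongrightarrow> p z \<and> (\<lambda>n. Q n z) \<longlonglongrightarrow> q z"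
    "integrable (lborel_on S) (\<lambda>z. (h z)\<^sup>2)" by (rule sobE[OF assms(1)]) blast
  obtain k V R T C where 2: "r \<in> borel_measurable (lborel_on S)" "s \<in> borel_measurable (lborel_on S)"
    "(k::complex\<Rightarrow>real) \<in> borel_measurable (lborel_on S)" "\<And>n::nat. C1on S (V n) (R n) (T n)"
    "uniform_limit S V v sequentially"
    "\<And>n z. z \<in> S \<Longrightarrow> norm (V n z) \<le> C" "AE z in lborel_on S. \<forall>n. norm (R n z) \<le> k z \<and> norm (T n z) \<le> k z"
    "AE z in lborel_on S. (\<lambda>n. R n z) \<longlonglongrightarrow> r z \<and> (\<lambda>n. T n z) \<longlonglongrightarrow> s z"
    "integrable (lborel_on S) (\<lambda>z. (k z)\<^sup>2)" by (rule sobE[OF assms(2)]) blast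
  define D where "D = \<bar>B\<bar> + \<bar>C\<bar>"
  have bnd: "norm (a * b + c * d) \<le> D * (x + y)"
    if "norm a \<le> x" "norm b \<le> C" "norm c \<le> B" "norm d \<le> y" for a b c d :: complex and x y
  proof -
    have "norm (a * b + c * d) \<le> x * C + B * y"
      using that norm_ge_zero order_trans
      by (intro norm_triangle_mono) (auto simp: norm_mult intro!: mult_mono intro: order_trans[OF norm_ge_zero])
    also have "\<dots> \<le> x * D + D * y"
      using that by (intro add_mono mult_left_mono mult_right_mono) (auto simp: D_def intro: order_trans[OF norm_ge_zero])
    finally show ?thesis by (simp add: algebra_simps)
  qed
  show ?thesis
  proof (rule sobI[of _ S _ "\<lambda>z. D * (h z + k z)" "\<lambda>n z. U n z * V n z" "\<lambda>n z. P n z * V n z + U n z * R n z" "\<lambda>n z. Q n z * V n z + U n z * T n z" _ "B * C"])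
    have "AE z in lborel_on S. z \<in> S" by (rule AE_I2) (simp add: space_restrict_space)
    then show "AE z in lborel_on S. (\<lambda>n. P n z * V n z + U n z * R n z) \<longlonglongrightarrow> p z * v z + u z * r z \<and> (\<lambda>n. Q n z * V n z + U n z * T n z) \<longlonglongrightarrow> q z * v z + u z * s z"
      using 1(8) 2(8) by eventually_elim (auto intro!: tendsto_intros tendsto_sob[OF 1(5)] tendsto_sob[OF 2(5)])
    show "integrable (lborel_on S) (\<lambda>z. (D * (h z + k z))\<^sup>2)" by (rule integrable_square_add) (use 1 2 in auto)
    show "uniform_limit S (\<lambda>n z. U n z * V n z) (\<lambda>z. u z * v z) sequentially"
      by (intro uniform_lim_mult 1 2) (auto simp: bounded_iff intro!: Bu Bv exI)
    show "norm (U n z * V n z) \<le> B * C" if "z \<in> S" for n z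
      using 1(6)[OF that] 2(6)[OF that] by (auto simp: norm_mult intro!: mult_mono intro: order_trans[OF norm_ge_zero])
    show "AE z in lborel_on S. \<forall>n. norm (P n z * V n z + U n z * R n z) \<le> D * (h z + k z) \<and> norm (Q n z * V n z + U n z * T n z) \<le> D * (h z + k z)"
      using 1(7) 2(7) \<open>AE z in lborel_on S. z \<in> S\<close> by eventually_elim (auto intro!: bnd 1(6) 2(6))
    show "C1on S (\<lambda>z. U n z * V n z) (\<lambda>z. P n z * V n z + U n z * R n z) (\<lambda>z. Q n z * V n z + U n z * T n z)" for n
      by (rule C1on_mult[OF 1(4) 2(4)])
  qed (use 1 2 in measurable)
qed

text \<open>Uniform convergence puts all but finitely many approximants into a compact neighbourhood
  of \<open>C\<close> inside \<open>T\<close>. There \<open>G\<close> and its partials are bounded,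
  so the chain rule applied to this tail keeps a square integrable majorant.\<close>

lemma sob_compose:
  assumes u: "sob S u p q" and C: "compact C" "C \<subseteq> T" "open T" "\<And>z. z \<in> S \<Longrightarrow> u z \<in> C" and G: "C1on T G a b"
  shows "sob S (\<lambda>z. G (u z)) (\<lambda>z. rlin (a (u z)) (b (u z)) (p z)) (\<lambda>z. rlin (a (u z)) (b (u z)) (q z))"
proof -
  obtain h U P Q B where 1: "p \<in> borel_measurable (lborel_on S)" "q \<in> borel_measurable (lborel_on S)"
    "(h::complex\<Rightarrow>real) \<in> borel_measurable (lborel_on S)" "\<And>n::nat. C1on S (U n) (P n) (Q n)"
    "uniform_limit S U u sequentially"
    "\<And>n z. z \<in> S \<Longrightarrow> norm (U n z) \<le> B" "AE z in lborel_on S. \<forall>n. norm (P n z) \<le> h z \<and> norm (Q n z) \<le> h z"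
    "AE z in lborel_on S. (\<lambda>n. P n z) \<longlonglongrightarrow> p z \<and> (\<lambda>n. Q n z) \<longlonglongrightarrow> q z"
    "integrable (lborel_on S) (\<lambda>z. (h z)\<^sup>2)" by (rule sobE[OF u]) blast
  obtain e where e: "e > 0" "(\<Union>x\<in>C. cball x e) \<subseteq> T"
    using compact_subset_open_imp_cball_epsilon_subset[OF C(1) C(3) C(2)] by blast
  define N where "N = (\<Union>x\<in>C. cball x e)"
  have cN: "compact N"
  proof -
    have "N = {x + y |x y. x \<in> C \<and> y \<in> cball 0 e}"
      by (auto simp: N_def dist_norm norm_minus_commute) (metis add.commute diff_add_cancel)+
    then show ?thesis using compact_sums[OF C(1) compact_cball[of 0 e]] by simp
  qed
  have cont: "continuous_on N g" if "continuous_on T g" for g :: "complex \<Rightarrow> complex"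
    using that e continuous_on_subset unfolding N_def by blast
  have bdd: "\<exists>B. \<forall>z\<in>N. norm (g z) \<le> B" if "continuous_on T g" for g :: "complex \<Rightarrow> complex"
    using compact_imp_bounded[OF compact_continuous_image[OF cont[OF that] cN]]
    by (auto simp: bounded_iff)
  have cG: "continuous_on T G" "continuous_on T a" "continuous_on T b"
    using G C1on_continuous[OF G] by (auto simp: C1on_def)
  obtain B0 where B0: "\<And>w. w \<in> N \<Longrightarrow> norm (G w) \<le> B0" using bdd[OF cG(1)] by auto
  obtain B1 where B1: "\<And>w. w \<in> N \<Longrightarrow> norm (a w) \<le> B1" using bdd[OF cG(2)] by auto
  obtain B2 where B2: "\<And>w. w \<in> N \<Longrightarrow> norm (b w) \<le> B2" using bdd[OF cG(3)] by auto
  have "eventually (\<lambda>n. \<forall>z\<in>S. dist (U n z) (u z) < e) sequentially"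
    using 1(5) e by (auto simp: uniform_limit_iff)
  then obtain m where m: "\<And>n z. n \<ge> m \<Longrightarrow> z \<in> S \<Longrightarrow> dist (U n z) (u z) < e"
    by (auto simp: eventually_sequentially)
  have UN: "U (n + m) z \<in> N" if "z \<in> S" for n z
    using m[of "n + m" z] that C(4)[OF that] by (auto simp: N_def dist_commute intro!: bexI[of _ "u z"])
  have NT: "N \<subseteq> T" using e by (simp add: N_def)
  have uT: "u z \<in> T" if "z \<in> S" for z using C that by auto
  have contu: "continuous_on S (\<lambda>z. H (u z))" if "continuous_on T H" for H :: "complex \<Rightarrow> complex"
    by (rule continuous_on_compose2[OF that sob_continuous[OF u]]) (use uT in auto)
  note [measurable] = continuous_on_measurable_lborel_on[OF contu[OF cG(2)]] continuous_on_measurable_lborel_on[OF contu[OF cG(3)]] 1(1-3)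
  have ul: "uniform_limit S (\<lambda>n. U (n + m)) u sequentially"
    using 1(5) by (auto simp: uniform_limit_iff intro: eventually_all_ge_at_top[THEN eventually_mono] sequentially_offset)
  have bnd: "norm (rlin x y w) \<le> (\<bar>B1\<bar> + \<bar>B2\<bar>) * k" if "norm x \<le> B1" "norm y \<le> B2" "norm w \<le> k" for x y w k
    by (rule order_trans[OF norm_rlin_le mult_mono]) (use that in auto)
  show ?thesis
  proof (rule sobI[of _ S _ "\<lambda>z. (\<bar>B1\<bar> + \<bar>B2\<bar>) * h z" "\<lambda>n z. G (U (n + m) z)" "\<lambda>n z. rlin (a (U (n + m) z)) (b (U (n + m) z)) (P (n + m) z)"
        "\<lambda>n z. rlin (a (U (n + m) z)) (b (U (n + m) z)) (Q (n + m) z)" _ B0])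
    have AS: "AE z in lborel_on S. z \<in> S" by (rule AE_I2) (simp add: space_restrict_space)
    have t: "(\<lambda>n. g (U n z)) \<longlonglongrightarrow> g (u z)" if "z \<in> S" "continuous_on T g" for z and g :: "complex \<Rightarrow> complex"
    proof -
      have "isCont g (u z)" using that C uT by (auto simp: continuous_on_eq_continuous_at)
      then show ?thesis using isCont_tendsto_compose tendsto_sob[OF 1(5) that(1)] by blast
    qed
    show "AE z in lborel_on S. (\<lambda>n. rlin (a (U (n + m) z)) (b (U (n + m) z)) (P (n + m) z)) \<longlonglongrightarrow> rlin (a (u z)) (b (u z)) (p z)
      \<and> (\<lambda>n. rlin (a (U (n + m) z)) (b (U (n + m) z)) (Q (n + m) z)) \<longlonglongrightarrow> rlin (a (u z)) (b (u z)) (q z)"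
      using 1(8) AS unfolding rlin_def
      by eventually_elim (auto intro!: tendsto_intros t cG LIMSEQ_ignore_initial_segment)
    show "uniform_limit S (\<lambda>n z. G (U (n + m) z)) (\<lambda>z. G (u z)) sequentially"
      by (rule uniform_limit_compose_uniformly_continuous_on[OF ul compact_uniformly_continuous[OF cont[OF cG(1)] cN]])
         (use UN compact_imp_closed[OF cN] in auto)
    show "integrable (lborel_on S) (\<lambda>z. ((\<bar>B1\<bar> + \<bar>B2\<bar>) * h z)\<^sup>2)" using 1(9) by (simp add: power_mult_distrib)
    show "C1on S (\<lambda>z. G (U (n + m) z)) (\<lambda>z. rlin (a (U (n + m) z)) (b (U (n + m) z)) (P (n + m) z)) (\<lambda>z. rlin (a (U (n + m) z)) (b (U (n + m) z)) (Q (n + m) z))" for n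
      by (rule C1on_compose[OF 1(4) G]) (use UN NT in auto)
    show "AE z in lborel_on S. \<forall>n. norm (rlin (a (U (n + m) z)) (b (U (n + m) z)) (P (n + m) z)) \<le> (\<bar>B1\<bar> + \<bar>B2\<bar>) * h z
      \<and> norm (rlin (a (U (n + m) z)) (b (U (n + m) z)) (Q (n + m) z)) \<le> (\<bar>B1\<bar> + \<bar>B2\<bar>) * h z"
      using 1(7) AS by eventually_elim (auto intro!: bnd B1 B2 UN)
  qed (use UN B0 in \<open>auto simp: rlin_def\<close>)
qed

lemma AE_in_lborel_on: "AE z in lborel_on S. z \<in> S"
  by (rule AE_I2) (simp add: space_restrict_space)

lemma sob_norm_le_dominant:
  assumes "AE z in lborel_on S. \<forall>n. norm (P n z) \<le> h z"
    and "AE z in lborel_on S. (\<lambda>n::nat. P n z) \<longlonglongrightarrow> p z"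
  shows "AE z in lborel_on S. norm (p z :: complex) \<le> h z"
  using assms
proof eventually_elim
  case (elim z)
  show ?case by (rule Lim_bounded[OF tendsto_norm[OF elim(2)]]) (use elim in auto)
qed

lemma sob_square_integrable:
  assumes "sob S u p q"
  shows "integrable (lborel_on S) (\<lambda>z. (norm (p z))\<^sup>2)" "integrable (lborel_on S) (\<lambda>z. (norm (q z))\<^sup>2)"
proof -
  obtain h U P Q B where 1: "p \<in> borel_measurable (lborel_on S)" "q \<in> borel_measurable (lborel_on S)"
    "(h::complex\<Rightarrow>real) \<in> borel_measurable (lborel_on S)" "\<And>n::nat. C1on S (U n) (P n) (Q n)"
    "uniform_limit S U u sequentially"
    "\<And>n z. z \<in> S \<Longrightarrow> norm (U n z) \<le> B" "AE z in lborel_on S. \<forall>n. norm (P n z) \<le> h z \<and> norm (Q n z) \<le> h z"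
    "AE z in lborel_on S. (\<lambda>n. P n z) \<longlonglongrightarrow> p z \<and> (\<lambda>n. Q n z) \<longlonglongrightarrow> q z"
    "integrable (lborel_on S) (\<lambda>z. (h z)\<^sup>2)" by (rule sobE[OF assms(1)]) blast
  have *: "AE z in lborel_on S. norm (p z) \<le> h z" "AE z in lborel_on S. norm (q z) \<le> h z"
    by (rule sob_norm_le_dominant[where P = P]; use 1(7,8) in \<open>force elim: eventually_mono\<close>)
       (rule sob_norm_le_dominant[where P = Q]; use 1(7,8) in \<open>force elim: eventually_mono\<close>)
  have "AE z in lborel_on S. norm ((norm (p z))\<^sup>2) \<le> norm ((h z)\<^sup>2)"
    using *(1) by eventually_elim (auto intro: power_mono)
  then show "integrable (lborel_on S) (\<lambda>z. (norm (p z))\<^sup>2)"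
    by (rule Bochner_Integration.integrable_bound[OF 1(9), rotated]) (use 1(1) in measurable)
  have "AE z in lborel_on S. norm ((norm (q z))\<^sup>2) \<le> norm ((h z)\<^sup>2)"
    using *(2) by eventually_elim (auto intro: power_mono)
  then show "integrable (lborel_on S) (\<lambda>z. (norm (q z))\<^sup>2)"
    by (rule Bochner_Integration.integrable_bound[OF 1(9), rotated]) (use 1(2) in measurable)
qed

section \<open>Integration by parts for Sobolev pairs\<close>

lemma C1on_extend_by_zero:
  assumes S: "open S" and K: "closed K" "K \<subseteq> S" and u: "C1on S u p q"
    and 0: "\<And>z. z \<in> S - K \<Longrightarrow> u z = 0 \<and> p z = 0 \<and> q z = 0"
  shows "C1on UNIV (\<lambda>z. if z \<in> S then u z else 0) (\<lambda>z. if z \<in> S then p z else 0) (\<lambda>z. if z \<in> S then q z else 0)"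
proof -
  have cont: "continuous_on UNIV (\<lambda>z. if z \<in> S then g z else 0)"
    if "continuous_on S g" "\<And>z. z \<in> S - K \<Longrightarrow> g z = 0" for g :: "complex \<Rightarrow> complex"
  proof -
    have "continuous_on (S \<union> - K) (\<lambda>z. if z \<in> S then g z else 0)"
    proof (rule continuous_on_open_Un[OF S])
      show "open (- K)" using K by auto
      show "continuous_on S (\<lambda>z. if z \<in> S then g z else 0)" using that(1) by (simp cong: continuous_on_cong)
      have "continuous_on (- K) (\<lambda>z. 0 :: complex)" by simp
      then show "continuous_on (- K) (\<lambda>z. if z \<in> S then g z else 0)"
        by (rule continuous_on_eq) (use that(2) in auto)
    qed
    moreover have "S \<union> - K = UNIV" using K by auto
    ultimately show ?thesis by simp
  qed
  have "((\<lambda>z. if z \<in> S then u z else 0) has_derivative rlin (if z \<in> S then p z else 0) (if z \<in> S then q z else 0)) (at z)" for z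
  proof (cases "z \<in> S")
    case True
    have "(u has_derivative rlin (p z) (q z)) (at z)" using u True by (auto simp: C1on_def)
    then have "((\<lambda>z. if z \<in> S then u z else 0) has_derivative rlin (p z) (q z)) (at z)"
      by (rule has_derivative_transform_within_open[OF _ S True]) simp
    then show ?thesis using True by simp
  next
    case False
    have "((\<lambda>z. 0 :: complex) has_derivative rlin 0 0) (at z)" by (simp add: rlin_def[abs_def])
    then have "((\<lambda>z. if z \<in> S then u z else 0) has_derivative rlin 0 0) (at z)"
      by (rule has_derivative_transform_within_open[of _ _ _ _ "- K"]) (use False K 0 in auto)
    then show ?thesis using False by simp
  qed
  moreover have "continuous_on UNIV (\<lambda>z. if z \<in> S then p z else 0)" "continuous_on UNIV (\<lambda>z. if z \<in> S then q z else 0)"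
    using u 0 by (intro cont; simp add: C1on_def)+
  ultimately show ?thesis by (simp add: C1on_def)
qed

text \<open>The cut-off stays a separate factor because approximants of \<open>a\<close> do not
  inherit a compact support from it. The product of \<open>\<phi>\<close> with an approximant does
  vanish off \<open>K\<close>, so the C1 identity applies to it; dominated convergence finishes, the
  integrands being bounded through products of two square integrable majorants.\<close>

lemma sob_null_lagrangian:
  assumes S: "open S" "bounded S" and K: "compact K" "K \<subseteq> S"
    and \<phi>: "C1on UNIV \<phi> \<phi>1 \<phi>2" "\<And>z. z \<notin> K \<Longrightarrow> \<phi> z = 0 \<and> \<phi>1 z = 0 \<and> \<phi>2 z = 0"
    and a: "sob S a a1 a2" and b: "sob S b b1 b2"
  shows "(LINT z|lborel_on S. (\<phi> z * a1 z + \<phi>1 z * a z) * b2 z - (\<phi> z * a2 z + \<phi>2 z * a z) * b1 z) = 0"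
proof -
  obtain h U P Q B where 1: "a1 \<in> borel_measurable (lborel_on S)" "a2 \<in> borel_measurable (lborel_on S)"
    "(h::complex\<Rightarrow>real) \<in> borel_measurable (lborel_on S)" "\<And>n::nat. C1on S (U n) (P n) (Q n)"
    "uniform_limit S U a sequentially"
    "\<And>n z. z \<in> S \<Longrightarrow> norm (U n z) \<le> B" "AE z in lborel_on S. \<forall>n. norm (P n z) \<le> h z \<and> norm (Q n z) \<le> h z"
    "AE z in lborel_on S. (\<lambda>n. P n z) \<longlonglongrightarrow> a1 z \<and> (\<lambda>n. Q n z) \<longlonglongrightarrow> a2 z"
    "integrable (lborel_on S) (\<lambda>z. (h z)\<^sup>2)" by (rule sobE[OF a]) blast
  obtain k V R T C where 2: "b1 \<in> borel_measurable (lborel_on S)" "b2 \<in> borel_measurable (lborel_on S)"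
    "(k::complex\<Rightarrow>real) \<in> borel_measurable (lborel_on S)" "\<And>n::nat. C1on S (V n) (R n) (T n)"
    "uniform_limit S V b sequentially"
    "\<And>n z. z \<in> S \<Longrightarrow> norm (V n z) \<le> C" "AE z in lborel_on S. \<forall>n. norm (R n z) \<le> k z \<and> norm (T n z) \<le> k z"
    "AE z in lborel_on S. (\<lambda>n. R n z) \<longlonglongrightarrow> b1 z \<and> (\<lambda>n. T n z) \<longlonglongrightarrow> b2 z"
    "integrable (lborel_on S) (\<lambda>z. (k z)\<^sup>2)" by (rule sobE[OF b]) blast
  have \<phi>c: "continuous_on UNIV \<phi>" "continuous_on UNIV \<phi>1" "continuous_on UNIV \<phi>2"
    using \<phi>(1) C1on_continuous[OF \<phi>(1)] by (auto simp: C1on_def)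
  have bdd: "\<exists>B\<ge>0. \<forall>z. norm (g z) \<le> B" if g: "continuous_on UNIV g" "\<And>z. z \<notin> K \<Longrightarrow> g z = 0" for g :: "complex \<Rightarrow> complex"
  proof -
    obtain B where "\<forall>z\<in>K. norm (g z) \<le> B"
      using compact_imp_bounded[OF compact_continuous_image[OF continuous_on_subset[OF g(1) subset_UNIV] K(1)]]
      by (auto simp: bounded_iff)
    then show ?thesis using g(2) by (intro exI[of _ "\<bar>B\<bar>"]) (metis abs_ge_self abs_ge_zero norm_zero order_trans)
  qed
  obtain B0 where B0: "B0 \<ge> 0" "\<And>z. norm (\<phi> z) \<le> B0" using bdd[OF \<phi>c(1)] \<phi>(2) by auto
  obtain B1 where B1: "B1 \<ge> 0" "\<And>z. norm (\<phi>1 z) \<le> B1" using bdd[OF \<phi>c(2)] \<phi>(2) by auto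
  obtain B2 where B2: "B2 \<ge> 0" "\<And>z. norm (\<phi>2 z) \<le> B2" using bdd[OF \<phi>c(3)] \<phi>(2) by auto
  define D where "D = B0 + B1 + B2"
  have D: "D \<ge> 0" "norm (\<phi> z) \<le> D" "norm (\<phi>1 z) \<le> D" "norm (\<phi>2 z) \<le> D" for z
    using B0 B1 B2 by (auto simp: D_def add_increasing add_increasing2)
  have aC: "continuous_on S a" using sob_continuous[OF a] .
  note [measurable] = continuous_on_measurable_lborel_on[OF aC] 1(1-3) 2(1-3)
     continuous_on_measurable_lborel_on[OF continuous_on_subset[OF \<phi>c(1) subset_UNIV]]
     continuous_on_measurable_lborel_on[OF continuous_on_subset[OF \<phi>c(2) subset_UNIV]]
     continuous_on_measurable_lborel_on[OF continuous_on_subset[OF \<phi>c(3) subset_UNIV]]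
  have [measurable]: "U n \<in> borel_measurable (lborel_on S)" "P n \<in> borel_measurable (lborel_on S)" "Q n \<in> borel_measurable (lborel_on S)"
    "R n \<in> borel_measurable (lborel_on S)" "T n \<in> borel_measurable (lborel_on S)" for n
    using 1(4)[of n] 2(4)[of n] C1on_continuous[OF 1(4)]
    by (auto simp: C1on_def intro!: continuous_on_measurable_lborel_on)
  define I where "I n z = (\<phi> z * P n z + \<phi>1 z * U n z) * T n z - (\<phi> z * Q n z + \<phi>2 z * U n z) * R n z" for n z
  have zero: "(LINT z|lborel_on S. I n z) = 0" for n
  proof -
    let ?A = "\<lambda>z. if z \<in> S then \<phi> z * U n z else 0"
    let ?A1 = "\<lambda>z. if z \<in> S then \<phi>1 z * U n z + \<phi> z * P n z else 0"
    let ?A2 = "\<lambda>z. if z \<in> S then \<phi>2 z * U n z + \<phi> z * Q n z else 0"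
    have "C1on UNIV ?A ?A1 ?A2"
      by (rule C1on_extend_by_zero[OF S(1) compact_imp_closed[OF K(1)] K(2) C1on_mult[OF C1on_subset[OF \<phi>(1) subset_UNIV] 1(4)]])
         (use \<phi>(2) in auto)
    then have "(LINT z:S|lborel. ?A1 z * T n z - ?A2 z * R n z) = 0"
      by (rule null_lagrangian[OF S(1) K, of ?A]) (use \<phi>(2) 2(4) in auto)
    moreover have "(LINT z:S|lborel. ?A1 z * T n z - ?A2 z * R n z) = (LINT z:S|lborel. I n z)"
      by (rule set_lebesgue_integral_cong) (use S in \<open>auto simp: I_def add.commute\<close>)
    ultimately show ?thesis
      using S by (simp add: integral_restrict_space set_lebesgue_integral_def)
  qed
  have "(\<lambda>n. LINT z|lborel_on S. I n z) \<longlonglongrightarrow>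
     (LINT z|lborel_on S. (\<phi> z * a1 z + \<phi>1 z * a z) * b2 z - (\<phi> z * a2 z + \<phi>2 z * a z) * b1 z)"
  proof (rule integral_dominated_convergence)
    show "integrable (lborel_on S) (\<lambda>z. D * ((1 * (h z + \<bar>B\<bar>))\<^sup>2 + (k z)\<^sup>2))"
      by (intro integrable_mult_right Bochner_Integration.integrable_add integrable_square_add 1 2 finite_measure.integrable_const[OF finite_measure_lborel_on[OF S]]) auto
    show "AE z in lborel_on S. (\<lambda>n. I n z) \<longlonglongrightarrow> (\<phi> z * a1 z + \<phi>1 z * a z) * b2 z - (\<phi> z * a2 z + \<phi>2 z * a z) * b1 z"
      using 1(8) 2(8) AE_in_lborel_on unfolding I_def
      by eventually_elim (auto intro!: tendsto_intros tendsto_sob[OF 1(5)])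
    have I_le: "norm (I n z) \<le> D * ((1 * (h z + \<bar>B\<bar>))\<^sup>2 + (k z)\<^sup>2)"
      if z: "z \<in> S" and dom: "\<forall>n. norm (P n z) \<le> h z \<and> norm (Q n z) \<le> h z" "\<forall>n. norm (R n z) \<le> k z \<and> norm (T n z) \<le> k z" for n z
    proof -
      have bnd: "norm (\<phi> z * x + \<zeta> * U n z) * norm y \<le> D * (h z + \<bar>B\<bar>) * k z"
        if "norm x \<le> h z" "norm \<zeta> \<le> D" "norm y \<le> k z" for x y \<zeta>
      proof (rule mult_mono)
        show "norm (\<phi> z * x + \<zeta> * U n z) \<le> D * (h z + \<bar>B\<bar>)"
          unfolding distrib_left
          by (rule norm_triangle_mono) (use that D z 1(6)[OF z, of n] in \<open>auto simp: norm_mult intro!: mult_mono\<close>)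
        show "0 \<le> D * (h z + \<bar>B\<bar>)" using D order_trans[OF norm_ge_zero that(1)] by auto
      qed (use that in auto)
      have "norm (I n z) \<le> D * (h z + \<bar>B\<bar>) * k z + D * (h z + \<bar>B\<bar>) * k z"
        unfolding I_def
        by (rule order_trans[OF norm_triangle_ineq4], unfold norm_mult, intro add_mono bnd) (use D dom in auto)
      also have "\<dots> = D * (2 * (h z + \<bar>B\<bar>) * k z)" by simp
      also have "\<dots> \<le> D * ((1 * (h z + \<bar>B\<bar>))\<^sup>2 + (k z)\<^sup>2)"
        by (rule mult_left_mono[OF _ D(1)]) (use sum_squares_bound[of "h z + \<bar>B\<bar>" "k z"] in simp)
      finally show ?thesis .
    qed
    show "AE z in lborel_on S. norm (I n z) \<le> D * ((1 * (h z + \<bar>B\<bar>))\<^sup>2 + (k z)\<^sup>2)" for n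
      using AE_in_lborel_on 1(7) 2(7) by eventually_elim (rule I_le)
  qed (auto simp: I_def[abs_def])
  then show ?thesis by (simp add: zero LIMSEQ_const_iff)
qed

text \<open>Near \<open>z\<close> the function \<open>W\<close> coincides with the branch
  \<open>Ln (U \<zeta> / U z) + W z\<close>: continuity keeps \<open>W\<close> within distance pi of
  \<open>W z\<close>, and on the corresponding strip \<open>Ln\<close> inverts
  \<open>exp\<close>.\<close>

lemma has_derivative_continuous_logarithm:
  assumes S: "open S" "z \<in> S" and W: "continuous_on S W" "\<And>\<zeta>. \<zeta> \<in> S \<Longrightarrow> exp (W \<zeta>) = U \<zeta>"
    and U: "(U has_derivative rlin p q) (at z)"
  shows "(W has_derivative rlin (p / U z) (q / U z)) (at z)"
proof -
  have Uz: "U z \<noteq> 0" using W(2)[OF S(2)] by (metis exp_not_eq_zero)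
  have "((\<lambda>\<zeta>. Ln (U \<zeta> / U z) + W z) has_derivative (\<lambda>h. rlin p q h / U z)) (at z)"
  proof -
    have "(Ln has_derivative (\<lambda>h. h * 1)) (at (U z / U z))"
      using Uz has_field_derivative_Ln[of 1] by (simp add: has_field_derivative_def lambda_one)
    then have "((\<lambda>\<zeta>. Ln (U \<zeta> / U z)) has_derivative (\<lambda>h. (rlin p q h / U z) * 1)) (at z)"
      by (rule has_derivative_compose[rotated]) (auto intro!: derivative_eq_intros U simp: divide_inverse)
    then show ?thesis by (simp add: has_derivative_add_const)
  qed
  moreover have "(\<lambda>h. rlin p q h / U z) = rlin (p / U z) (q / U z)"
    by (simp add: fun_eq_iff rlin_def add_divide_distrib scaleR_conv_of_real)
  ultimately have D: "((\<lambda>\<zeta>. Ln (U \<zeta> / U z) + W z) has_derivative rlin (p / U z) (q / U z)) (at z)" by simp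
  let ?T = "S \<inter> (\<lambda>\<zeta>. W \<zeta>) -` ball (W z) pi"
  have T: "open ?T" "z \<in> ?T" using continuous_open_preimage[OF W(1) S(1) open_ball] S by auto
  have "Ln (U \<zeta> / U z) + W z = W \<zeta>" if "\<zeta> \<in> ?T" for \<zeta>
  proof -
    have "\<bar>Im (W \<zeta> - W z)\<bar> < pi"
      using that abs_Im_le_cmod[of "W \<zeta> - W z"] by (auto simp: dist_norm norm_minus_commute)
    then have "Ln (exp (W \<zeta> - W z)) = W \<zeta> - W z" by (intro Ln_exp) auto
    moreover have "exp (W \<zeta> - W z) = U \<zeta> / U z" using that S W(2) by (auto simp: exp_diff)
    ultimately show ?thesis by simp
  qed
  then show ?thesis
    by (rule has_derivative_transform_within_open[OF D T])
qed

text \<open>A continuous logarithm need not be a composition with one holomorphic branch. Its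
  approximants \<open>w + Ln (U / g)\<close> are continuous logarithms of the C1 functions
  \<open>U\<close>, hence themselves C1, although neither summand need be.\<close>

lemma sob_log:
  assumes S: "open S" and g: "sob S g p q" and c: "c > 0" "\<And>z. z \<in> S \<Longrightarrow> c \<le> norm (g z)"
    and w: "continuous_on S w" "\<And>z. z \<in> S \<Longrightarrow> exp (w z) = g z" "\<And>z. z \<in> S \<Longrightarrow> norm (w z) \<le> D"
  shows "sob S w (\<lambda>z. p z / g z) (\<lambda>z. q z / g z)"
proof -
  obtain h U P Q B where 1: "p \<in> borel_measurable (lborel_on S)" "q \<in> borel_measurable (lborel_on S)"
    "(h::complex\<Rightarrow>real) \<in> borel_measurable (lborel_on S)" "\<And>n::nat. C1on S (U n) (P n) (Q n)"
    "uniform_limit S U g sequentially"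
    "\<And>n z. z \<in> S \<Longrightarrow> norm (U n z) \<le> B" "AE z in lborel_on S. \<forall>n. norm (P n z) \<le> h z \<and> norm (Q n z) \<le> h z"
    "AE z in lborel_on S. (\<lambda>n. P n z) \<longlonglongrightarrow> p z \<and> (\<lambda>n. Q n z) \<longlonglongrightarrow> q z"
    "integrable (lborel_on S) (\<lambda>z. (h z)\<^sup>2)" by (rule sobE[OF g]) blast
  have gc: "continuous_on S g" by (rule sob_continuous[OF g])
  note [measurable] = continuous_on_measurable_lborel_on[OF gc] 1(1-3)
  have g0: "g z \<noteq> 0" if "z \<in> S" for z using c that by force
  have "isCont Ln 1" by (intro continuous_intros) auto
  then have Ln1: "\<exists>d>0. \<forall>y. dist y 1 < d \<longrightarrow> norm (Ln y) < e" if "e > 0" for e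
    using that unfolding continuous_at_eps_delta by (auto simp: dist_norm)
  have quot: "dist (U n z / g z) 1 < d" if "z \<in> S" "dist (U n z) (g z) < d * c" "d > 0" for n z d
  proof -
    have "U n z / g z - 1 = (U n z - g z) / g z" using g0[OF that(1)] by (simp add: field_simps)
    then have "dist (U n z / g z) 1 = dist (U n z) (g z) / norm (g z)" by (simp add: dist_norm norm_divide)
    also have "\<dots> \<le> dist (U n z) (g z) / c" using c(1) c(2)[OF that(1)] by (intro frac_le) auto
    also have "\<dots> < d" using that c by (simp add: divide_less_eq)
    finally show ?thesis .
  qed
  obtain d1 where d1: "d1 > 0" "\<And>y. dist y 1 < d1 \<Longrightarrow> norm (Ln y) < 1" using Ln1[of 1] by auto
  \<comment> \<open>The bound 1/2 keeps \<open>U / g\<close> off the branch cut of \<open>Ln\<close>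
    and gives \<open>norm U \<ge> c / 2\<close>.\<close>
  define d where "d = min d1 (1/2)"
  have d: "d > 0" "d \<le> 1/2" "\<And>y. dist y 1 < d \<Longrightarrow> norm (Ln y) < 1" using d1 by (auto simp: d_def)
  have "eventually (\<lambda>n. \<forall>z\<in>S. dist (U n z) (g z) < d * c) sequentially"
    using 1(5) c d by (auto simp: uniform_limit_iff)
  then obtain m where m: "\<And>n z. n \<ge> m \<Longrightarrow> z \<in> S \<Longrightarrow> dist (U n z) (g z) < d * c"
    by (auto simp: eventually_sequentially)
  have near: "dist (U (n + m) z / g z) 1 < d" if "z \<in> S" for n z
    using quot[OF that m[OF _ that] d(1)] by simp
  have Re: "Re (U (n + m) z / g z) > 0" if "z \<in> S" for n z
    using near[OF that, of n] d(2) abs_Re_le_cmod[of "U (n + m) z / g z - 1"] by (simp add: dist_norm)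
  have U0: "U (n + m) z \<noteq> 0" if "z \<in> S" for n z using Re[OF that, of n] by auto
  have Uc: "c / 2 \<le> norm (U (n + m) z)" if "z \<in> S" for n z
  proof -
    have "norm (g z) - norm (U (n + m) z) \<le> d * c"
      using m[of "n + m" z] that norm_triangle_ineq2[of "g z" "U (n + m) z"] by (simp add: dist_norm norm_minus_commute)
    moreover have "d * c \<le> 1/2 * c" by (rule mult_right_mono) (use d c in auto)
    ultimately show ?thesis using c(2)[OF that] by linarith
  qed
  let ?W = "\<lambda>n z. w z + Ln (U (n + m) z / g z)"
  have cW: "continuous_on S (?W n)" for n
    by (intro continuous_intros w(1) gc C1on_continuous[OF 1(4)]) (use g0 Re in \<open>auto simp: complex_nonpos_Reals_iff not_le\<close>)
  have eW: "exp (?W n z) = U (n + m) z" if "z \<in> S" for n z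
    using that U0 g0 by (simp add: exp_add w(2))
  show ?thesis
  proof (rule sobI[of _ S _ "\<lambda>z. 2 / c * h z" ?W "\<lambda>n z. P (n + m) z / U (n + m) z" "\<lambda>n z. Q (n + m) z / U (n + m) z" _ "D + 1"])
    show "(\<lambda>z. p z / g z) \<in> borel_measurable (lborel_on S)" "(\<lambda>z. q z / g z) \<in> borel_measurable (lborel_on S)"
      "(\<lambda>z. 2 / c * h z) \<in> borel_measurable (lborel_on S)" by measurable
    show "AE z in lborel_on S. (\<lambda>n. P (n + m) z / U (n + m) z) \<longlonglongrightarrow> p z / g z \<and> (\<lambda>n. Q (n + m) z / U (n + m) z) \<longlonglongrightarrow> q z / g z"
      using 1(8) AE_in_lborel_on
    proof eventually_elim
      case (elim z)
      then show ?case using g0[of z] LIMSEQ_ignore_initial_segment[of "\<lambda>n. P n z" _ m] LIMSEQ_ignore_initial_segment[of "\<lambda>n. Q n z" _ m]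
        LIMSEQ_ignore_initial_segment[OF tendsto_sob[OF 1(5)], of z m]
        by (auto intro!: tendsto_divide)
    qed
    show "integrable (lborel_on S) (\<lambda>z. (2 / c * h z)\<^sup>2)" unfolding power_mult_distrib using 1(9) by simp
    have quot_le: "norm (x / U (n + m) z) \<le> 2 / c * h z" if "z \<in> S" "norm x \<le> h z" for n z x
    proof -
      have "norm (x / U (n + m) z) \<le> h z / (c / 2)"
        unfolding norm_divide by (rule frac_le) (use that Uc c order_trans[OF norm_ge_zero that(2)] in auto)
      then show ?thesis by (simp add: field_simps)
    qed
    show "AE z in lborel_on S. \<forall>n. norm (P (n + m) z / U (n + m) z) \<le> 2 / c * h z \<and> norm (Q (n + m) z / U (n + m) z) \<le> 2 / c * h z"
      using AE_in_lborel_on 1(7) by eventually_elim (blast intro: quot_le)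
    show "norm (?W n z) \<le> D + 1" if "z \<in> S" for n z
      by (rule norm_triangle_mono[OF w(3)[OF that]]) (use d(3)[OF near[OF that]] in \<open>auto intro: less_imp_le\<close>)
    have "(?W n has_derivative rlin (P (n + m) z / U (n + m) z) (Q (n + m) z / U (n + m) z)) (at z)" if "z \<in> S" for n z
      by (rule has_derivative_continuous_logarithm[OF S that cW eW]) (use 1(4)[of "n + m"] that in \<open>auto simp: C1on_def\<close>)
    moreover have "continuous_on S (P n)" "continuous_on S (Q n)" "continuous_on S (U n)" for n
      using 1(4) C1on_continuous[OF 1(4)] by (auto simp: C1on_def)
    ultimately show "C1on S (?W n) (\<lambda>z. P (n + m) z / U (n + m) z) (\<lambda>z. Q (n + m) z / U (n + m) z)" for n
      using U0 unfolding C1on_def by (auto intro!: continuous_on_divide)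
    show "uniform_limit S ?W w sequentially"
      unfolding uniform_limit_iff
    proof (intro allI impI)
      fix e :: real assume "e > 0"
      then obtain d' where d': "d' > 0" "\<And>y. dist y 1 < d' \<Longrightarrow> norm (Ln y) < e" using Ln1 by blast
      have "eventually (\<lambda>n. \<forall>z\<in>S. dist (U n z) (g z) < d' * c) sequentially"
        using 1(5) c d' by (auto simp: uniform_limit_iff)
      then have "eventually (\<lambda>n. \<forall>z\<in>S. dist (U (n + m) z) (g z) < d' * c) sequentially"
        by (rule sequentially_offset)
      then show "eventually (\<lambda>n. \<forall>z\<in>S. dist (?W n z) (w z) < e) sequentially"
        by eventually_elim (auto simp: dist_norm intro!: d'(2) quot[unfolded dist_norm] d'(1))
    qed
  qed
qed

section \<open>Cut-off functions and squares\<close>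

definition clip01 :: "real \<Rightarrow> real" where "clip01 t = max 0 (min 1 t)"

lemma clip01_bounds [simp]: "0 \<le> clip01 t" "clip01 t \<le> 1"
  by (auto simp: clip01_def)

lemma clip01_eq [simp]: "t \<le> 0 \<Longrightarrow> clip01 t = 0" "t \<ge> 1 \<Longrightarrow> clip01 t = 1"
  by (auto simp: clip01_def)

lemma continuous_on_clip01 [continuous_intros]:
  "continuous_on S f \<Longrightarrow> continuous_on S (\<lambda>x. clip01 (f x))"
  unfolding clip01_def by (intro continuous_intros)

text \<open>Only points outside the open unit interval need care. There \<open>P'\<close> vanishes
  at the clamped point, so increments of \<open>P\<close> are below any positive multiple of the
  increment of \<open>clip01\<close>, and \<open>clip01\<close> is 1-Lipschitz.\<close>

lemma DERIV_clip01:
  assumes P: "\<And>x. (P has_real_derivative P' x) (at x)" and P': "P' 0 = 0" "P' 1 = 0"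
  shows "((\<lambda>t. P (clip01 t)) has_real_derivative P' (clip01 t)) (at t)"
proof (cases "0 < t \<and> t < 1")
  case True
  have "(P has_real_derivative P' (clip01 t)) (at t)" using P[of t] True by (simp add: clip01_def)
  then show ?thesis
    by (rule has_field_derivative_transform_within_open[where S = "{0<..<1}"]) (use True in \<open>auto simp: clip01_def\<close>)
next
  case False
  then have c: "P' (clip01 t) = 0" using P' by (auto simp: clip01_def)
  have "(P has_derivative (\<lambda>h. 0)) (at (clip01 t))"
    using P[of "clip01 t"] by (simp add: has_field_derivative_def c lambda_zero)
  then have "\<forall>e>0. \<exists>d>0. \<forall>y. \<bar>y - clip01 t\<bar> < d \<longrightarrow> \<bar>P y - P (clip01 t)\<bar> \<le> e * \<bar>y - clip01 t\<bar>"
    by (simp add: has_derivative_at_alt)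
  moreover have "\<bar>clip01 y - clip01 t\<bar> \<le> \<bar>y - t\<bar>" for y by (auto simp: clip01_def)
  ultimately have "\<forall>e>0. \<exists>d>0. \<forall>y. \<bar>y - t\<bar> < d \<longrightarrow> \<bar>P (clip01 y) - P (clip01 t)\<bar> \<le> e * \<bar>y - t\<bar>"
    by (meson mult_left_mono less_imp_le order_trans le_less_trans)
  then show ?thesis
    by (simp add: has_field_derivative_def has_derivative_at_alt c flip: lambda_zero)
qed

text \<open>The cubic Hermite step 3 x^2 - 2 x^3 in the clamped variable; its derivative vanishes at
  both ends, which makes the clamped function C1.\<close>

definition smoothstep :: "real \<Rightarrow> real" where
  "smoothstep t = (clip01 t)\<^sup>2 * (3 - 2 * clip01 t)"

definition smoothstep' :: "real \<Rightarrow> real" where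
  "smoothstep' t = 6 * clip01 t * (1 - clip01 t)"

lemma DERIV_smoothstep: "(smoothstep has_real_derivative smoothstep' t) (at t)"
  unfolding smoothstep_def[abs_def] smoothstep'_def
  by (rule DERIV_clip01[where P = "\<lambda>x. x\<^sup>2 * (3 - 2 * x)" and P' = "\<lambda>x. 6 * x * (1 - x)"])
     (auto intro!: derivative_eq_intros simp: algebra_simps power2_eq_square)

lemma smoothstep_eq [simp]: "t \<le> 0 \<Longrightarrow> smoothstep t = 0" "t \<ge> 1 \<Longrightarrow> smoothstep t = 1"
  by (auto simp: smoothstep_def)

lemma smoothstep'_eq [simp]: "t \<le> 0 \<Longrightarrow> smoothstep' t = 0" "t \<ge> 1 \<Longrightarrow> smoothstep' t = 0"
  by (auto simp: smoothstep'_def)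

lemma smoothstep_bounds: "0 \<le> smoothstep t" "smoothstep t \<le> 1"
proof -
  have *: "0 \<le> x\<^sup>2 * (3 - 2 * x) \<and> x\<^sup>2 * (3 - 2 * x) \<le> 1" if "0 \<le> x" "x \<le> 1" for x :: real
  proof -
    have "1 - x\<^sup>2 * (3 - 2 * x) = (1 - x)\<^sup>2 * (1 + 2 * x)"
      by (simp add: algebra_simps power2_eq_square)
    also have "\<dots> \<ge> 0" using that by simp
    finally show ?thesis using that by simp
  qed
  then show "0 \<le> smoothstep t" "smoothstep t \<le> 1" using *[of "clip01 t"] by (auto simp: smoothstep_def)
qed

lemma smoothstep'_bounds: "0 \<le> smoothstep' t" "smoothstep' t \<le> 2"
proof -
  have "clip01 t * (1 - clip01 t) \<le> 1/4"
    using zero_le_power2[of "clip01 t - 1/2"] by (simp add: power2_eq_square algebra_simps)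
  then show "smoothstep' t \<le> 2" by (simp add: smoothstep'_def)
qed (simp add: smoothstep'_def)

lemma continuous_on_smoothstep' [continuous_intros]:
  "continuous_on S f \<Longrightarrow> continuous_on S (\<lambda>x. smoothstep' (f x))"
  unfolding smoothstep'_def by (intro continuous_intros)

lemma continuous_on_smoothstep [continuous_intros]:
  "continuous_on S f \<Longrightarrow> continuous_on S (\<lambda>x. smoothstep (f x))"
  unfolding smoothstep_def by (intro continuous_intros)

text \<open>The maximum norm of the plane. Its spheres are made of coordinate segments, so energies
  along them are slices of an area integral.\<close>

definition supn :: "complex \<Rightarrow> real" where "supn z = max \<bar>Re z\<bar> \<bar>Im z\<bar>"

lemma continuous_on_supn [continuous_intros]:
  "continuous_on S f \<Longrightarrow> continuous_on S (\<lambda>x. supn (f x))"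
  unfolding supn_def by (intro continuous_intros)

lemma supn_bounds: "supn z \<le> norm z" "norm z \<le> 2 * supn z" "0 \<le> supn z"
  using abs_Re_le_cmod[of z] abs_Im_le_cmod[of z] cmod_le[of z] by (auto simp: supn_def)

lemma supn_triangle: "supn (z + w) \<le> supn z + supn w"
  by (auto simp: supn_def)

lemma supn_minus: "supn (z - w) = supn (w - z)" "supn (- z) = supn z"
  by (auto simp: supn_def)

lemma supn_scaleR: "supn (c *\<^sub>R z) = \<bar>c\<bar> * supn z"
  by (auto simp: supn_def abs_mult max_mult_distrib_left)

lemma supn_eq_0 [simp]: "supn z = 0 \<longleftrightarrow> z = 0" "supn 0 = 0"
  by (auto simp: supn_def complex_eq_iff max_def)

definition sq :: "real \<Rightarrow> complex set" where "sq r = {z. supn z < r}"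

definition csq :: "real \<Rightarrow> complex set" where "csq r = {z. supn z \<le> r}"

lemma open_sq [simp]: "open (sq r)"
  unfolding sq_def by (intro open_Collect_less continuous_intros)

lemma closed_csq: "closed (csq r)"
  unfolding csq_def by (intro closed_Collect_le continuous_intros)

lemma bounded_csq [simp]: "bounded (csq r)"
proof -
  have "norm z \<le> 2 * r" if "z \<in> csq r" for z using that supn_bounds[of z] by (auto simp: csq_def)
  then show ?thesis by (auto simp: bounded_iff)
qed

lemma compact_csq [simp]: "compact (csq r)"
  by (simp add: compact_eq_bounded_closed closed_csq)

lemma sq_subset_csq: "sq r \<subseteq> csq r" by (auto simp: sq_def csq_def)

lemma bounded_sq [simp]: "bounded (sq r)"
  using bounded_csq sq_subset_csq by (rule bounded_subset)

lemma measure_csq_le: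
  assumes "r \<ge> 0" shows "emeasure lborel (csq r) \<le> ennreal (4 * r\<^sup>2)" "measure lborel (csq r) \<le> 4 * r\<^sup>2"
proof -
  have "csq r = cbox (Complex (-r) (-r)) (Complex r r)"
    by (auto simp: csq_def supn_def in_cbox_complex_iff abs_le_iff)
  then show "measure lborel (csq r) \<le> 4 * r\<^sup>2"
    using assms by (simp add: measure_lborel_cbox_eq Basis_complex_def power2_eq_square)
  then show "emeasure lborel (csq r) \<le> ennreal (4 * r\<^sup>2)"
    using emeasure_compact_finite[OF compact_csq, of r]
    by (subst emeasure_eq_ennreal_measure) (auto intro: ennreal_leI)
qed

text \<open>Built from the square of \<open>x\<close>, since the absolute value is not
  differentiable at 0. For \<open>0 \<le> r < R\<close> the argument of \<open>smoothstep\<close> is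
  at least 1 when |x| is at most \<open>r\<close>, and at most 0 when |x| is at least
  \<open>R\<close>.\<close>

definition cut1 :: "real \<Rightarrow> real \<Rightarrow> real \<Rightarrow> real" where
  "cut1 r R x = smoothstep ((R\<^sup>2 - x\<^sup>2) / (R\<^sup>2 - r\<^sup>2))"

definition cut1' :: "real \<Rightarrow> real \<Rightarrow> real \<Rightarrow> real" where
  "cut1' r R x = smoothstep' ((R\<^sup>2 - x\<^sup>2) / (R\<^sup>2 - r\<^sup>2)) * (- 2 * x / (R\<^sup>2 - r\<^sup>2))"

lemma DERIV_cut1:
  shows "(cut1 r R has_real_derivative cut1' r R x) (at x)"
  unfolding cut1_def[abs_def] cut1'_def divide_inverse
  by (rule DERIV_chain2[OF DERIV_smoothstep]) (auto intro!: derivative_eq_intros)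

lemma continuous_on_cut1' [continuous_intros]: "continuous_on S f \<Longrightarrow> continuous_on S (\<lambda>x. cut1' r R (f x))"
  unfolding cut1'_def divide_inverse by (intro continuous_intros)

lemma continuous_on_cut1 [continuous_intros]: "continuous_on S f \<Longrightarrow> continuous_on S (\<lambda>x. cut1 r R (f x))"
  unfolding cut1_def divide_inverse by (intro continuous_intros)

lemma cut1_props:
  assumes "0 \<le> r" "r < R"
  shows "\<bar>x\<bar> \<le> r \<Longrightarrow> cut1 r R x = 1 \<and> cut1' r R x = 0"
    and "\<bar>x\<bar> \<ge> R \<Longrightarrow> cut1 r R x = 0 \<and> cut1' r R x = 0"
    and "0 \<le> cut1 r R x" "cut1 r R x \<le> 1"
    and "\<bar>cut1' r R x\<bar> \<le> 4 * R / (R\<^sup>2 - r\<^sup>2)"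
proof -
  have pos: "R\<^sup>2 - r\<^sup>2 > 0" using power_strict_mono[of r R 2] assms by simp
  show 1: "\<bar>x\<bar> \<le> r \<Longrightarrow> cut1 r R x = 1 \<and> cut1' r R x = 0"
    using pos abs_le_square_iff[of x r] assms by (auto simp: cut1_def cut1'_def)
  show 2: "\<bar>x\<bar> \<ge> R \<Longrightarrow> cut1 r R x = 0 \<and> cut1' r R x = 0"
    using pos abs_le_square_iff[of R x] assms by (auto simp: cut1_def cut1'_def divide_nonpos_pos)
  show "0 \<le> cut1 r R x" "cut1 r R x \<le> 1" by (auto simp: cut1_def smoothstep_bounds)
  show "\<bar>cut1' r R x\<bar> \<le> 4 * R / (R\<^sup>2 - r\<^sup>2)"
  proof (cases "\<bar>x\<bar> \<ge> R")
    case True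
    then show ?thesis using 2 pos assms by simp
  next
    case False
    have "\<bar>cut1' r R x\<bar> = smoothstep' ((R\<^sup>2 - x\<^sup>2) / (R\<^sup>2 - r\<^sup>2)) * (2 * \<bar>x\<bar> / (R\<^sup>2 - r\<^sup>2))"
      using pos smoothstep'_bounds by (simp add: cut1'_def abs_mult)
    also have "\<dots> \<le> 2 * (2 * R / (R\<^sup>2 - r\<^sup>2))"
      using pos False smoothstep'_bounds by (intro mult_mono divide_right_mono) auto
    finally show ?thesis by simp
  qed
qed

definition cut :: "real \<Rightarrow> real \<Rightarrow> complex \<Rightarrow> real" where
  "cut r R z = cut1 r R (Re z) * cut1 r R (Im z)"

definition cutx :: "real \<Rightarrow> real \<Rightarrow> complex \<Rightarrow> real" where
  "cutx r R z = cut1' r R (Re z) * cut1 r R (Im z)"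

definition cuty :: "real \<Rightarrow> real \<Rightarrow> complex \<Rightarrow> real" where
  "cuty r R z = cut1 r R (Re z) * cut1' r R (Im z)"

lemma C1on_of_real:
  assumes "\<And>z. z \<in> S \<Longrightarrow> (f has_derivative (\<lambda>h. Re h * p z + Im h * q z)) (at z)" "continuous_on S p" "continuous_on S q"
  shows "C1on S (\<lambda>z. complex_of_real (f z)) (\<lambda>z. of_real (p z)) (\<lambda>z. of_real (q z))"
  using assms unfolding C1on_def
  by (auto intro!: continuous_intros has_derivative_eq_rhs[OF has_derivative_of_real] simp: rlin_def fun_eq_iff scaleR_conv_of_real)

lemma C1on_cut: "C1on S (\<lambda>z. complex_of_real (cut r R z)) (\<lambda>z. of_real (cutx r R z)) (\<lambda>z. of_real (cuty r R z))"
proof (rule C1on_of_real)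
  show "(cut r R has_derivative (\<lambda>h. Re h * cutx r R z + Im h * cuty r R z)) (at z)" for z
  proof -
    have 1: "((\<lambda>z. cut1 r R (Re z)) has_derivative (\<lambda>h. Re h * cut1' r R (Re z))) (at z)"
      using has_derivative_compose[OF has_derivative_Re[OF has_derivative_ident] DERIV_cut1[unfolded has_field_derivative_def]]
      by (simp add: mult.commute)
    have 2: "((\<lambda>z. cut1 r R (Im z)) has_derivative (\<lambda>h. Im h * cut1' r R (Im z))) (at z)"
      using has_derivative_compose[OF has_derivative_Im[OF has_derivative_ident] DERIV_cut1[unfolded has_field_derivative_def]]
      by (simp add: mult.commute)
    show ?thesis unfolding cut_def[abs_def] cutx_def cuty_def
      by (rule has_derivative_eq_rhs[OF has_derivative_mult[OF 1 2]]) (simp add: fun_eq_iff algebra_simps)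
  qed
qed (auto simp: cutx_def[abs_def] cuty_def[abs_def] intro!: continuous_intros)

lemma cut_props:
  assumes "0 \<le> r" "r < R"
  shows "supn z \<le> r \<Longrightarrow> cut r R z = 1 \<and> cutx r R z = 0 \<and> cuty r R z = 0"
    and "supn z \<ge> R \<Longrightarrow> cut r R z = 0 \<and> cutx r R z = 0 \<and> cuty r R z = 0"
    and "0 \<le> cut r R z" "cut r R z \<le> 1"
    and "\<bar>cutx r R z\<bar> \<le> 4 * R / (R\<^sup>2 - r\<^sup>2)" "\<bar>cuty r R z\<bar> \<le> 4 * R / (R\<^sup>2 - r\<^sup>2)"
proof -
  note * = cut1_props[OF assms]
  show "supn z \<le> r \<Longrightarrow> cut r R z = 1 \<and> cutx r R z = 0 \<and> cuty r R z = 0"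
    using *(1) by (auto simp: supn_def cut_def cutx_def cuty_def)
  show "supn z \<ge> R \<Longrightarrow> cut r R z = 0 \<and> cutx r R z = 0 \<and> cuty r R z = 0"
    using *(2)[of "Re z"] *(2)[of "Im z"] by (auto simp: supn_def cut_def cutx_def cuty_def le_max_iff_disj)
  show "0 \<le> cut r R z" "cut r R z \<le> 1" using *(3,4) by (auto simp: cut_def mult_le_one)
  have "\<bar>cutx r R z\<bar> \<le> 4 * R / (R\<^sup>2 - r\<^sup>2) * 1"
    unfolding cutx_def abs_mult by (rule mult_mono) (use *(3,4,5) order_trans[OF abs_ge_zero *(5)] in auto)
  moreover have "\<bar>cuty r R z\<bar> \<le> 1 * (4 * R / (R\<^sup>2 - r\<^sup>2))"
    unfolding cuty_def abs_mult by (rule mult_mono) (use *(3,4,5) in auto)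
  ultimately show "\<bar>cutx r R z\<bar> \<le> 4 * R / (R\<^sup>2 - r\<^sup>2)" "\<bar>cuty r R z\<bar> \<le> 4 * R / (R\<^sup>2 - r\<^sup>2)" by auto
qed

text \<open>\<open>Im (cnj p * q)\<close> is the Jacobian determinant of a map with partials \<open>p\<close> and \<open>q\<close>.\<close>

definition distortion :: "real \<Rightarrow> complex set \<Rightarrow> (complex \<Rightarrow> complex) \<Rightarrow> (complex \<Rightarrow> complex) \<Rightarrow> bool" where
  "distortion K S p q \<longleftrightarrow> (AE z in lborel_on S. (norm (p z))\<^sup>2 + (norm (q z))\<^sup>2 \<le> K * Im (cnj (p z) * q z))"

lemma sob_Re: assumes "sob S u p q" shows "sob S (\<lambda>z. of_real (Re (u z))) (\<lambda>z. of_real (Re (p z))) (\<lambda>z. of_real (Re (q z)))"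
proof -
  obtain B where B: "\<And>z. z \<in> S \<Longrightarrow> norm (u z) \<le> B" using sob_bounded[OF assms] by blast
  have "C1on UNIV (\<lambda>w. of_real (Re w)) (\<lambda>_. 1) (\<lambda>_. 0)"
    by (auto simp: C1on_def rlin_def scaleR_conv_of_real intro!: derivative_eq_intros)
  from sob_compose[OF assms compact_cball[of 0 B] subset_UNIV open_UNIV _ this] B
  show ?thesis by (simp add: rlin_def scaleR_conv_of_real)
qed

lemma sob_Im: assumes "sob S u p q" shows "sob S (\<lambda>z. of_real (Im (u z))) (\<lambda>z. of_real (Im (p z))) (\<lambda>z. of_real (Im (q z)))"
proof -
  obtain B where B: "\<And>z. z \<in> S \<Longrightarrow> norm (u z) \<le> B" using sob_bounded[OF assms] by blast
  have "C1on UNIV (\<lambda>w. of_real (Im w)) (\<lambda>_. 0) (\<lambda>_. 1)"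
    by (auto simp: C1on_def rlin_def scaleR_conv_of_real intro!: derivative_eq_intros)
  from sob_compose[OF assms compact_cball[of 0 B] subset_UNIV open_UNIV _ this] B
  show ?thesis by (simp add: rlin_def scaleR_conv_of_real)
qed

text \<open>An open set of measure zero is empty. This upgrades an almost everywhere inequality for
  a continuous function to one at every point.\<close>

lemma AE_lborel_on_open_imp:
  assumes "AE z in lborel_on S. P z" "open S" "open {z \<in> S. \<not> P z}" "z \<in> S"
  shows "P z"
proof (rule ccontr)
  assume "\<not> P z"
  have "AE z in lborel. \<not> (z \<in> S \<and> \<not> P z)"
    using assms by (auto simp: AE_restrict_space_iff)
  moreover have "{z \<in> S. \<not> P z} \<in> sets lborel" using assms by auto
  ultimately have "{z \<in> S. \<not> P z} \<in> null_sets lborel"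
    using AE_iff_null_sets[of "{z \<in> S. \<not> P z}" lborel] by auto
  then have "negligible {z \<in> S. \<not> P z}" using assms(3) by (simp add: negligible_iff_null_sets null_sets_completionI)
  then show False using open_not_negligible[OF assms(3)] assms(4) \<open>\<not> P z\<close> by auto
qed

lemma integral_lborel_on_cong:
  "(\<And>z. z \<in> S \<Longrightarrow> f z = g z) \<Longrightarrow> integral\<^sup>L (lborel_on S) f = integral\<^sup>L (lborel_on S) g"
  by (rule Bochner_Integration.integral_cong) (auto simp: space_restrict_space)

section \<open>Maximum principle and Caccioppoli inequality\<close>

lemma DERIV_max_0_square: "((\<lambda>x::real. (max 0 x)\<^sup>2) has_real_derivative 2 * max 0 x) (at x)"
proof -
  consider "x > 0" | "x < 0" | "x = 0" by linarith
  then show ?thesis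
  proof cases
    case 1
    have "((\<lambda>x. x\<^sup>2) has_real_derivative 2 * x) (at x)" by (auto intro!: derivative_eq_intros)
    then have "((\<lambda>x. (max 0 x)\<^sup>2) has_real_derivative 2 * x) (at x)"
      by (rule has_field_derivative_transform_within_open[where S = "{0<..}"]) (use 1 in auto)
    then show ?thesis using 1 by simp
  next
    case 2
    have "((\<lambda>x. 0::real) has_real_derivative 0) (at x)" by (auto intro!: derivative_eq_intros)
    then have "((\<lambda>x. (max 0 x)\<^sup>2) has_real_derivative 0) (at x)"
      by (rule has_field_derivative_transform_within_open[where S = "{..<0}"]) (use 2 in auto)
    then show ?thesis using 2 by simp
  next
    case 3
    have "\<bar>(max 0 y)\<^sup>2\<bar> \<le> e * \<bar>y\<bar>" if "\<bar>y\<bar> < e" for y e :: real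
    proof -
      have "(max 0 y)\<^sup>2 \<le> \<bar>y\<bar> * \<bar>y\<bar>" by (auto simp: max_def power2_eq_square)
      also have "\<dots> \<le> e * \<bar>y\<bar>" using that by (intro mult_right_mono) auto
      finally show ?thesis by simp
    qed
    then show ?thesis unfolding has_field_derivative_def has_derivative_at_alt 3
      by (auto simp flip: lambda_zero)
  qed
qed

text \<open>Let \<open>m\<close> be the positive part of \<open>Re u - t\<close>. Since its square
  vanishes near the boundary, the Jacobian of \<open>m\<^sup>2\<close> and \<open>Im u\<close> has
  integral zero; this Jacobian is \<open>2 * m\<close> times the Jacobian J of \<open>u\<close>,
  which is nonnegative. So \<open>m\<close> times J is zero almost everywhere, distortion makes the
  gradient of \<open>m\<^sup>2\<close> vanish, and a compactly supported function without gradient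
  is zero.\<close>

lemma sob_max_principle:
  assumes r: "r > 0" and K: "K > 0" and cont: "continuous_on (csq r) u" and u: "sob (sq r) u p q"
    and dist: "distortion K (sq r) p q" and bd: "\<And>z. supn z = r \<Longrightarrow> Re (u z) \<le> c" and z: "z \<in> csq r"
  shows "Re (u z) \<le> c"
proof (rule field_le_epsilon)
  fix e :: real assume e: "e > 0"
  \<comment> \<open>The margin \<open>e\<close> pushes the compact set where
    \<open>Re u \<ge> t\<close> strictly inside the square, which leaves room for a cut-off equal to
    1 on it.\<close>
  define t where "t = c + e"
  define M where "M = csq r \<inter> u -` {w. t \<le> Re w}"
  have "closed {w. t \<le> Re w}" by (intro closed_Collect_le continuous_intros)
  then have "compact M"
    unfolding M_def compact_eq_bounded_closed
    by (intro conjI continuous_closed_preimage[OF cont closed_csq] bounded_subset[OF bounded_csq Int_lower1])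
  have Mlt: "supn x < r" if "x \<in> M" for x
    using that bd[of x] e by (force simp: M_def csq_def t_def)
  obtain r1 where r1: "0 \<le> r1" "r1 < r" "\<And>x. x \<in> M \<Longrightarrow> supn x \<le> r1"
  proof (cases "M = {}")
    case True then show thesis using that[of 0] r by auto
  next
    case False
    obtain x where "x \<in> M" "\<And>y. y \<in> M \<Longrightarrow> supn y \<le> supn x"
      using continuous_attains_sup[OF \<open>compact M\<close> False continuous_on_supn[OF continuous_on_id]] by blast
    then show thesis using that[of "supn x"] Mlt supn_bounds by auto
  qed
  define r2 where "r2 = (r1 + r) / 2"
  have r2: "r1 < r2" "r2 < r" using r1 by (auto simp: r2_def)
  define m where "m z = max 0 (Re (u z) - t)" for z
  have m0: "m z = 0" if "z \<in> csq r" "supn z > r1" for z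
  proof -
    have "z \<notin> M" using r1(3)[of z] that by auto
    then show ?thesis using that by (auto simp: M_def m_def)
  qed
  obtain B where B: "\<And>z. z \<in> sq r \<Longrightarrow> norm (u z) \<le> B" using sob_bounded[OF u] by blast
  \<comment> \<open>Squaring makes the positive part continuously differentiable, as the chain rule
    for \<open>sob\<close> requires.\<close>
  have C1: "C1on UNIV (\<lambda>w. of_real ((max 0 (Re w - t))\<^sup>2)) (\<lambda>w. of_real (2 * max 0 (Re w - t))) (\<lambda>_. of_real 0)"
  proof (rule C1on_of_real)
    fix w
    show "((\<lambda>w. (max 0 (Re w - t))\<^sup>2) has_derivative (\<lambda>h. Re h * (2 * max 0 (Re w - t)) + Im h * 0)) (at w)"
    proof -
      have "((\<lambda>w. Re w - t) has_derivative Re) (at w)"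
        by (auto intro!: derivative_eq_intros simp: fun_eq_iff)
      from has_derivative_compose[OF this DERIV_max_0_square[unfolded has_field_derivative_def]] show ?thesis
        by (simp add: mult.commute)
    qed
  qed (auto intro!: continuous_intros)
  define a where "a z = complex_of_real ((m z)\<^sup>2)" for z
  have a: "sob (sq r) a (\<lambda>z. of_real (2 * m z * Re (p z))) (\<lambda>z. of_real (2 * m z * Re (q z)))"
    using sob_compose[OF u compact_cball[of 0 B] subset_UNIV open_UNIV _ C1] B
    by (simp add: rlin_def scaleR_conv_of_real a_def[abs_def] m_def mult_ac)
  have K2: "compact (csq r2)" "csq r2 \<subseteq> sq r" by (rule compact_csq, use r2 in \<open>auto simp: csq_def sq_def\<close>)
  let ?c = "cut r1 r2"
  have c0: "complex_of_real (?c z) = 0 \<and> complex_of_real (cutx r1 r2 z) = 0 \<and> complex_of_real (cuty r1 r2 z) = 0" if "z \<notin> csq r2" for z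
    using cut_props(2)[of r1 r2 z] r1 r2 that by (auto simp: csq_def)
  have dc: "cutx r1 r2 z * m z = 0" "cuty r1 r2 z * m z = 0" "?c z * m z = m z" if "z \<in> sq r" for z
  proof -
    have "supn z \<le> r1 \<or> m z = 0" using m0[of z] that sq_subset_csq[of r] by force
    then show "cutx r1 r2 z * m z = 0" "cuty r1 r2 z * m z = 0" "?c z * m z = m z"
      using cut_props(1)[of r1 r2 z] r1 r2 by auto
  qed
  have mm: "m z \<ge> 0" for z by (simp add: m_def)
  have mc: "continuous_on (sq r) (\<lambda>z. complex_of_real (m z))"
    unfolding m_def by (intro continuous_intros sob_continuous[OF u])
  have [measurable]: "p \<in> borel_measurable (lborel_on (sq r))" "q \<in> borel_measurable (lborel_on (sq r))"
    using u by (auto simp: sob_def)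
  have [measurable]: "m \<in> borel_measurable (lborel_on (sq r))"
    using measurable_compose[OF continuous_on_measurable_lborel_on[OF mc] borel_measurable_Re] by simp
  have [measurable]: "(\<lambda>z. complex_of_real (?c z)) \<in> borel_measurable (lborel_on (sq r))"
    "(\<lambda>z. complex_of_real (cutx r1 r2 z)) \<in> borel_measurable (lborel_on (sq r))"
    "(\<lambda>z. complex_of_real (cuty r1 r2 z)) \<in> borel_measurable (lborel_on (sq r))"
    "a \<in> borel_measurable (lborel_on (sq r))"
    "(\<lambda>z. complex_of_real (Re z)) \<in> borel_measurable (lborel_on (sq r))"
    using C1on_cut[of "sq r" r1 r2] C1on_continuous[OF C1on_cut[of "sq r" r1 r2]] sob_continuous[OF a]
    by (auto simp: C1on_def intro!: continuous_on_measurable_lborel_on continuous_intros)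
  have J: "AE z in lborel_on (sq r). m z * Im (cnj (p z) * q z) = 0"
  proof -
    have "(LINT z|lborel_on (sq r). complex_of_real (2 * m z * Im (cnj (p z) * q z))) = 0"
    proof -
      have N0: "(LINT z|lborel_on (sq r). (complex_of_real (?c z) * of_real (2 * m z * Re (p z)) + of_real (cutx r1 r2 z) * a z) * of_real (Im (q z))
         - (complex_of_real (?c z) * of_real (2 * m z * Re (q z)) + of_real (cuty r1 r2 z) * a z) * of_real (Im (p z))) = 0"
        by (rule sob_null_lagrangian[OF _ _ K2 C1on_cut c0 a sob_Im[OF u]]) auto
      have N1: "(complex_of_real (?c z) * of_real (2 * m z * Re (p z)) + of_real (cutx r1 r2 z) * a z) * of_real (Im (q z))
         - (complex_of_real (?c z) * of_real (2 * m z * Re (q z)) + of_real (cuty r1 r2 z) * a z) * of_real (Im (p z)) = of_real (2 * m z * Im (cnj (p z) * q z))"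
        if "z \<in> sq r" for z
      proof -
        have "(?c z * (2 * m z * Re (p z)) + (cutx r1 r2 z) * (m z)\<^sup>2) * (Im (q z))
           - (?c z * (2 * m z * Re (q z)) + (cuty r1 r2 z) * (m z)\<^sup>2) * (Im (p z))
           = 2 * (?c z * m z) * (Re (p z) * Im (q z) - Re (q z) * Im (p z)) + (cutx r1 r2 z * m z) * m z * Im (q z)
             - (cuty r1 r2 z * m z) * m z * Im (p z)" by (simp add: algebra_simps power2_eq_square)
        also have "\<dots> = 2 * m z * Im (cnj (p z) * q z)"
          unfolding dc[OF that] by (simp add: algebra_simps)
        finally show ?thesis unfolding a_def of_real_mult[symmetric] of_real_add[symmetric] of_real_diff[symmetric]
          by (rule arg_cong)
      qed
      show ?thesis by (rule trans[OF integral_lborel_on_cong[OF N1[symmetric]] N0])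
    qed
    then have I: "(LINT z|lborel_on (sq r). 2 * m z * Im (cnj (p z) * q z)) = 0"
      by (simp only: integral_complex_of_real of_real_eq_0_iff)
    obtain Bm where Bm: "\<And>z. z \<in> sq r \<Longrightarrow> \<bar>m z\<bar> \<le> Bm"
    proof
      fix z assume "z \<in> sq r"
      then show "\<bar>m z\<bar> \<le> \<bar>B\<bar> + \<bar>t\<bar>" using B[of z] abs_Re_le_cmod[of "u z"] by (auto simp: m_def)
    qed
    have "integrable (lborel_on (sq r)) (\<lambda>z. 2 * m z * Im (cnj (p z) * q z))"
    proof (rule Bochner_Integration.integrable_bound)
      show "integrable (lborel_on (sq r)) (\<lambda>z. \<bar>Bm\<bar> * ((norm (p z))\<^sup>2 + (norm (q z))\<^sup>2))"
        using sob_square_integrable[OF u] by auto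
      have "norm (2 * m z * Im (cnj (p z) * q z)) \<le> norm (\<bar>Bm\<bar> * ((norm (p z))\<^sup>2 + (norm (q z))\<^sup>2))" if "z \<in> sq r" for z
      proof -
        have "\<bar>Im (cnj (p z) * q z)\<bar> \<le> norm (p z) * norm (q z)"
          using abs_Im_le_cmod[of "cnj (p z) * q z"] by (simp add: norm_mult)
        then have "2 * \<bar>Im (cnj (p z) * q z)\<bar> \<le> (norm (p z))\<^sup>2 + (norm (q z))\<^sup>2"
          using sum_squares_bound[of "norm (p z)" "norm (q z)"] by simp
        then have "\<bar>m z\<bar> * (2 * \<bar>Im (cnj (p z) * q z)\<bar>) \<le> \<bar>Bm\<bar> * ((norm (p z))\<^sup>2 + (norm (q z))\<^sup>2)"
          using Bm[OF that] by (intro mult_mono) auto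
        moreover have "norm (2 * x * y) \<le> norm s" if "\<bar>x\<bar> * (2 * \<bar>y\<bar>) \<le> s" for x y s :: real
          using that by (simp add: abs_mult mult_ac)
        ultimately show ?thesis by blast
      qed
      then show "AE z in lborel_on (sq r). norm (2 * m z * Im (cnj (p z) * q z)) \<le> norm (\<bar>Bm\<bar> * ((norm (p z))\<^sup>2 + (norm (q z))\<^sup>2))"
        by (intro eventually_mono[OF AE_in_lborel_on]) auto
      have "(\<lambda>z. 2 * m z * (Re (p z) * Im (q z) - Im (p z) * Re (q z))) \<in> borel_measurable (lborel_on (sq r))"
        by measurable
      then show "(\<lambda>z. 2 * m z * Im (cnj (p z) * q z)) \<in> borel_measurable (lborel_on (sq r))"
        by (simp add: algebra_simps)
    qed
    moreover have "AE z in lborel_on (sq r). 0 \<le> 2 * m z * Im (cnj (p z) * q z)"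
      using dist unfolding distortion_def
    proof eventually_elim
      case (elim z)
      have "0 \<le> K * Im (cnj (p z) * q z)" using elim by (smt (verit) zero_le_power2)
      then have "0 \<le> Im (cnj (p z) * q z)" using K by (simp only: zero_le_mult_iff) linarith
      then show ?case using mm by (intro mult_nonneg_nonneg) auto
    qed
    ultimately have "AE z in lborel_on (sq r). 2 * m z * Im (cnj (p z) * q z) = 0"
      using I by (subst (asm) integral_nonneg_eq_0_iff_AE) auto
    then show ?thesis by eventually_elim simp
  qed
  have Da: "AE z in lborel_on (sq r). 2 * m z * Re (p z) = 0 \<and> 2 * m z * Re (q z) = 0"
    using J dist unfolding distortion_def
  proof eventually_elim
    case (elim z)
    show ?case
    proof (cases "m z = 0")
      case False
      then have "(norm (p z))\<^sup>2 + (norm (q z))\<^sup>2 \<le> 0" using elim by auto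
      then have "p z = 0 \<and> q z = 0" by (metis norm_eq_zero sum_power2_le_zero_iff)
      then show ?thesis by simp
    qed simp
  qed
  have Cx: "C1on (sq r) (\<lambda>z. of_real (Re z)) (\<lambda>_. 1) (\<lambda>_. 0)" "C1on (sq r) (\<lambda>z. of_real (Im z)) (\<lambda>_. 0) (\<lambda>_. 1)"
    by (auto simp: C1on_def rlin_def scaleR_conv_of_real intro!: derivative_eq_intros)
  have xs: "\<bar>Re z\<bar> \<le> r" "\<bar>Im z\<bar> \<le> r" if "z \<in> sq r" for z using that by (auto simp: sq_def supn_def)
  have X: "sob (sq r) (\<lambda>z. of_real (Re z)) (\<lambda>_. 1) (\<lambda>_. 0)"
    by (rule sob_C1on[OF _ _ Cx(1), where B = "r + 1"]) (use r xs in \<open>force+\<close>)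
  have Y: "sob (sq r) (\<lambda>z. of_real (Im z)) (\<lambda>_. 0) (\<lambda>_. 1)"
    by (rule sob_C1on[OF _ _ Cx(2), where B = "r + 1"]) (use r xs in \<open>force+\<close>)
  have am: "?c z * a z = a z" "cutx r1 r2 z * a z = 0" if "z \<in> sq r" for z
  proof -
    have "?c z * (m z)\<^sup>2 = (m z)\<^sup>2" using dc(3)[OF that] by (simp add: power2_eq_square)
    then show "?c z * a z = a z" by (metis a_def of_real_mult)
    have "cutx r1 r2 z * (m z)\<^sup>2 = 0" using dc(1)[OF that] by (simp add: power2_eq_square)
    then show "cutx r1 r2 z * a z = 0" by (metis a_def of_real_mult of_real_0)
  qed
  have "(LINT z|lborel_on (sq r). a z) = 0"
  proof -
    \<comment> \<open>Pairing \<open>Re z * a z\<close> with the coordinate \<open>Im z\<close>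
      integrates the x-derivative of the former, which is \<open>a\<close> itself because the
      gradient of \<open>a\<close> vanishes.\<close>
    note N0 = sob_null_lagrangian[OF open_sq bounded_sq K2 C1on_cut c0 sob_mult[OF X a] Y]
    have N1: "AE z in lborel_on (sq r). (complex_of_real (?c z) * (1 * a z + of_real (Re z) * of_real (2 * m z * Re (p z))) + of_real (cutx r1 r2 z) * (of_real (Re z) * a z)) * 1
       - (complex_of_real (?c z) * (0 * a z + of_real (Re z) * of_real (2 * m z * Re (q z))) + of_real (cuty r1 r2 z) * (of_real (Re z) * a z)) * 0 = a z"
      using Da AE_in_lborel_on
    proof eventually_elim
      case (elim z)
      have "(complex_of_real (?c z) * (1 * a z + of_real (Re z) * of_real (2 * m z * Re (p z))) + of_real (cutx r1 r2 z) * (of_real (Re z) * a z))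
         = ?c z * a z + of_real (Re z) * (cutx r1 r2 z * a z)"
        using elim(1) by (simp only:) (simp add: algebra_simps)
      then show ?case using am[OF elim(2)] by simp
    qed
    show ?thesis
      by (rule trans[OF integral_cong_AE[OF _ _ eventually_mono[OF N1 sym]] N0]) measurable
  qed
  then have "(LINT z|lborel_on (sq r). (m z)\<^sup>2) = 0"
    unfolding a_def by (simp only: integral_complex_of_real of_real_eq_0_iff)
  moreover obtain Ba where Ba: "\<And>z. z \<in> sq r \<Longrightarrow> norm (a z) \<le> Ba" using sob_bounded[OF a] by blast
  have "integrable (lborel_on (sq r)) a"
    by (rule integrable_lborel_on_bounded[OF open_sq bounded_sq _ Ba]) measurable
  then have "integrable (lborel_on (sq r)) (\<lambda>z. (m z)\<^sup>2)" using integrable_Re[of "lborel_on (sq r)" a] by (simp add: a_def)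
  ultimately have "AE z in lborel_on (sq r). (m z)\<^sup>2 = 0"
    by (subst (asm) integral_nonneg_eq_0_iff_AE) auto
  then have le: "AE z in lborel_on (sq r). Re (u z) \<le> t" by eventually_elim (auto simp: m_def max_def split: if_splits)
  show "Re (u z) \<le> c + e"
  proof (cases "supn z = r")
    case True then show ?thesis using bd e by force
  next
    case False
    then have zr: "z \<in> sq r" using z by (auto simp: csq_def sq_def)
    have "open (sq r \<inter> u -` {w. t < Re w})"
      by (intro continuous_open_preimage sob_continuous[OF u] open_sq open_Collect_less continuous_intros)
    moreover have "sq r \<inter> u -` {w. t < Re w} = {z \<in> sq r. \<not> Re (u z) \<le> t}" by auto
    ultimately have "Re (u z) \<le> t"
      using AE_lborel_on_open_imp[OF le open_sq _ zr] by simp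
    then show ?thesis by (simp add: t_def)
  qed
qed

lemma measurable_indicator_lborel_on [measurable]:
  "A \<in> sets borel \<Longrightarrow> (indicator A :: complex \<Rightarrow> real) \<in> borel_measurable (lborel_on S)"
  by (rule measurable_restrict_space1) simp

lemma csq_borel [measurable, simp]: "csq r \<in> sets borel"
  by (rule borel_closed[OF closed_csq])

text \<open>The Jacobian identity for \<open>Im u\<close> and \<open>Re u\<close> with the squared
  cut-off turns the integral of c^2 J into that of \<open>X\<close>, which is linear in the
  derivatives of \<open>u\<close>. Distortion bounds the energy by \<open>K\<close> times J, and
  Young's inequality absorbs \<open>X\<close> into half of the energy. The bound does not depend on
  \<open>R\<close>, since the squared gradient of the cut-off is of order 1 / R^2 on an area of
  order R^2.\<close>

lemma caccioppoli:
  assumes S: "open S" "bounded S" "csq (2 * R) \<subseteq> S" and R: "R > 0" and K: "K > 0"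
    and u: "sob S u p q" and dist: "distortion K S p q" and B: "\<And>z. z \<in> S \<Longrightarrow> \<bar>Im (u z)\<bar> \<le> B" "B \<ge> 0"
  shows "(LINT z|lborel_on S. indicator (csq R) z * ((norm (p z))\<^sup>2 + (norm (q z))\<^sup>2)) \<le> 2000 * K\<^sup>2 * B\<^sup>2"
proof -
  define c cx cy where "c = cut R (2 * R)" and "cx = cutx R (2 * R)" and "cy = cuty R (2 * R)"
  have C: "C1on T (\<lambda>z. complex_of_real (c z)) (\<lambda>z. of_real (cx z)) (\<lambda>z. of_real (cy z))" for T
    unfolding c_def cx_def cy_def by (rule C1on_cut)
  \<comment> \<open>The cut-off between \<open>R\<close> and \<open>2 * R\<close> has slope at most
    8 / (3 R), rounded up here.\<close>
  define D where "D = 3 / R"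
  have D0: "D > 0" using R by (simp add: D_def)
  have R2: "(2 * R)\<^sup>2 - R\<^sup>2 = 3 * R\<^sup>2" by (simp add: power2_eq_square)
  have "4 * (2 * R) / ((2 * R)\<^sup>2 - R\<^sup>2) = (8/3) / R" unfolding R2 using R by (simp add: power2_eq_square field_simps)
  also have "\<dots> \<le> D" unfolding D_def using R by (intro divide_right_mono) auto
  finally have DR: "4 * (2 * R) / ((2 * R)\<^sup>2 - R\<^sup>2) \<le> D" .
  have c: "0 \<le> c z" "c z \<le> 1" "\<bar>cx z\<bar> \<le> D" "\<bar>cy z\<bar> \<le> D" "z \<in> csq R \<Longrightarrow> c z = 1"
     "z \<notin> csq (2 * R) \<Longrightarrow> c z = 0 \<and> cx z = 0 \<and> cy z = 0" for z
    using cut_props[of R "2 * R" z] R DR unfolding c_def cx_def cy_def csq_def by auto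
  define E where "E z = (norm (p z))\<^sup>2 + (norm (q z))\<^sup>2" for z
  define J where "J z = Re (p z) * Im (q z) - Im (p z) * Re (q z)" for z
  have J: "Im (cnj (p z) * q z) = J z" for z by (simp add: J_def algebra_simps)
  have Es: "E z = (Re (p z))\<^sup>2 + (Im (p z))\<^sup>2 + (Re (q z))\<^sup>2 + (Im (q z))\<^sup>2" for z
    by (simp add: E_def cmod_power2)
  have JE: "\<bar>J z\<bar> \<le> E z" for z
    unfolding J_def Es abs_le_iff
    using zero_le_power2[of "Re (p z) - Im (q z)"] zero_le_power2[of "Im (p z) - Re (q z)"]
      zero_le_power2[of "Re (p z) + Im (q z)"] zero_le_power2[of "Im (p z) + Re (q z)"]
      zero_le_power2[of "Re (p z)"] zero_le_power2[of "Re (q z)"] zero_le_power2[of "Im (p z)"] zero_le_power2[of "Im (q z)"]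
    by (auto simp: power2_sum power2_diff)
  define X where "X z = 2 * c z * Im (u z) * (cx z * Re (q z) - cy z * Re (p z))" for z
  have [measurable]: "p \<in> borel_measurable (lborel_on S)" "q \<in> borel_measurable (lborel_on S)"
    using u by (auto simp: sob_def)
  have [measurable]: "u \<in> borel_measurable (lborel_on S)"
    using sob_continuous[OF u] by (rule continuous_on_measurable_lborel_on)
  have "(\<lambda>z. complex_of_real (c z)) \<in> borel_measurable (lborel_on S)" "(\<lambda>z. complex_of_real (cx z)) \<in> borel_measurable (lborel_on S)"
    "(\<lambda>z. complex_of_real (cy z)) \<in> borel_measurable (lborel_on S)"
    using C[of S] C1on_continuous[OF C[of S]]
    by (auto simp: C1on_def intro!: continuous_on_measurable_lborel_on)
  from this[THEN measurable_compose[OF _ borel_measurable_Re]]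
  have [measurable]: "c \<in> borel_measurable (lborel_on S)" "cx \<in> borel_measurable (lborel_on S)" "cy \<in> borel_measurable (lborel_on S)"
    by simp_all
  have iE: "integrable (lborel_on S) E"
    using sob_square_integrable[OF u] by (simp add: E_def[abs_def])
  have XE: "\<bar>X z\<bar> \<le> 2 * B * D * (E z + 1)" if "z \<in> S" for z
  proof -
    have 1: "\<bar>cx z * Re (q z) - cy z * Re (p z)\<bar> \<le> D * (E z + 1)"
    proof -
      have "\<bar>cx z * Re (q z) - cy z * Re (p z)\<bar> \<le> D * \<bar>Re (q z)\<bar> + D * \<bar>Re (p z)\<bar>"
        by (rule order_trans[OF abs_triangle_ineq4]) (use c(3,4)[of z] in \<open>auto simp: abs_mult intro!: add_mono mult_right_mono\<close>)
      also have "\<dots> = D * (\<bar>Re (q z)\<bar> + \<bar>Re (p z)\<bar>)" by (simp add: algebra_simps)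
      also have "\<bar>Re (q z)\<bar> + \<bar>Re (p z)\<bar> \<le> E z + 1"
      proof -
        have "\<bar>x\<bar> \<le> x\<^sup>2 + 1/4" for x :: real
          using zero_le_power2[of "\<bar>x\<bar> - 1/2"] by (simp add: power2_eq_square algebra_simps)
        from this[of "Re (q z)"] this[of "Re (p z)"] show ?thesis
          using zero_le_power2[of "Im (p z)"] zero_le_power2[of "Im (q z)"] unfolding Es by linarith
      qed
      finally show ?thesis using D0 by simp
    qed
    have "\<bar>X z\<bar> = (2 * c z) * \<bar>Im (u z)\<bar> * \<bar>cx z * Re (q z) - cy z * Re (p z)\<bar>"
      using c(1)[of z] by (simp add: X_def abs_mult)
    also have "\<dots> \<le> (2 * B) * (D * (E z + 1))"
    proof (rule mult_mono[OF _ 1])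
      show "2 * c z * \<bar>Im (u z)\<bar> \<le> 2 * B" using mult_mono[OF c(2)[of z] B(1)[OF that]] c(1) B by (simp add: mult_ac)
    qed (use B in auto)
    finally show ?thesis by simp
  qed
  have cE: "(c z)\<^sup>2 * \<bar>x\<bar> \<le> \<bar>x\<bar>" for z x
  proof -
    have "(c z)\<^sup>2 \<le> 1" using c(1,2)[of z] by (simp add: power_le_one)
    then show ?thesis using mult_right_mono[of "(c z)\<^sup>2" 1 "\<bar>x\<bar>"] by simp
  qed
  have i1: "integrable (lborel_on S) (\<lambda>z. 2 * B * D * (E z + 1))"
    using iE finite_measure.integrable_const[OF finite_measure_lborel_on[OF S(1,2)], of "1::real"] by auto
  have iX: "integrable (lborel_on S) X"
    by (rule Bochner_Integration.integrable_bound[OF i1])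
       (unfold X_def[abs_def], measurable, use XE[unfolded X_def] in \<open>intro eventually_mono[OF AE_in_lborel_on], fastforce\<close>)
  have icE: "integrable (lborel_on S) (\<lambda>z. (c z)\<^sup>2 * E z)"
  proof (rule Bochner_Integration.integrable_bound[OF iE])
    have "norm ((c z)\<^sup>2 * E z) \<le> norm (E z)" for z using cE[of z "E z"] by (simp add: abs_mult)
    then show "AE z in lborel_on S. norm ((c z)\<^sup>2 * E z) \<le> norm (E z)" by simp
  qed (simp add: E_def[abs_def])
  have icJ: "integrable (lborel_on S) (\<lambda>z. (c z)\<^sup>2 * J z)"
  proof (rule Bochner_Integration.integrable_bound[OF iE])
    have "norm ((c z)\<^sup>2 * J z) \<le> norm (E z)" for z
      using order_trans[OF cE[of z "J z"] order_trans[OF JE abs_ge_self]] by (simp add: abs_mult)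
    then show "AE z in lborel_on S. norm ((c z)\<^sup>2 * J z) \<le> norm (E z)" by simp
  qed (simp add: J_def[abs_def])
  have "(LINT z|lborel_on S. complex_of_real (X z - (c z)\<^sup>2 * J z)) = 0"
  proof (rule trans[OF integral_lborel_on_cong sob_null_lagrangian[OF S(1,2) compact_csq S(3) C1on_mult[OF C C] _ sob_Im[OF u] sob_Re[OF u]]])
    fix z
    have "X z - (c z)\<^sup>2 * J z = (c z * c z * Im (p z) + (cx z * c z + c z * cx z) * Im (u z)) * Re (q z)
      - (c z * c z * Im (q z) + (cy z * c z + c z * cy z) * Im (u z)) * Re (p z)"
      by (simp add: X_def J_def power2_eq_square algebra_simps)
    then show "complex_of_real (X z - (c z)\<^sup>2 * J z) = (of_real (c z) * of_real (c z) * of_real (Im (p z)) + (of_real (cx z) * of_real (c z) + of_real (c z) * of_real (cx z)) * of_real (Im (u z))) * of_real (Re (q z))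
      - (of_real (c z) * of_real (c z) * of_real (Im (q z)) + (of_real (cy z) * of_real (c z) + of_real (c z) * of_real (cy z)) * of_real (Im (u z))) * of_real (Re (p z))"
      by (simp only: of_real_mult of_real_add of_real_diff)
  qed (use c(6) in auto)
  then have N: "(LINT z|lborel_on S. X z - (c z)\<^sup>2 * J z) = 0"
    by (simp only: integral_complex_of_real of_real_eq_0_iff)
  define G where "G z = 2 * D\<^sup>2 * indicator (csq (2 * R)) z" for z :: complex
  have iG: "integrable (lborel_on S) G"
    unfolding G_def using finite_measure_lborel_on[OF S(1,2)]
    by (intro integrable_mult_right finite_measure.integrable_const_bound[where B = 1] measurable_indicator_lborel_on) (auto intro: AE_I2 indicator_le_1)
  have key: "AE z in lborel_on S. K * (X z - (c z)\<^sup>2 * J z) \<le> - (1/2) * ((c z)\<^sup>2 * E z) + 2 * K\<^sup>2 * B\<^sup>2 * G z"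
    using dist AE_in_lborel_on unfolding distortion_def
  proof eventually_elim
    case (elim z)
    have 1: "(c z)\<^sup>2 * E z \<le> K * ((c z)\<^sup>2 * J z)"
      using mult_left_mono[OF elim(1)[unfolded J, folded E_def] zero_le_power2[of "c z"]] by (simp add: mult_ac)
    have t: "K * (2 * c z * Im (u z) * (a * b)) \<le> 1/2 * ((c z)\<^sup>2 * b\<^sup>2) + 2 * K\<^sup>2 * B\<^sup>2 * a\<^sup>2" for a b
    proof -
      \<comment> \<open>Young's inequality, weighted so that the two derivative terms together
        consume at most half of c^2 E.\<close>
      have "0 \<le> 2 * (c z * b / 2 - K * Im (u z) * a)\<^sup>2" by simp
      then have "K * (2 * c z * Im (u z) * (a * b)) \<le> 1/2 * ((c z)\<^sup>2 * b\<^sup>2) + 2 * K\<^sup>2 * a\<^sup>2 * (Im (u z))\<^sup>2"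
        by (simp add: power2_eq_square algebra_simps)
      also have "(Im (u z))\<^sup>2 \<le> B\<^sup>2" using B(1)[OF elim(2)] by (metis abs_le_square_iff abs_of_nonneg B(2))
      then have "2 * K\<^sup>2 * a\<^sup>2 * (Im (u z))\<^sup>2 \<le> 2 * K\<^sup>2 * a\<^sup>2 * B\<^sup>2" by (intro mult_left_mono) auto
      finally show ?thesis by (simp add: mult_ac)
    qed
    have "K * X z = K * (2 * c z * Im (u z) * (cx z * Re (q z))) + K * (2 * c z * Im (u z) * ((- cy z) * Re (p z)))"
      by (simp add: X_def algebra_simps)
    also have "\<dots> \<le> (1/2 * ((c z)\<^sup>2 * (Re (q z))\<^sup>2) + 2 * K\<^sup>2 * B\<^sup>2 * (cx z)\<^sup>2) + (1/2 * ((c z)\<^sup>2 * (Re (p z))\<^sup>2) + 2 * K\<^sup>2 * B\<^sup>2 * (- cy z)\<^sup>2)"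
      by (intro add_mono t)
    also have "\<dots> = 1/2 * ((c z)\<^sup>2 * ((Re (p z))\<^sup>2 + (Re (q z))\<^sup>2)) + 2 * K\<^sup>2 * B\<^sup>2 * ((cx z)\<^sup>2 + (cy z)\<^sup>2)"
      by (simp add: algebra_simps)
    also have "\<dots> \<le> 1/2 * ((c z)\<^sup>2 * E z) + 2 * K\<^sup>2 * B\<^sup>2 * G z"
    proof (intro add_mono mult_left_mono)
      show "(Re (p z))\<^sup>2 + (Re (q z))\<^sup>2 \<le> E z" by (simp add: Es)
      have "(cx z)\<^sup>2 \<le> D\<^sup>2" "(cy z)\<^sup>2 \<le> D\<^sup>2" using c(3,4)[of z] D0 by (metis abs_le_square_iff abs_of_pos)+
      then show "(cx z)\<^sup>2 + (cy z)\<^sup>2 \<le> G z" using c(6)[of z] by (auto simp: G_def indicator_def)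
    qed auto
    finally show ?case using 1 by (simp add: algebra_simps)
  qed
  have "(LINT z|lborel_on S. K * (X z - (c z)\<^sup>2 * J z)) \<le> (LINT z|lborel_on S. - (1/2) * ((c z)\<^sup>2 * E z) + 2 * K\<^sup>2 * B\<^sup>2 * G z)"
    by (rule integral_mono_AE[OF _ _ key]) (intro integrable_mult_right Bochner_Integration.integrable_add Bochner_Integration.integrable_diff iX icJ icE iG)+
  then have "(LINT z|lborel_on S. (c z)\<^sup>2 * E z) \<le> 4 * K\<^sup>2 * B\<^sup>2 * (LINT z|lborel_on S. G z)"
    using N icE iG by (simp add: Bochner_Integration.integral_add Bochner_Integration.integral_diff)
  \<comment> \<open>The computation gives 18 / R^2 times 16 R^2, that is 288; rounding it up to 500
    yields the constant 2000.\<close>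
  also have "(LINT z|lborel_on S. G z) \<le> 500"
  proof -
    have "(LINT z|lborel_on S. indicator (csq (2 * R)) z :: real) = measure lborel (csq (2 * R))"
    proof -
      have "csq (2 * R) \<inter> S = csq (2 * R)" using S(3) by blast
      then show ?thesis using S(1,3) by (simp add: measure_restrict_space)
    qed
    also have "\<dots> \<le> 4 * (2 * R)\<^sup>2" using measure_csq_le(2)[of "2 * R"] R by simp
    finally have "(LINT z|lborel_on S. G z) \<le> 2 * D\<^sup>2 * (4 * (2 * R)\<^sup>2)"
      unfolding G_def integral_mult_right_zero by (rule mult_left_mono) simp
    also have "\<dots> = 2 * 4 * 4 * 9" using R by (simp add: D_def power2_eq_square field_simps)
    finally show ?thesis by simp
  qed
  finally have 1: "(LINT z|lborel_on S. (c z)\<^sup>2 * E z) \<le> 2000 * K\<^sup>2 * B\<^sup>2" by (simp add: mult_left_mono)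
  have "(LINT z|lborel_on S. indicator (csq R) z * E z) \<le> (LINT z|lborel_on S. (c z)\<^sup>2 * E z)"
  proof (rule integral_mono_AE[OF _ icE])
    have "indicator (csq R) z * E z \<le> (c z)\<^sup>2 * E z \<and> 0 \<le> indicator (csq R) z * E z" for z
      using c(5)[of z] by (auto simp: indicator_def E_def)
    then show "AE z in lborel_on S. indicator (csq R) z * E z \<le> (c z)\<^sup>2 * E z" by auto
    show "integrable (lborel_on S) (\<lambda>z. indicator (csq R) z * E z)"
      by (rule Bochner_Integration.integrable_bound[OF iE])
         (unfold E_def[abs_def], measurable, auto simp: indicator_def)
  qed
  with 1 show ?thesis by (simp add: E_def)
qed

section \<open>The length-area method\<close>

lemma continuous_Complex [continuous_intros]:
  "continuous_on S f \<Longrightarrow> continuous_on S g \<Longrightarrow> continuous_on S (\<lambda>x. Complex (f x) (g x))"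
  unfolding Complex_eq by (intro continuous_intros)

lemma measurable_Complex [measurable]:
  "(\<lambda>x. Complex (fst x) (snd x)) \<in> borel_measurable borel"
  by (intro borel_measurable_continuous_onI continuous_intros)

lemma lborel_complex: "(lborel :: complex measure) = distr (lborel \<Otimes>\<^sub>M lborel) borel (\<lambda>x. Complex (fst x) (snd x))"
proof (rule lborel_eqI)
  fix l u :: complex
  assume le: "\<And>b. b \<in> Basis \<Longrightarrow> l \<bullet> b \<le> u \<bullet> b"
  from this[of 1] this[of \<i>] have le: "Re l \<le> Re u" "Im l \<le> Im u" by (auto simp: Basis_complex_def)
  have "(\<lambda>x. Complex (fst x) (snd x)) -` box l u = {Re l<..<Re u} \<times> {Im l<..<Im u}"
    by (auto simp: in_box_complex_iff)
  moreover have "(\<lambda>x. Complex (fst x) (snd x)) \<in> borel_measurable (lborel \<Otimes>\<^sub>M lborel)"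
    using measurable_Complex by (simp add: lborel_prod)
  moreover have "emeasure (lborel \<Otimes>\<^sub>M lborel) ({Re l<..<Re u} \<times> {Im l<..<Im u}) = ennreal ((Re u - Re l) * (Im u - Im l))"
    using le by (subst lborel.emeasure_pair_measure_Times) (auto simp: ennreal_mult)
  ultimately show "emeasure (distr (lborel \<Otimes>\<^sub>M lborel) borel (\<lambda>x. Complex (fst x) (snd x))) (box l u) = ennreal (\<Prod>b\<in>Basis. (u - l) \<bullet> b)"
    by (subst emeasure_distr) (auto simp: Basis_complex_def space_pair_measure)
qed simp

lemma nn_integral_complex:
  assumes [measurable]: "f \<in> borel_measurable borel"
  shows "(\<integral>\<^sup>+z. f z \<partial>lborel) = (\<integral>\<^sup>+x. \<integral>\<^sup>+y. f (Complex x y) \<partial>lborel \<partial>lborel)"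
    and "(\<integral>\<^sup>+z. f z \<partial>lborel) = (\<integral>\<^sup>+y. \<integral>\<^sup>+x. f (Complex x y) \<partial>lborel \<partial>lborel)"
    and "(\<lambda>x. \<integral>\<^sup>+y. f (Complex x y) \<partial>lborel) \<in> borel_measurable borel"
    and "(\<lambda>y. \<integral>\<^sup>+x. f (Complex x y) \<partial>lborel) \<in> borel_measurable borel"
proof -
  have m: "(\<lambda>x. f (Complex (fst x) (snd x))) \<in> borel_measurable borel"
    by (rule measurable_compose[OF measurable_Complex assms])
  then have m[measurable]: "(\<lambda>x. f (Complex (fst x) (snd x))) \<in> borel_measurable (lborel \<Otimes>\<^sub>M lborel)"
    by (simp add: lborel_prod)
  have 1: "(\<integral>\<^sup>+z. f z \<partial>lborel) = (\<integral>\<^sup>+x. f (Complex (fst x) (snd x)) \<partial>(lborel \<Otimes>\<^sub>M lborel))"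
    by (subst lborel_complex, subst nn_integral_distr) (auto simp: lborel_prod)
  then show "(\<integral>\<^sup>+z. f z \<partial>lborel) = (\<integral>\<^sup>+x. \<integral>\<^sup>+y. f (Complex x y) \<partial>lborel \<partial>lborel)"
    using lborel.nn_integral_fst[OF m] by simp
  show "(\<integral>\<^sup>+z. f z \<partial>lborel) = (\<integral>\<^sup>+y. \<integral>\<^sup>+x. f (Complex x y) \<partial>lborel \<partial>lborel)"
    using lborel_pair.nn_integral_snd[OF m] 1 by simp
  show "(\<lambda>x. \<integral>\<^sup>+y. f (Complex x y) \<partial>lborel) \<in> borel_measurable borel"
    using lborel.borel_measurable_nn_integral_fst[OF m] by simp
  have "(\<lambda>x. f (Complex (snd x) (fst x))) \<in> borel_measurable borel"
    by (rule measurable_compose[OF _ assms]) (intro borel_measurable_continuous_onI continuous_intros)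
  then have "(\<lambda>x. f (Complex (snd x) (fst x))) \<in> borel_measurable (lborel \<Otimes>\<^sub>M lborel)"
    by (simp add: lborel_prod)
  from lborel.borel_measurable_nn_integral_fst[OF this]
  show "(\<lambda>y. \<integral>\<^sup>+x. f (Complex x y) \<partial>lborel) \<in> borel_measurable borel"
    by simp
qed

text \<open>The fundamental theorem of calculus followed by Cauchy-Schwarz. The energy is an
  \<open>ennreal\<close> integral so that Tonelli applies to it afterwards without integrability
  conditions.\<close>

lemma square_norm_diff_le_energy:
  fixes f :: "real \<Rightarrow> complex"
  assumes f: "\<And>x. x \<in> {l..u} \<Longrightarrow> (f has_vector_derivative f' x) (at x)" and f': "continuous_on {l..u} f'"
    and xy: "x \<in> {l..u}" "y \<in> {l..u}" and lu: "l < u"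
  shows "ennreal ((norm (f x - f y))\<^sup>2) \<le> ennreal (u - l) * (\<integral>\<^sup>+t. ennreal ((norm (f' t))\<^sup>2) * indicator {l..u} t \<partial>lborel)"
proof -
  define I where "I = integral {l..u} (\<lambda>t. norm (f' t))"
  have int: "(\<lambda>t. norm (f' t)) integrable_on {a..b}" if "{a..b} \<subseteq> {l..u}" for a b
    by (intro integrable_continuous_interval continuous_on_norm continuous_on_subset[OF f' that])
  have le: "norm (f b - f a) \<le> I" if "a \<le> b" "{a..b} \<subseteq> {l..u}" for a b
  proof -
    have "(f' has_integral (f b - f a)) {a..b}"
      by (rule fundamental_theorem_of_calculus) (use that f in \<open>auto intro: has_vector_derivative_at_within\<close>)
    then have "norm (f b - f a) \<le> integral {a..b} (\<lambda>t. norm (f' t))"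
      using integral_norm_bound_integral[OF _ int[OF that(2)], of f'] by (auto simp: has_integral_integrable_integral)
    also have "\<dots> \<le> I" unfolding I_def
      by (rule integral_subset_le[OF that(2) int[OF that(2)] int]) auto
    finally show ?thesis .
  qed
  have dI: "norm (f x - f y) \<le> I"
    using le[of x y] le[of y x] xy by (cases "x \<le> y") (auto simp: norm_minus_commute)
  define A where "A = integral {l..u} (\<lambda>t. (norm (f' t))\<^sup>2)"
  have iA: "(\<lambda>t. (norm (f' t))\<^sup>2) integrable_on {l..u}"
    by (intro integrable_continuous_interval continuous_intros f')
  \<comment> \<open>The mean of \<open>norm (f' t)\<close>. Nonnegativity of the variance around it
    is Cauchy-Schwarz against the constant 1.\<close>
  define m where "m = I / (u - l)"
  have "0 \<le> integral {l..u} (\<lambda>t. (norm (f' t) - m)\<^sup>2)"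
    by (rule integral_nonneg) (auto intro!: integrable_continuous_interval continuous_intros f')
  also have "(\<lambda>t. (norm (f' t) - m)\<^sup>2) = (\<lambda>t. (norm (f' t))\<^sup>2 + ((- 2 * m) * norm (f' t) + m\<^sup>2))"
    by (auto simp: fun_eq_iff power2_diff)
  also have "integral {l..u} \<dots> = A + ((- 2 * m) * I + (u - l) * m\<^sup>2)"
  proof -
    have 1: "((\<lambda>t. (norm (f' t))\<^sup>2) has_integral A) {l..u}" using iA by (simp add: A_def integrable_integral)
    have 2: "((\<lambda>t. (- 2 * m) * norm (f' t)) has_integral (- 2 * m) * I) {l..u}"
      unfolding I_def by (intro has_integral_mult_right integrable_integral int order_refl)
    have 3: "((\<lambda>t. m\<^sup>2) has_integral (u - l) * m\<^sup>2) {l..u}"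
      using has_integral_const_real[of "m\<^sup>2" l u] lu by simp
    show ?thesis by (rule integral_unique) (intro has_integral_add 1 2 3)
  qed
  also have "\<dots> = A - I\<^sup>2 / (u - l)"
  proof -
    have "(- 2 * (I / d)) * I + d * (I / d)\<^sup>2 = - (I\<^sup>2 / d)" if "d > 0" for d
      using that by (simp add: power2_eq_square field_simps)
    from this[of "u - l"] show ?thesis using lu by (simp add: m_def)
  qed
  finally have "I\<^sup>2 \<le> (u - l) * A" using lu by (simp add: field_simps)
  moreover have "(norm (f x - f y))\<^sup>2 \<le> I\<^sup>2" by (rule power_mono[OF dI]) simp
  ultimately have "(norm (f x - f y))\<^sup>2 \<le> (u - l) * A" by simp
  moreover have "(\<integral>\<^sup>+t. ennreal ((norm (f' t))\<^sup>2) * indicator {l..u} t \<partial>lborel) = ennreal A"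
    by (rule nn_integral_has_integral_lebesgue') (use iA in \<open>auto simp: A_def intro: integrable_integral\<close>)
  ultimately show ?thesis using lu by (simp add: ennreal_mult'[symmetric] ennreal_leI)
qed

definition sq_annulus :: "complex \<Rightarrow> real \<Rightarrow> real \<Rightarrow> complex set" where
  "sq_annulus z0 a b = {z. a \<le> supn (z - z0) \<and> supn (z - z0) \<le> b}"

lemma sq_annulus_borel [measurable, simp]: "sq_annulus z0 a b \<in> sets borel"
proof -
  have "closed (sq_annulus z0 a b)"
    unfolding sq_annulus_def by (intro closed_Collect_conj closed_Collect_le continuous_intros)
  then show ?thesis by simp
qed

text \<open>The boundary of the square of half-side \<open>\<rho>\<close> consists of four segments
  of length \<open>2 * \<rho>\<close>, and an oscillation \<open>\<delta>\<close> on it forces line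
  energy of order \<delta>^2 / \<rho>. Integrating over \<open>\<rho>\<close> sweeps out the ring
  and turns line energies into area energy.\<close>

lemma length_area_C1on:
  assumes V: "C1on S V P Q" and ab: "0 < a" "a < b" and A: "sq_annulus z0 a b \<subseteq> S" and d: "\<delta> \<ge> 0"
    and osc: "\<And>\<rho>. a < \<rho> \<Longrightarrow> \<rho> < b \<Longrightarrow> \<exists>z z'. supn (z - z0) = \<rho> \<and> supn (z' - z0) = \<rho> \<and> \<delta> \<le> norm (V z - V z')"
  shows "ennreal (\<delta>\<^sup>2 * (b - a)) \<le> ennreal (128 * b) * (\<integral>\<^sup>+z. ennreal (indicator (sq_annulus z0 a b) z * ((norm (P z))\<^sup>2 + (norm (Q z))\<^sup>2)) \<partial>lborel)"
proof -
  define A where "A = sq_annulus z0 a b"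
  define x0 y0 where "x0 = Re z0" and "y0 = Im z0"
  define G where "G z = ennreal (indicator A z * ((norm (P z))\<^sup>2 + (norm (Q z))\<^sup>2))" for z
  have PQ: "continuous_on A P" "continuous_on A Q" using V A by (auto simp: C1on_def A_def intro: continuous_on_subset)
  have "(\<lambda>z. indicator A z *\<^sub>R ((norm (P z))\<^sup>2 + (norm (Q z))\<^sup>2)) \<in> borel_measurable borel"
    by (intro borel_measurable_continuous_on_indicator) (auto intro!: continuous_intros PQ, simp add: A_def)
  then have G: "G \<in> borel_measurable borel" unfolding G_def by simp
  define \<Phi> \<Xi> where "\<Phi> x = (\<integral>\<^sup>+y. G (Complex x y) \<partial>lborel)" and "\<Xi> y = (\<integral>\<^sup>+x. G (Complex x y) \<partial>lborel)" for x y
  have [measurable]: "\<Phi> \<in> borel_measurable borel" "\<Xi> \<in> borel_measurable borel"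
    unfolding \<Phi>_def \<Xi>_def using nn_integral_complex(3,4)[OF G] by auto
  define E where "E = (\<integral>\<^sup>+z. G z \<partial>lborel)"
  have E: "(\<integral>\<^sup>+x. \<Phi> x \<partial>lborel) = E" "(\<integral>\<^sup>+y. \<Xi> y \<partial>lborel) = E"
    unfolding \<Phi>_def \<Xi>_def E_def using nn_integral_complex(1,2)[OF G] by auto
  have DV: "(V has_derivative rlin (P z) (Q z)) (at z)" if "z \<in> A" for z using V A that by (auto simp: C1on_def A_def)
  have inA: "Complex x y \<in> A" if "a \<le> \<rho>" "\<rho> \<le> b" "\<bar>x - x0\<bar> \<le> \<rho>" "\<bar>y - y0\<bar> \<le> \<rho>" "\<bar>x - x0\<bar> = \<rho> \<or> \<bar>y - y0\<bar> = \<rho>" for x y \<rho>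
    using that by (auto simp: A_def sq_annulus_def supn_def x0_def y0_def)
  have vert: "ennreal ((norm (V (Complex x y) - V (Complex x y')))\<^sup>2) \<le> ennreal (2 * \<rho>) * \<Phi> x"
    if r: "a \<le> \<rho>" "\<rho> \<le> b" and x: "\<bar>x - x0\<bar> = \<rho>" and y: "\<bar>y - y0\<bar> \<le> \<rho>" "\<bar>y' - y0\<bar> \<le> \<rho>" for x y y' \<rho>
  proof -
    have inA': "Complex x t \<in> A" if "t \<in> {y0 - \<rho>..y0 + \<rho>}" for t
      by (rule inA[OF r]) (use that x in auto)
    have "ennreal ((norm (V (Complex x y) - V (Complex x y')))\<^sup>2) \<le> ennreal ((y0 + \<rho>) - (y0 - \<rho>)) *
      (\<integral>\<^sup>+t. ennreal ((norm (Q (Complex x t)))\<^sup>2) * indicator {y0 - \<rho>..y0 + \<rho>} t \<partial>lborel)"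
    proof (rule square_norm_diff_le_energy[where f = "\<lambda>t. V (Complex x t)"])
      show "((\<lambda>t. V (Complex x t)) has_vector_derivative Q (Complex x t)) (at t)" if "t \<in> {y0 - \<rho>..y0 + \<rho>}" for t
      proof -
        have "((\<lambda>t. Complex x t) has_derivative (\<lambda>h. h *\<^sub>R \<i>)) (at t)"
          unfolding Complex_eq by (auto intro!: derivative_eq_intros simp: scaleR_conv_of_real)
        from has_derivative_compose[OF this DV[OF inA'[OF that]]]
        show ?thesis by (simp add: has_vector_derivative_def rlin_scaleR)
      qed
      show "continuous_on {y0 - \<rho>..y0 + \<rho>} (\<lambda>t. Q (Complex x t))"
        by (rule continuous_on_compose2[OF PQ(2)]) (use inA' in \<open>auto intro!: continuous_intros\<close>)
    qed (use r ab y in auto)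
    also have "\<dots> \<le> ennreal (2 * \<rho>) * \<Phi> x"
      unfolding \<Phi>_def
      by (rule mult_mono) (use inA' r ab in \<open>auto intro!: nn_integral_mono ennreal_leI simp: G_def indicator_def\<close>)
    finally show ?thesis .
  qed
  have hor: "ennreal ((norm (V (Complex x y) - V (Complex x' y)))\<^sup>2) \<le> ennreal (2 * \<rho>) * \<Xi> y"
    if r: "a \<le> \<rho>" "\<rho> \<le> b" and y: "\<bar>y - y0\<bar> = \<rho>" and x: "\<bar>x - x0\<bar> \<le> \<rho>" "\<bar>x' - x0\<bar> \<le> \<rho>" for x x' y \<rho>
  proof -
    have inA': "Complex t y \<in> A" if "t \<in> {x0 - \<rho>..x0 + \<rho>}" for t
      by (rule inA[OF r]) (use that y in auto)
    have "ennreal ((norm (V (Complex x y) - V (Complex x' y)))\<^sup>2) \<le> ennreal ((x0 + \<rho>) - (x0 - \<rho>)) *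
      (\<integral>\<^sup>+t. ennreal ((norm (P (Complex t y)))\<^sup>2) * indicator {x0 - \<rho>..x0 + \<rho>} t \<partial>lborel)"
    proof (rule square_norm_diff_le_energy[where f = "\<lambda>t. V (Complex t y)"])
      show "((\<lambda>t. V (Complex t y)) has_vector_derivative P (Complex t y)) (at t)" if "t \<in> {x0 - \<rho>..x0 + \<rho>}" for t
      proof -
        have "((\<lambda>t. Complex t y) has_derivative (\<lambda>h. h *\<^sub>R 1)) (at t)"
          unfolding Complex_eq by (auto intro!: derivative_eq_intros simp: scaleR_conv_of_real)
        from has_derivative_compose[OF this DV[OF inA'[OF that]]]
        show ?thesis by (simp only: has_vector_derivative_def rlin_scaleR rlin_simps)
      qed
      show "continuous_on {x0 - \<rho>..x0 + \<rho>} (\<lambda>t. P (Complex t y))"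
        by (rule continuous_on_compose2[OF PQ(1)]) (use inA' in \<open>auto intro!: continuous_intros\<close>)
    qed (use r ab x in auto)
    also have "\<dots> \<le> ennreal (2 * \<rho>) * \<Xi> y"
      unfolding \<Xi>_def
      by (rule mult_mono) (use inA' r ab in \<open>auto intro!: nn_integral_mono ennreal_leI simp: G_def indicator_def\<close>)
    finally show ?thesis .
  qed
  \<comment> \<open>The energy on the four lines through the sides. Taking whole lines, cut by the
    ring only, makes this a sum of four translated or reflected slice functions of the ring
    energy.\<close>
  define T where "T \<rho> = \<Phi> (x0 + \<rho>) + \<Phi> (x0 - \<rho>) + (\<Xi> (y0 + \<rho>) + \<Xi> (y0 - \<rho>))" for \<rho>
  have main: "ennreal (\<delta>\<^sup>2) \<le> ennreal (32 * b) * T \<rho>" if r: "a < \<rho>" "\<rho> < b" for \<rho>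
  proof (cases "T \<rho>")
    case top
    then show ?thesis using ab by (simp add: ennreal_mult_top)
  next
    case (real \<tau>)
    have r': "a \<le> \<rho>" "\<rho> \<le> b" "\<rho> > 0" using r ab by auto
    define s where "s = sqrt (2 * \<rho> * \<tau>)"
    have sI: "n \<le> s" if "ennreal (n\<^sup>2) \<le> ennreal (2 * \<rho>) * x" "x \<le> T \<rho>" for n x
    proof -
      have "ennreal (n\<^sup>2) \<le> ennreal (2 * \<rho>) * ennreal \<tau>"
        using order_trans[OF that(1) mult_left_mono[OF that(2)]] real by simp
      then have "n\<^sup>2 \<le> 2 * \<rho> * \<tau>" using r' real by (simp add: ennreal_mult'[symmetric])
      then show ?thesis unfolding s_def by (rule real_le_rsqrt)
    qed
    have PT: "\<Phi> x \<le> T \<rho>" if "\<bar>x - x0\<bar> = \<rho>" for x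
    proof -
      have "x = x0 + \<rho> \<or> x = x0 - \<rho>" using that by auto
      then show ?thesis by (auto simp: T_def add_increasing add_increasing2)
    qed
    have XT: "\<Xi> y \<le> T \<rho>" if "\<bar>y - y0\<bar> = \<rho>" for y
    proof -
      have "y = y0 + \<rho> \<or> y = y0 - \<rho>" using that by auto
      then show ?thesis by (auto simp: T_def add_increasing add_increasing2)
    qed
    have v: "norm (V (Complex x y) - V (Complex x y')) \<le> s" if "\<bar>x - x0\<bar> = \<rho>" "\<bar>y - y0\<bar> \<le> \<rho>" "\<bar>y' - y0\<bar> \<le> \<rho>" for x y y'
      by (rule sI[OF vert[OF r'(1,2) that] PT[OF that(1)]])
    have h: "norm (V (Complex x y) - V (Complex x' y)) \<le> s" if "\<bar>y - y0\<bar> = \<rho>" "\<bar>x - x0\<bar> \<le> \<rho>" "\<bar>x' - x0\<bar> \<le> \<rho>" for x x' y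
      by (rule sI[OF hor[OF r'(1,2) that] XT[OF that(1)]])
    have s0: "s \<ge> 0" unfolding s_def using r' real by simp
    \<comment> \<open>Every boundary point is reached from this corner along at most two sides, each
      costing at most \<open>s\<close>. Two boundary points thus differ by at most
      \<open>4 * s\<close>; squared, with s^2 = 2 \<rho> T, this is the factor 32.\<close>
    let ?c = "Complex (x0 + \<rho>) (y0 + \<rho>)"
    have c: "norm (V z - V ?c) \<le> 2 * s" if "supn (z - z0) = \<rho>" for z
    proof -
      define x y where "x = Re z" and "y = Im z"
      have z: "z = Complex x y" by (simp add: x_def y_def)
      have xy: "\<bar>x - x0\<bar> \<le> \<rho>" "\<bar>y - y0\<bar> \<le> \<rho>" and "\<bar>x - x0\<bar> = \<rho> \<or> \<bar>y - y0\<bar> = \<rho>"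
        using that by (auto simp: supn_def x_def y_def x0_def y0_def)
      then consider "x = x0 + \<rho>" | "y = y0 + \<rho>" | "x = x0 - \<rho>" | "y = y0 - \<rho>" by linarith
      then show ?thesis
      proof cases
        case 1
        then show ?thesis using v[of x y "y0 + \<rho>"] xy s0 r' z by auto
      next
        case 2
        then show ?thesis using h[of y x "x0 + \<rho>"] xy s0 r' z by auto
      next
        case 3
        have "norm (V z - V ?c) \<le> norm (V z - V (Complex x (y0 + \<rho>))) + norm (V (Complex x (y0 + \<rho>)) - V ?c)"
          using dist_triangle[of "V z" "V ?c" "V (Complex x (y0 + \<rho>))"] by (simp add: dist_norm)
        also have "\<dots> \<le> s + s" unfolding z by (intro add_mono v h) (use 3 r' xy in auto)
        finally show ?thesis by simp
      next
        case 4
        have "norm (V z - V ?c) \<le> norm (V z - V (Complex (x0 + \<rho>) y)) + norm (V (Complex (x0 + \<rho>) y) - V ?c)"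
          using dist_triangle[of "V z" "V ?c" "V (Complex (x0 + \<rho>) y)"] by (simp add: dist_norm)
        also have "\<dots> \<le> s + s" unfolding z by (intro add_mono v h) (use 4 r' xy in auto)
        finally show ?thesis by simp
      qed
    qed
    obtain z z' where z: "supn (z - z0) = \<rho>" "supn (z' - z0) = \<rho>" "\<delta> \<le> norm (V z - V z')" using osc[OF r] by blast
    have "\<delta> \<le> norm (V z - V ?c) + norm (V z' - V ?c)"
      using z(3) norm_triangle_ineq4[of "V z - V ?c" "V z' - V ?c"] by simp
    also have "\<dots> \<le> 4 * s" using c[OF z(1)] c[OF z(2)] by simp
    finally have "\<delta>\<^sup>2 \<le> (4 * s)\<^sup>2" by (rule power_mono) (rule d)
    also have "\<dots> = 32 * \<rho> * \<tau>" using r' real by (simp add: s_def power_mult_distrib)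
    also have "\<dots> \<le> 32 * b * \<tau>" using r real by (intro mult_right_mono) auto
    finally show ?thesis using real ab by (simp add: ennreal_mult'[symmetric] ennreal_leI)
  qed
  have "ennreal (\<delta>\<^sup>2 * (b - a)) = (\<integral>\<^sup>+\<rho>. ennreal (\<delta>\<^sup>2) * indicator {a<..<b} \<rho> \<partial>lborel)"
    using ab by (subst nn_integral_cmult_indicator) (auto simp: ennreal_mult)
  also have "\<dots> \<le> (\<integral>\<^sup>+\<rho>. ennreal (32 * b) * T \<rho> \<partial>lborel)"
    by (rule nn_integral_mono) (use main in \<open>auto simp: indicator_def\<close>)
  also have "\<dots> = ennreal (32 * b) * (\<integral>\<^sup>+\<rho>. T \<rho> \<partial>lborel)"
    by (rule nn_integral_cmult) (simp add: T_def)
  \<comment> \<open>Each of the four summands integrates to \<open>E\<close> over the real line,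
    which turns 32 into 128.\<close>
  also have "(\<integral>\<^sup>+\<rho>. T \<rho> \<partial>lborel) = (E + E) + (E + E)"
  proof -
    have 1: "(\<integral>\<^sup>+\<rho>. \<Phi> (x0 + \<rho>) \<partial>lborel) = E" "(\<integral>\<^sup>+\<rho>. \<Xi> (y0 + \<rho>) \<partial>lborel) = E"
      using nn_integral_real_affine[of \<Phi> 1 x0] nn_integral_real_affine[of \<Xi> 1 y0] E by auto
    have 2: "(\<integral>\<^sup>+\<rho>. \<Phi> (x0 - \<rho>) \<partial>lborel) = E" "(\<integral>\<^sup>+\<rho>. \<Xi> (y0 - \<rho>) \<partial>lborel) = E"
      using nn_integral_real_affine[of \<Phi> "-1" x0] nn_integral_real_affine[of \<Xi> "-1" y0] E by auto
    show ?thesis unfolding T_def by (simp add: nn_integral_add 1 2)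
  qed
  also have "ennreal (32 * b) * ((E + E) + (E + E)) = ennreal (128 * b) * E"
  proof -
    have "ennreal (128 * b) = ennreal 4 * ennreal (32 * b)" using ab by (subst ennreal_mult[symmetric]) auto
    moreover have "(E + E) + (E + E) = ennreal 4 * E"
      by (simp add: mult_2[symmetric] mult.assoc[symmetric] numeral_mult_ennreal)
    ultimately show ?thesis by (simp add: mult_ac)
  qed
  finally show ?thesis by (simp add: E_def G_def A_def)
qed

text \<open>Approximants within \<open>\<delta> / 4\<close> of \<open>u\<close> still oscillate by
  \<open>\<delta> / 2\<close>, so the C1 case passes to the limit at the cost of a factor 4, from
  128 to 512.\<close>

lemma length_area:
  assumes S: "open S" and u: "sob S u p q" and ab: "0 < a" "a < b" and A: "sq_annulus z0 a b \<subseteq> S" and d: "\<delta> > 0"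
    and osc: "\<And>\<rho>. a < \<rho> \<Longrightarrow> \<rho> < b \<Longrightarrow> \<exists>z z'. supn (z - z0) = \<rho> \<and> supn (z' - z0) = \<rho> \<and> \<delta> \<le> norm (u z - u z')"
  shows "\<delta>\<^sup>2 * (b - a) \<le> 512 * b * (LINT z|lborel_on S. indicator (sq_annulus z0 a b) z * ((norm (p z))\<^sup>2 + (norm (q z))\<^sup>2))"
proof -
  define A where "A = sq_annulus z0 a b"
  obtain h U P Q B where 1: "p \<in> borel_measurable (lborel_on S)" "q \<in> borel_measurable (lborel_on S)"
    "(h::complex\<Rightarrow>real) \<in> borel_measurable (lborel_on S)" "\<And>n::nat. C1on S (U n) (P n) (Q n)"
    "uniform_limit S U u sequentially"
    "\<And>n z. z \<in> S \<Longrightarrow> norm (U n z) \<le> B" "AE z in lborel_on S. \<forall>n. norm (P n z) \<le> h z \<and> norm (Q n z) \<le> h z"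
    "AE z in lborel_on S. (\<lambda>n. P n z) \<longlonglongrightarrow> p z \<and> (\<lambda>n. Q n z) \<longlonglongrightarrow> q z"
    "integrable (lborel_on S) (\<lambda>z. (h z)\<^sup>2)" by (rule sobE[OF u]) blast
  define e where "e n z = indicator A z * ((norm (P n z))\<^sup>2 + (norm (Q n z))\<^sup>2)" for n z
  have PQm: "P n \<in> borel_measurable (lborel_on S)" "Q n \<in> borel_measurable (lborel_on S)" for n
    using 1(4)[of n] by (auto simp: C1on_def intro!: continuous_on_measurable_lborel_on)
  note [measurable] = PQm 1(1-3)
  have [measurable]: "A \<in> sets borel" by (simp add: A_def)
  have em: "e n \<in> borel_measurable (lborel_on S)" for n unfolding e_def by measurable
  have e_le: "AE z in lborel_on S. norm (e n z) \<le> 2 * (h z)\<^sup>2" for n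
    using 1(7)
  proof eventually_elim
    case (elim z)
    have "(norm (P n z))\<^sup>2 \<le> (h z)\<^sup>2" "(norm (Q n z))\<^sup>2 \<le> (h z)\<^sup>2"
      using elim by (auto intro: power_mono)
    then show ?case by (auto simp: e_def indicator_def)
  qed
  have ih: "integrable (lborel_on S) (\<lambda>z. 2 * (h z)\<^sup>2)" using 1(9) by simp
  have ie: "integrable (lborel_on S) (e n)" for n
  proof (rule Bochner_Integration.integrable_bound[OF ih em])
    show "AE z in lborel_on S. norm (e n z) \<le> norm (2 * (h z)\<^sup>2)"
      using e_le by eventually_elim auto
  qed
  have lim: "(\<lambda>n. LINT z|lborel_on S. e n z) \<longlonglongrightarrow> (LINT z|lborel_on S. indicator A z * ((norm (p z))\<^sup>2 + (norm (q z))\<^sup>2))"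
  proof (rule integral_dominated_convergence[OF _ em ih])
    show "AE z in lborel_on S. (\<lambda>n. e n z) \<longlonglongrightarrow> indicator A z * ((norm (p z))\<^sup>2 + (norm (q z))\<^sup>2)"
      using 1(8) unfolding e_def by eventually_elim (auto intro!: tendsto_intros)
    show "AE z in lborel_on S. norm (e n z) \<le> 2 * (h z)\<^sup>2" for n
      by (rule e_le)
  qed measurable
  have "eventually (\<lambda>n. \<forall>z\<in>S. dist (U n z) (u z) < \<delta> / 4) sequentially"
    using uniform_limitD[OF 1(5), of "\<delta> / 4"] d by simp
  then have "eventually (\<lambda>n. (\<delta> / 2)\<^sup>2 * (b - a) \<le> 128 * b * (LINT z|lborel_on S. e n z)) sequentially"
  proof eventually_elim
    case (elim n)
    have e0: "0 \<le> (LINT z|lborel_on S. e n z)"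
      by (rule Bochner_Integration.integral_nonneg) (simp add: e_def)
    have "ennreal ((\<delta> / 2)\<^sup>2 * (b - a)) \<le> ennreal (128 * b) * (\<integral>\<^sup>+z. ennreal (e n z) \<partial>lborel)"
      unfolding e_def A_def
    proof (rule length_area_C1on[OF 1(4) ab A])
      fix \<rho> assume r: "a < \<rho>" "\<rho> < b"
      obtain z z' where z: "supn (z - z0) = \<rho>" "supn (z' - z0) = \<rho>" "\<delta> \<le> norm (u z - u z')"
        using osc[OF r] by blast
      have "z \<in> S" "z' \<in> S" using z r A by (auto simp: sq_annulus_def)
      then have "dist (U n z) (u z) < \<delta> / 4" "dist (U n z') (u z') < \<delta> / 4" using elim by auto
      moreover have "dist (u z) (u z') \<le> dist (u z) (U n z) + (dist (U n z) (U n z') + dist (U n z') (u z'))"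
        by (meson dist_triangle add_left_mono order_trans)
      ultimately have "\<delta> / 2 \<le> dist (U n z) (U n z')"
        using z(3)[folded dist_norm] dist_commute[of "u z" "U n z"] by linarith
      then have "\<delta> / 2 \<le> norm (U n z - U n z')" by (simp add: dist_norm)
      then show "\<exists>z z'. supn (z - z0) = \<rho> \<and> supn (z' - z0) = \<rho> \<and> \<delta> / 2 \<le> norm (U n z - U n z')"
        using z by blast
    qed (use d in auto)
    also have "(\<integral>\<^sup>+z. ennreal (e n z) \<partial>lborel) = (\<integral>\<^sup>+z. ennreal (e n z) \<partial>lborel_on S)"
    proof -
      have "ennreal (e n z) = ennreal (e n z) * indicator S z" for z
        using A by (auto simp: e_def A_def indicator_def)
      then show ?thesis using S by (subst nn_integral_restrict_space) auto
    qed
    also have "\<dots> = ennreal (LINT z|lborel_on S. e n z)"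
      by (rule nn_integral_eq_integral[OF ie]) (auto simp: e_def)
    also have "ennreal (128 * b) * ennreal (LINT z|lborel_on S. e n z) = ennreal (128 * b * (LINT z|lborel_on S. e n z))"
      using ab by (simp add: ennreal_mult' )
    finally show ?case
      by (subst (asm) ennreal_le_iff) (use ab e0 in auto)
  qed
  then have "(\<delta> / 2)\<^sup>2 * (b - a) \<le> 128 * b * (LINT z|lborel_on S. indicator A z * ((norm (p z))\<^sup>2 + (norm (q z))\<^sup>2))"
    by (intro tendsto_lowerbound[OF tendsto_mult_left[OF lim]]) auto
  then show ?thesis by (simp add: A_def power_divide)
qed

section \<open>A Liouville theorem for zero-free quasiregular maps\<close>

lemma AE_lborel_on_iff: "open S \<Longrightarrow> (AE z in lborel_on S. P z) \<longleftrightarrow> (AE z in lborel. z \<in> S \<longrightarrow> P z)"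
  by (rule AE_restrict_space_iff) auto

lemma sob_subset:
  assumes u: "sob S u p q" and T: "T \<subseteq> S" "open T" "open S"
  shows "sob T u p q"
proof -
  obtain h U P Q B where 1: "p \<in> borel_measurable (lborel_on S)" "q \<in> borel_measurable (lborel_on S)"
    "(h::complex\<Rightarrow>real) \<in> borel_measurable (lborel_on S)" "\<And>n::nat. C1on S (U n) (P n) (Q n)"
    "uniform_limit S U u sequentially"
    "\<And>n z. z \<in> S \<Longrightarrow> norm (U n z) \<le> B" "AE z in lborel_on S. \<forall>n. norm (P n z) \<le> h z \<and> norm (Q n z) \<le> h z"
    "AE z in lborel_on S. (\<lambda>n. P n z) \<longlonglongrightarrow> p z \<and> (\<lambda>n. Q n z) \<longlonglongrightarrow> q z"
    "integrable (lborel_on S) (\<lambda>z. (h z)\<^sup>2)" by (rule sobE[OF u]) blast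
  show ?thesis
  proof (rule sobI[of p T q h U P Q u B])
    show "p \<in> borel_measurable (lborel_on T)" "q \<in> borel_measurable (lborel_on T)" "h \<in> borel_measurable (lborel_on T)"
      using 1(1-3) T(1) measurable_restrict_mono by blast+
    show "AE z in lborel_on T. \<forall>n. norm (P n z) \<le> h z \<and> norm (Q n z) \<le> h z"
    proof -
      have "AE z in lborel. z \<in> S \<longrightarrow> (\<forall>n. norm (P n z) \<le> h z \<and> norm (Q n z) \<le> h z)"
        using 1(7) unfolding AE_lborel_on_iff[OF T(3)] .
      then have "AE z in lborel. z \<in> T \<longrightarrow> (\<forall>n. norm (P n z) \<le> h z \<and> norm (Q n z) \<le> h z)"
        by (rule eventually_mono) (use T in auto)
      then show ?thesis unfolding AE_lborel_on_iff[OF T(2)] .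
    qed
    show "AE z in lborel_on T. (\<lambda>n. P n z) \<longlonglongrightarrow> p z \<and> (\<lambda>n. Q n z) \<longlonglongrightarrow> q z"
    proof -
      have "AE z in lborel. z \<in> S \<longrightarrow> ((\<lambda>n. P n z) \<longlonglongrightarrow> p z \<and> (\<lambda>n. Q n z) \<longlonglongrightarrow> q z)"
        using 1(8) unfolding AE_lborel_on_iff[OF T(3)] .
      then have "AE z in lborel. z \<in> T \<longrightarrow> ((\<lambda>n. P n z) \<longlonglongrightarrow> p z \<and> (\<lambda>n. Q n z) \<longlonglongrightarrow> q z)"
        by (rule eventually_mono) (use T in auto)
      then show ?thesis unfolding AE_lborel_on_iff[OF T(2)] .
    qed
    have "set_integrable lborel S (\<lambda>z. (h z)\<^sup>2)" using 1(9) T by (simp add: integrable_restrict_space set_integrable_def)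
    then have "set_integrable lborel T (\<lambda>z. (h z)\<^sup>2)" by (rule set_integrable_subset) (use T in auto)
    then show "integrable (lborel_on T) (\<lambda>z. (h z)\<^sup>2)" using T by (simp add: integrable_restrict_space set_integrable_def)
    show "uniform_limit T U u sequentially" by (rule uniform_limit_on_subset[OF 1(5) T(1)])
  qed (use 1 T in \<open>auto intro: C1on_subset\<close>)
qed

lemma distortion_subset:
  assumes "distortion K S p q" "T \<subseteq> S" "open T" "open S"
  shows "distortion K T p q"
proof -
  have "AE z in lborel. z \<in> S \<longrightarrow> (norm (p z))\<^sup>2 + (norm (q z))\<^sup>2 \<le> K * Im (cnj (p z) * q z)"
    using assms by (simp add: AE_lborel_on_iff distortion_def)
  then have "AE z in lborel. z \<in> T \<longrightarrow> (norm (p z))\<^sup>2 + (norm (q z))\<^sup>2 \<le> K * Im (cnj (p z) * q z)"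
    by (rule eventually_mono) (use assms in auto)
  then show ?thesis using assms by (simp add: AE_lborel_on_iff distortion_def)
qed

text \<open>A complex factor is the effect on the partials of post-composing with a holomorphic map.
  Both sides of the inequality scale by its squared modulus.\<close>

lemma distortion_mult:
  assumes "distortion K S p q"
  shows "distortion K S (\<lambda>z. c z * p z) (\<lambda>z. c z * q z)"
  using assms unfolding distortion_def
proof eventually_elim
  case (elim z)
  have "cnj (c z * p z) * (c z * q z) = of_real ((norm (c z))\<^sup>2) * (cnj (p z) * q z)"
    by (simp only: complex_norm_square complex_cnj_mult mult_ac)
  then have "Im (cnj (c z * p z) * (c z * q z)) = (norm (c z))\<^sup>2 * Im (cnj (p z) * q z)"
    by (simp only: Im_complex_of_real Re_complex_of_real times_complex.simps)
  then show ?case using mult_left_mono[OF elim zero_le_power2[of "norm (c z)"]]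
    unfolding norm_mult power_mult_distrib by (simp only: distrib_left[symmetric] mult.left_commute[of K])
qed

text \<open>The Cauchy-Riemann form of a complex linear differential.\<close>

lemma rlin_mult: "rlin a (\<i> * a) h = a * h"
  by (simp add: rlin_def complex_eq_iff algebra_simps)

lemma C1on_holomorphic:
  assumes "\<And>w. w \<in> T \<Longrightarrow> (G has_field_derivative a w) (at w)" "continuous_on T a"
  shows "C1on T G a (\<lambda>w. \<i> * a w)"
proof -
  have "rlin (a w) (\<i> * a w) = (*) (a w)" for w by (simp add: fun_eq_iff rlin_mult)
  then show ?thesis using assms by (auto simp: C1on_def has_field_derivative_def intro!: continuous_intros)
qed

text \<open>\<open>N\<close> disjoint rings share one bounded energy, so some ring carries less than
  \<delta>^2 / 1024. The outer half-side being twice the inner one, the ratio 512 b / (b - a) in the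
  length-area estimate is 1024; hence some square boundary in that ring has oscillation below
  \<open>\<delta>\<close>.\<close>

lemma sob_oscillation:
  assumes R: "R > 0" and K: "K > 0" and W: "sob (sq (4 ^ Suc N * R)) W p q"
    and dist: "distortion K (sq (4 ^ Suc N * R)) p q"
    and B: "\<And>z. z \<in> sq (4 ^ Suc N * R) \<Longrightarrow> \<bar>Im (W z)\<bar> \<le> B" "B \<ge> 0"
    and d: "\<delta> > 0" "real N * \<delta>\<^sup>2 > 1024 * (2000 * K\<^sup>2 * B\<^sup>2)"
    and z: "z \<in> csq R" "z' \<in> csq R"
  shows "norm (W z - W z') \<le> 4 * \<delta>"
proof -
  define S where "S = sq (4 ^ Suc N * R)"
  define E where "E z = (norm (p z))\<^sup>2 + (norm (q z))\<^sup>2" for z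
  \<comment> \<open>Each ring doubles its inner half-side while the scale grows by 4, so the closed
    rings are disjoint. The exponent \<open>Suc N\<close> in the hypotheses leaves room for the
    doubled square that the energy bound requires.\<close>
  define A where "A j = sq_annulus 0 (4 ^ j * R) (2 * (4 ^ j * R))" for j :: nat
  have S: "open S" "bounded S" by (auto simp: S_def)
  have pow: "4 ^ j * R \<le> 4 ^ k * R" if "j \<le> k" for j k :: nat
    using R that by (simp add: power_increasing)
  have AS: "A j \<subseteq> csq (4 ^ N * R)" if "j < N" for j
  proof -
    have "2 * (4 ^ j * R) \<le> 4 ^ Suc j * R" using R by simp
    also have "\<dots> \<le> 4 ^ N * R" using that by (intro pow) auto
    finally show ?thesis by (auto simp: A_def sq_annulus_def csq_def)
  qed
  have pos: "4 ^ N * R > 0" using R by simp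
  have CS: "csq (2 * (4 ^ N * R)) \<subseteq> S" using pos by (auto simp: S_def csq_def sq_def)
  have CS': "csq (4 ^ N * R) \<subseteq> S" using pos by (auto simp: S_def csq_def sq_def)
  have E: "integrable (lborel_on S) E" using sob_square_integrable[OF W] by (simp add: E_def[abs_def] S_def)
  have [measurable]: "E \<in> borel_measurable (lborel_on S)" using E by simp
  have iE: "integrable (lborel_on S) (\<lambda>z. indicator X z * E z)" if [measurable]: "X \<in> sets borel" for X
    by (rule Bochner_Integration.integrable_bound[OF E]) (measurable, auto simp: indicator_def)
  have Am[measurable]: "A j \<in> sets borel" for j by (simp add: A_def)
  have total: "(LINT z|lborel_on S. indicator (csq (4 ^ N * R)) z * E z) \<le> 2000 * K\<^sup>2 * B\<^sup>2"
    unfolding E_def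
    by (rule caccioppoli[OF S CS _ K]) (use W dist B R in \<open>auto simp: S_def\<close>)
  have disj: "disjoint_family_on A {..<N}"
  proof -
    have "A i \<inter> A j = {}" if "i < j" for i j
    proof -
      have "2 * (4 ^ i * R) < 4 ^ Suc i * R" using R by simp
      also have "\<dots> \<le> 4 ^ j * R" using that by (intro pow) auto
      finally show ?thesis by (auto simp: A_def sq_annulus_def)
    qed
    then show ?thesis unfolding disjoint_family_on_def by (metis Int_commute linorder_neqE_nat)
  qed
  have "(\<Sum>j<N. (LINT z|lborel_on S. indicator (A j) z * E z)) = (LINT z|lborel_on S. (\<Sum>j<N. indicator (A j) z * E z))"
    by (rule Bochner_Integration.integral_sum[symmetric]) (use iE in auto)
  also have "\<dots> \<le> (LINT z|lborel_on S. indicator (csq (4 ^ N * R)) z * E z)"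
  proof (rule Bochner_Integration.integral_mono)
    fix z
    have "(\<Sum>j<N. indicator (A j) z :: real) = indicator (\<Union>j<N. A j) z"
      using disj by (simp add: indicator_UN_disjoint)
    also have "\<dots> \<le> indicator (csq (4 ^ N * R)) z" using AS by (auto simp: indicator_def)
    finally show "(\<Sum>j<N. indicator (A j) z * E z) \<le> indicator (csq (4 ^ N * R)) z * E z"
      unfolding sum_distrib_right[symmetric] by (rule mult_right_mono) (simp add: E_def)
  qed (intro Bochner_Integration.integrable_sum iE Am csq_borel)+
  finally have sumA: "(\<Sum>j<N. (LINT z|lborel_on S. indicator (A j) z * E z)) \<le> 2000 * K\<^sup>2 * B\<^sup>2" using total by linarith
  have "\<exists>j<N. 1024 * (LINT z|lborel_on S. indicator (A j) z * E z) < \<delta>\<^sup>2"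
  proof (rule ccontr)
    assume neg: "\<not> ?thesis"
    have "\<delta>\<^sup>2 \<le> 1024 * (LINT z|lborel_on S. indicator (A j) z * E z)" if "j < N" for j
      using neg that not_less by blast
    then have "(\<Sum>j<N. \<delta>\<^sup>2) \<le> (\<Sum>j<N. 1024 * (LINT z|lborel_on S. indicator (A j) z * E z))"
      by (intro sum_mono) simp
    also have "\<dots> = 1024 * (\<Sum>j<N. (LINT z|lborel_on S. indicator (A j) z * E z))" by (simp add: sum_distrib_left)
    also have "\<dots> \<le> 1024 * (2000 * K\<^sup>2 * B\<^sup>2)" using sumA by (intro mult_left_mono) auto
    finally show False using d by simp
  qed
  then obtain j where j: "j < N" "1024 * (LINT z|lborel_on S. indicator (A j) z * E z) < \<delta>\<^sup>2" by blast
  have "\<exists>\<rho>. 4 ^ j * R < \<rho> \<and> \<rho> < 2 * (4 ^ j * R) \<and> (\<forall>z z'. supn z = \<rho> \<longrightarrow> supn z' = \<rho> \<longrightarrow> norm (W z - W z') < \<delta>)"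
  proof (rule ccontr)
    assume *: "\<not> ?thesis"
    have "\<delta>\<^sup>2 * (2 * (4 ^ j * R) - 4 ^ j * R) \<le> 512 * (2 * (4 ^ j * R)) * (LINT z|lborel_on S. indicator (sq_annulus 0 (4 ^ j * R) (2 * (4 ^ j * R))) z * ((norm (p z))\<^sup>2 + (norm (q z))\<^sup>2))"
    proof (rule length_area[OF S(1) _ _ _ _ d(1)])
      show "sq_annulus 0 (4 ^ j * R) (2 * (4 ^ j * R)) \<subseteq> S" using AS[OF j(1)] CS' by (simp add: A_def)
      show "\<exists>z z'. supn (z - 0) = \<rho> \<and> supn (z' - 0) = \<rho> \<and> \<delta> \<le> norm (W z - W z')"
        if "4 ^ j * R < \<rho>" "\<rho> < 2 * (4 ^ j * R)" for \<rho>
        using * that unfolding diff_0_right by (meson not_less)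
    qed (use W R in \<open>auto simp: S_def\<close>)
    then have "\<delta>\<^sup>2 * (4 ^ j * R) \<le> (1024 * (LINT z|lborel_on S. indicator (A j) z * E z)) * (4 ^ j * R)"
      by (simp add: A_def E_def algebra_simps)
    then have "\<delta>\<^sup>2 \<le> 1024 * (LINT z|lborel_on S. indicator (A j) z * E z)"
      by (rule mult_right_le_imp_le) (use R in simp)
    with j show False by simp
  qed
  then obtain \<rho> where r: "4 ^ j * R < \<rho>" "\<rho> < 2 * (4 ^ j * R)" "\<And>z z'. supn z = \<rho> \<Longrightarrow> supn z' = \<rho> \<Longrightarrow> norm (W z - W z') < \<delta>"
    by blast
  have rR: "R \<le> \<rho>" using r(1) pow[of 0 j] by simp
  have rS: "csq \<rho> \<subseteq> S"
  proof -
    have "2 * (4 ^ j * R) \<le> 4 ^ Suc j * R" using R by simp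
    also have "\<dots> \<le> 4 ^ N * R" using j by (intro pow) auto
    finally have "csq \<rho> \<subseteq> csq (4 ^ N * R)" using r by (auto simp: csq_def)
    then show ?thesis using CS' by blast
  qed
  define z1 where "z1 = complex_of_real \<rho>"
  have z1: "supn z1 = \<rho>" using rR R by (simp add: z1_def supn_def)
  \<comment> \<open>A rotation \<open>c\<close> preserves distortion. The values 1, -1,
    \<open>\<i>\<close> and \<open>-\<i>\<close> of \<open>c\<close> bound the real and imaginary
    parts from both sides.\<close>
  have one: "Re (c * W z) \<le> Re (c * W z1) + \<delta>" if "z \<in> csq \<rho>" "norm c = 1" for z c
  proof (rule sob_max_principle[of \<rho> K "\<lambda>z. c * W z"])
    have Ws: "sob S W p q" using W by (simp add: S_def)
    have sub: "sq \<rho> \<subseteq> S" using rS sq_subset_csq by blast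
    obtain B0 where B0: "\<And>z. z \<in> sq \<rho> \<Longrightarrow> norm (W z) \<le> B0" using sob_bounded[OF sob_subset[OF Ws sub]] S by auto
    have "C1on UNIV (\<lambda>w. c * w) (\<lambda>_. c) (\<lambda>_. \<i> * c)"
      by (rule C1on_holomorphic) (auto intro!: derivative_eq_intros)
    from sob_compose[OF sob_subset[OF Ws sub] compact_cball[of 0 B0] subset_UNIV open_UNIV _ this] B0
    show "sob (sq \<rho>) (\<lambda>z. c * W z) (\<lambda>z. c * p z) (\<lambda>z. c * q z)" using S by (simp add: rlin_mult)
    show "distortion K (sq \<rho>) (\<lambda>z. c * p z) (\<lambda>z. c * q z)"
      by (intro distortion_mult distortion_subset[OF _ sub]) (use dist S in \<open>auto simp: S_def\<close>)
    show "continuous_on (csq \<rho>) (\<lambda>z. c * W z)"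
      by (intro continuous_intros continuous_on_subset[OF sob_continuous[OF Ws] rS])
    show "Re (c * W z) \<le> Re (c * W z1) + \<delta>" if "supn z = \<rho>" for z
    proof -
      have "Re (c * W z) - Re (c * W z1) = Re (c * (W z - W z1))" by (simp add: algebra_simps)
      also have "\<dots> \<le> norm (c * (W z - W z1))" by (rule complex_Re_le_cmod)
      also have "\<dots> < \<delta>" using r(3)[OF that z1] \<open>norm c = 1\<close> by (simp add: norm_mult)
      finally show ?thesis by simp
    qed
  qed (use that rR R K in auto)
  have two: "norm (W z - W z1) \<le> 2 * \<delta>" if "z \<in> csq R" for z
  proof -
    have "z \<in> csq \<rho>" using that rR by (auto simp: csq_def)
    note * = one[OF this]
    have "\<bar>Re (W z - W z1)\<bar> \<le> \<delta>" "\<bar>Im (W z - W z1)\<bar> \<le> \<delta>"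
      using *[of 1] *[of "-1"] *[of \<i>] *[of "-\<i>"] by auto
    then show ?thesis using cmod_le[of "W z - W z1"] by linarith
  qed
  have "norm (W z - W z') \<le> norm (W z - W z1) + norm (W z' - W z1)"
    using norm_triangle_ineq4[of "W z - W z1" "W z' - W z1"] by simp
  also have "\<dots> \<le> 4 * \<delta>" using two[OF z(1)] two[OF z(2)] by simp
  finally show ?thesis .
qed

lemma quasiregular_liouville:
  assumes K: "K > 0" and g: "continuous_on UNIV g" "\<And>z. g z \<noteq> 0"
    and sob: "\<And>R. R > 0 \<Longrightarrow> sob (sq R) g p q" and dist: "\<And>R. R > 0 \<Longrightarrow> distortion K (sq R) p q"
    and growth: "\<And>n z. z \<in> csq (4 ^ n) \<Longrightarrow> norm (g z) \<le> D * L ^ n" and DL: "D > 0" "L \<ge> 1"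
  shows "g z = g 0"
proof -
  obtain w where w: "continuous_on UNIV w" "\<And>z. g z = exp (w z)"
    using continuous_logarithm_on_contractible[OF g(1) contractible_UNIV] g(2) by auto
  define s where "s z = w z - w 0" for z
  define \<alpha> \<beta> where "\<alpha> = \<bar>ln D\<bar> + \<bar>Re (w 0)\<bar> + 1" and "\<beta> = ln L"
  have \<alpha>\<beta>: "\<alpha> \<ge> 1" "\<beta> \<ge> 0" using DL by (auto simp: \<alpha>_def \<beta>_def)
  have up: "Re (s z) \<le> \<alpha> + \<beta> * real n" if "z \<in> csq (4 ^ n)" for z n
  proof -
    have "exp (Re (w z)) \<le> D * L ^ n" using growth[OF that] by (simp add: w(2))
    then have "Re (w z) \<le> ln (D * L ^ n)" using DL by (simp add: ln_ge_iff)
    also have "\<dots> = ln D + real n * ln L" using DL by (simp add: ln_mult ln_realpow)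
    finally show ?thesis unfolding s_def \<alpha>_def \<beta>_def by (simp add: algebra_simps)
  qed
  have "isCont exp (0::complex)" by simp
  then have "\<exists>d>0. \<forall>x::complex. dist x 0 < d \<longrightarrow> dist (exp x) (exp 0) < 1/4"
    unfolding continuous_at_eps_delta by (elim allE[of _ "1/4"]) simp
  then obtain d0 where d0: "d0 > 0" "\<And>x::complex. norm x < d0 \<Longrightarrow> norm (exp x - 1) < 1/4"
    by (auto simp: dist_norm)
  \<comment> \<open>With this choice the oscillation bound \<open>4 * \<delta>\<close> equals
    \<open>d0 / 2\<close>, strictly below \<open>d0\<close>.\<close>
  define \<delta> where "\<delta> = d0 / 8"
  have \<delta>: "\<delta> > 0" using d0 by (simp add: \<delta>_def)
  \<comment> \<open>\<open>N\<close> depends on \<open>K\<close> and \<open>\<delta>\<close> only,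
    since pi bounds the imaginary part of \<open>Ln\<close>; one shrinking factor therefore serves
    every scale and every bound \<open>M\<close>.\<close>
  obtain N :: nat where N: "1024 * (2000 * K\<^sup>2 * pi\<^sup>2) / \<delta>\<^sup>2 < real N" using reals_Archimedean2 by blast
  then have N': "real N * \<delta>\<^sup>2 > 1024 * (2000 * K\<^sup>2 * pi\<^sup>2)" using \<delta> by (simp add: divide_less_eq)
  have step: "norm (s z) \<le> M / 2" if M: "M > 0" "\<And>z. z \<in> csq (4 ^ (n + Suc N)) \<Longrightarrow> Re (s z) \<le> M" and z: "z \<in> csq (4 ^ n)" for M n z
  proof -
    let ?R = "4 ^ (n + Suc N) :: real"
    let ?S = "sq ?R"
    have cR: "compact (csq ?R)" by (rule compact_csq)
    have ne: "csq ?R \<noteq> {}" by (auto simp: csq_def intro!: exI[of _ 0])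
    have "continuous_on (csq ?R) (\<lambda>z. norm (g z))" by (intro continuous_on_norm continuous_on_subset[OF g(1)]) auto
    from continuous_attains_inf[OF cR ne this] obtain zm where zm: "\<And>z. z \<in> csq ?R \<Longrightarrow> norm (g zm) \<le> norm (g z)" by blast
    have cw: "compact (w ` csq ?R)" by (intro compact_continuous_image cR continuous_on_subset[OF w(1)]) auto
    obtain Bw where Bw: "\<And>z. z \<in> csq ?R \<Longrightarrow> norm (w z) \<le> Bw"
      using compact_imp_bounded[OF cw] by (auto simp: bounded_iff)
    have inS: "z \<in> csq ?R" if "z \<in> ?S" for z using that sq_subset_csq by blast
    have slog: "sob ?S w (\<lambda>z. p z / g z) (\<lambda>z. q z / g z)"
      by (rule sob_log[OF open_sq sob, where c = "norm (g zm)" and D = Bw])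
         (use g(2) zm Bw inS w in \<open>auto intro: continuous_on_subset\<close>)
    \<comment> \<open>On this half-plane the argument of \<open>Ln\<close> has positive real part,
      so \<open>Ln\<close> is holomorphic there; the bound \<open>Re (s z) \<le> M\<close> with
      \<open>M > 0\<close> puts the values of \<open>w\<close> into it.\<close>
    define T where "T = {w'. Re (w' - w 0) < 2 * M}"
    have T: "open T" unfolding T_def by (intro open_Collect_less continuous_intros)
    define a where "a w' = - inverse (2 * M - (w' - w 0))" for w' :: complex
    have Re2: "Re (2 * M - (w' - w 0)) > 0" if "w' \<in> T" for w' using that by (simp add: T_def)
    have nz: "2 * M - (w' - w 0) \<notin> \<real>\<^sub>\<le>\<^sub>0" "2 * M - (w' - w 0) \<noteq> 0" if "w' \<in> T" for w'
      using Re2[OF that] by (simp_all only: complex_nonpos_Reals_iff not_le) (simp, metis less_irrefl zero_complex.sel(1))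
    have C1: "C1on T (\<lambda>w'. Ln (2 * M - (w' - w 0))) a (\<lambda>w'. \<i> * a w')"
    proof (rule C1on_holomorphic)
      show "((\<lambda>w'. Ln (2 * M - (w' - w 0))) has_field_derivative a w') (at w')" if "w' \<in> T" for w'
        unfolding a_def using nz[OF that] by (auto intro!: derivative_eq_intros simp: divide_inverse)
      show "continuous_on T a" unfolding a_def[abs_def] using nz by (intro continuous_intros) auto
    qed
    have wT: "w ` csq ?R \<subseteq> T"
    proof -
      have "Re (w z - w 0) < 2 * M" if "z \<in> csq ?R" for z using M(1) M(2)[OF that] by (simp add: s_def)
      then show ?thesis by (auto simp: T_def)
    qed
    have W: "sob ?S (\<lambda>z. Ln (2 * M - (w z - w 0))) (\<lambda>z. a (w z) / g z * p z) (\<lambda>z. a (w z) / g z * q z)"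
      using sob_compose[OF slog cw wT T _ C1] inS by (simp add: rlin_mult)
    have sN: "?R = 4 ^ Suc N * 4 ^ n" by (simp add: power_add)
    have osc: "norm (Ln (2 * M - (w z - w 0)) - Ln (2 * M - (w 0 - w 0))) \<le> 4 * \<delta>"
    proof (rule sob_oscillation[where W = "\<lambda>z. Ln (2 * M - (w z - w 0))" and R = "4 ^ n", OF _ K _ _ _ _ \<delta> N'])
      show "sob (sq (4 ^ Suc N * 4 ^ n)) (\<lambda>z. Ln (2 * M - (w z - w 0))) (\<lambda>z. a (w z) / g z * p z) (\<lambda>z. a (w z) / g z * q z)"
        using W unfolding sN .
      show "distortion K (sq (4 ^ Suc N * 4 ^ n)) (\<lambda>z. a (w z) / g z * p z) (\<lambda>z. a (w z) / g z * q z)"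
        by (intro distortion_mult dist) simp
      show "\<bar>Im (Ln (2 * M - (w z - w 0)))\<bar> \<le> pi" if "z \<in> sq (4 ^ Suc N * 4 ^ n)" for z
      proof -
        have "w z \<in> T" using inS[of z] that wT unfolding sN by blast
        then show ?thesis using nz(2)[of "w z"] mpi_less_Im_Ln[of "2 * M - (w z - w 0)"] Im_Ln_le_pi[of "2 * M - (w z - w 0)"] by auto
      qed
    qed (use z in \<open>auto simp: csq_def\<close>)
    define x where "x = Ln (2 * M - (w z - w 0)) - Ln (2 * M - (w 0 - w 0))"
    have "norm (exp x - 1) < 1/4" using osc d0 unfolding x_def \<delta>_def by (intro d0(2)) auto
    have "csq (4 ^ n) \<subseteq> csq ?R"
      using power_increasing[of n "n + Suc N" "4::real"] by (auto simp: csq_def)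
    then have "w z \<in> T" "w 0 \<in> T" using z wT M by (auto simp: T_def)
    \<comment> \<open>Since \<open>s 0 = 0\<close>, this quotient compares \<open>s z\<close> with
      the reference value at 0: being within 1/4 of 1 means that \<open>norm (s z)\<close> is less
      than a quarter of \<open>2 * M\<close>.\<close>
    then have "exp x = (2 * M - s z) / (2 * M)" using nz(2) M by (simp add: x_def exp_diff s_def)
    then have "s z = - (exp x - 1) * (2 * M)" using M by (simp add: field_simps)
    then have "norm (s z) = norm (exp x - 1) * (2 * M)" using M by (simp add: norm_mult norm_minus_commute)
    also have "\<dots> \<le> 1/4 * (2 * M)" using \<open>norm (exp x - 1) < 1/4\<close> M by (intro mult_right_mono) auto
    finally show ?thesis by simp
  qed
  \<comment> \<open>Each halving consumes \<open>Suc N\<close> levels of scale, so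
    \<open>Suc m\<close> halvings start from the bound at level
    \<open>n + Suc m * Suc N\<close>.\<close>
  have iter: "norm (s z) \<le> (1/2) ^ Suc m * (\<alpha> + \<beta> * real (n + Suc m * Suc N))" if "z \<in> csq (4 ^ n)" for z n m
    using that
  proof (induction m arbitrary: n z)
    case 0
    show ?case using step[of "\<alpha> + \<beta> * real (n + Suc N)" n z] up[of _ "n + Suc N"] \<alpha>\<beta> 0 by (simp add: add_pos_nonneg)
  next
    case (Suc m)
    let ?M = "(1/2) ^ Suc m * (\<alpha> + \<beta> * real ((n + Suc N) + Suc m * Suc N))"
    have "norm (s z) \<le> ?M / 2"
    proof (rule step[OF _ _ Suc.prems])
      show "?M > 0" using \<alpha>\<beta> by (intro mult_pos_pos add_pos_nonneg) auto
      show "Re (s z) \<le> ?M" if "z \<in> csq (4 ^ (n + Suc N))" for z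
        using Suc.IH[OF that] complex_Re_le_cmod[of "s z"] by linarith
    qed
    also have "?M / 2 = (1/2) ^ Suc (Suc m) * (\<alpha> + \<beta> * real (n + Suc (Suc m) * Suc N))"
      by (simp add: algebra_simps)
    finally show ?case .
  qed
  obtain n :: nat where "supn z \<le> 4 ^ n" using real_arch_pow[of 4 "supn z"] by (auto intro: less_imp_le)
  then have zn: "z \<in> csq (4 ^ n)" by (simp add: csq_def)
  have "(\<lambda>m. (1/2) ^ Suc m * (\<alpha> + \<beta> * real (n + Suc m * Suc N))) \<longlonglongrightarrow> 0"
    by real_asymp
  then have "norm (s z) \<le> 0" by (rule LIMSEQ_le_const) (use iter[OF zn] in auto)
  then show ?thesis by (simp add: w(2) s_def)
qed

section \<open>Polynomial growth of quasiconformal homeomorphisms\<close>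

text \<open>The antiderivative of the square of \<open>smoothstep'\<close>, with total rise 12 - 18
  + 36/5 = 6/5. Used as a test function of ln |f|, it produces exactly the weight that occurs in the
  energy of \<open>smoothstep\<close>.\<close>

definition sqstep :: "real \<Rightarrow> real" where
  "sqstep t = 12 * (clip01 t)^3 - 18 * (clip01 t)^4 + 36/5 * (clip01 t)^5"

lemma DERIV_sqstep: "(sqstep has_real_derivative (smoothstep' t)\<^sup>2) (at t)"
proof -
  have "((\<lambda>t. 12 * (clip01 t)^3 - 18 * (clip01 t)^4 + 36/5 * (clip01 t)^5) has_real_derivative (6 * clip01 t * (1 - clip01 t))\<^sup>2) (at t)"
    by (rule DERIV_clip01[where P = "\<lambda>x. 12 * x^3 - 18 * x^4 + 36/5 * x^5" and P' = "\<lambda>x. (6 * x * (1 - x))\<^sup>2"])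
       (auto intro!: derivative_eq_intros simp: algebra_simps power2_eq_square power3_eq_cube power4_eq_xxxx)
  then show ?thesis by (simp add: sqstep_def[abs_def] smoothstep'_def)
qed

lemma sqstep_eq [simp]: "t \<le> 0 \<Longrightarrow> sqstep t = 0" "t \<ge> 1 \<Longrightarrow> sqstep t = 6/5"
  by (auto simp: sqstep_def)

lemma C1on_affine:
  assumes "C1on S u p q" shows "C1on S (\<lambda>z. c * u z + d) (\<lambda>z. c * p z) (\<lambda>z. c * q z)"
proof -
  have "C1on UNIV (\<lambda>w. c * w + d) (\<lambda>_. c) (\<lambda>_. \<i> * c)"
    by (rule C1on_holomorphic) (auto intro!: derivative_eq_intros)
  from C1on_compose[OF assms this] show ?thesis by (simp add: rlin_mult)
qed

text \<open>The differential of ln |w| in direction h is Re (h / w). The compact set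
  \<open>C\<close> keeps the values of \<open>f\<close> away from the singularity at 0.\<close>

lemma sob_of_ln_norm:
  assumes f: "sob S f p q" and C: "compact C" "0 \<notin> C" "\<And>z. z \<in> S \<Longrightarrow> f z \<in> C"
    and \<phi>: "\<And>t. (\<phi> has_real_derivative \<phi>' t) (at t)" "continuous_on UNIV \<phi>'"
  shows "sob S (\<lambda>z. of_real (\<phi> (ln (norm (f z))))) (\<lambda>z. of_real (\<phi>' (ln (norm (f z))) * Re (p z / f z)))
      (\<lambda>z. of_real (\<phi>' (ln (norm (f z))) * Re (q z / f z)))"
proof -
  have C1: "C1on (- {0}) (\<lambda>w. complex_of_real (\<phi> (ln (norm w)))) (\<lambda>w. of_real (\<phi>' (ln (norm w)) * Re (1 / w))) (\<lambda>w. of_real (\<phi>' (ln (norm w)) * Re (\<i> / w)))"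
  proof (rule C1on_of_real)
    fix w :: complex assume w: "w \<in> - {0}"
    have N1: "(norm has_derivative (\<lambda>h. (w \<bullet> h) / norm w)) (at w)"
      using has_derivative_norm[of w] w by (auto simp: sgn_div_norm divide_inverse inner_commute mult.commute)
    have "norm w > 0" using w by simp
    from has_derivative_compose[OF N1 DERIV_ln[OF this, unfolded has_field_derivative_def]]
    have "((\<lambda>w. ln (norm w)) has_derivative (\<lambda>h. (w \<bullet> h) / norm w * inverse (norm w))) (at w)"
      by (simp only: mult.commute)
    from has_derivative_compose[OF this \<phi>(1)[unfolded has_field_derivative_def]]
    have "((\<lambda>w. \<phi> (ln (norm w))) has_derivative (\<lambda>h. \<phi>' (ln (norm w)) * ((w \<bullet> h) / norm w * inverse (norm w)))) (at w)" .
    moreover have "(\<lambda>h. \<phi>' (ln (norm w)) * ((w \<bullet> h) / norm w * inverse (norm w)))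
      = (\<lambda>h. Re h * (\<phi>' (ln (norm w)) * Re (1 / w)) + Im h * (\<phi>' (ln (norm w)) * Re (\<i> / w)))"
    proof
      fix h
      have "(w \<bullet> h) / norm w * inverse (norm w) = Re h * Re (1 / w) + Im h * Re (\<i> / w)"
      proof -
        have "(w \<bullet> h) / norm w * inverse (norm w) = (w \<bullet> h) / (norm w)\<^sup>2"
          by (simp add: divide_inverse power2_eq_square)
        then show ?thesis
          unfolding cmod_power2 by (simp add: inner_complex_def Re_divide add_divide_distrib mult.commute)
      qed
      then show "\<phi>' (ln (norm w)) * ((w \<bullet> h) / norm w * inverse (norm w)) = Re h * (\<phi>' (ln (norm w)) * Re (1 / w)) + Im h * (\<phi>' (ln (norm w)) * Re (\<i> / w))"
        by (simp add: algebra_simps)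
    qed
    ultimately show "((\<lambda>w. \<phi> (ln (norm w))) has_derivative (\<lambda>h. Re h * (\<phi>' (ln (norm w)) * Re (1 / w)) + Im h * (\<phi>' (ln (norm w)) * Re (\<i> / w)))) (at w)"
      by simp
  next
    have "continuous_on (- {0 :: complex}) (\<lambda>w. \<phi>' (ln (norm w)))"
      by (rule continuous_on_compose2[OF \<phi>(2)]) (auto intro!: continuous_intros)
    then show "continuous_on (- {0 :: complex}) (\<lambda>w. \<phi>' (ln (norm w)) * Re (1 / w))" "continuous_on (- {0 :: complex}) (\<lambda>w. \<phi>' (ln (norm w)) * Re (\<i> / w))"
      by (auto intro!: continuous_intros)
  qed
  have "rlin (of_real (c * Re (1 / w))) (of_real (c * Re (\<i> / w))) h = of_real (c * Re (h / w))" for c w h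
  proof -
    have "Re (h / w) = Re h * Re (1 / w) + Im h * Re (\<i> / w)"
      by (simp add: Re_divide add_divide_distrib)
    then show ?thesis by (simp add: rlin_def scaleR_conv_of_real algebra_simps)
  qed
  then show ?thesis
    using sob_compose[OF f C(1) _ _ C(3) C1] C(2) by auto
qed

lemma sphere_meets_connected:
  assumes C: "connected C" and x: "x \<in> C" "y \<in> C" "supn (x - c) \<le> \<rho>" "\<rho> \<le> supn (y - c)"
  shows "\<exists>z\<in>C. supn (z - c) = \<rho>"
proof -
  have "connected ((\<lambda>z. supn (z - c)) ` C)"
    by (intro connected_continuous_image C continuous_intros)
  then have "{supn (x - c)..supn (y - c)} \<subseteq> (\<lambda>z. supn (z - c)) ` C"
    using x by (intro connected_contains_Icc) auto
  then show ?thesis using x by (auto dest!: subsetD[of _ _ \<rho>])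
qed

text \<open>\<open>\<kappa>\<close> is the flux of \<open>d (arg f)\<close> through the fixed ring \<open>1 \<le> supn z \<le> 2\<close>. It does not depend
  on \<open>m\<close>, \<open>M\<close>, \<open>r\<close> and \<open>\<rho>\<close>, which makes the energy bound uniform.\<close>

lemma ring_energy:
  assumes K: "K > 0" and f: "\<And>z. z \<noteq> 0 \<Longrightarrow> f z \<noteq> 0" "continuous_on UNIV f"
    and sob: "\<And>R. R > 0 \<Longrightarrow> sob (sq R) f p q" and dist: "\<And>R. R > 0 \<Longrightarrow> distortion K (sq R) p q"
    and mM: "m < M" and r: "0 < r" "r \<le> 1/4" and \<rho>: "\<rho> \<ge> 4"
    and lo: "\<And>z. supn z \<le> 2 * r \<Longrightarrow> z \<noteq> 0 \<Longrightarrow> ln (norm (f z)) \<le> m" and hi: "\<And>z. \<rho> / 2 \<le> supn z \<Longrightarrow> M \<le> ln (norm (f z))"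
  defines "S \<equiv> {z. r / 2 < supn z} \<inter> sq (2 * \<rho>)"
    and "t \<equiv> \<lambda>z. (ln (norm (f z)) - m) / (M - m)"
    and "\<kappa> \<equiv> (LINT z|lborel. cutx 1 2 z * Im (q z / f z) - cuty 1 2 z * Im (p z / f z))"
  defines "v1 \<equiv> \<lambda>z. complex_of_real (smoothstep' (t z) / (M - m) * Re (p z / f z))"
    and "v2 \<equiv> \<lambda>z. complex_of_real (smoothstep' (t z) / (M - m) * Re (q z / f z))"
  shows "sob S (\<lambda>z. of_real (smoothstep (t z))) v1 v2"
    and "integrable (lborel_on S) (\<lambda>z. (norm (v1 z))\<^sup>2 + (norm (v2 z))\<^sup>2)"
    and "(LINT z|lborel_on S. (norm (v1 z))\<^sup>2 + (norm (v2 z))\<^sup>2) \<le> 2 * K * \<bar>\<kappa>\<bar> / (M - m)"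
proof -
  have S: "open S" "bounded S"
    unfolding S_def by (intro open_Int open_Collect_less continuous_intros open_sq) (rule bounded_Int, simp)
  have Ssub: "S \<subseteq> sq (2 * \<rho>)" by (auto simp: S_def)
  have fS: "sob S f p q" by (rule sob_subset[OF sob Ssub]) (use S \<rho> in auto)
  have dS: "distortion K S p q" by (rule distortion_subset[OF dist Ssub]) (use S \<rho> in auto)
  define A where "A = csq (2 * \<rho>) \<inter> {z. r / 2 \<le> supn z}"
  have "compact A" unfolding A_def by (intro compact_Int_closed compact_csq closed_Collect_le continuous_intros)
  define C where "C = f ` A"
  have C: "compact C" unfolding C_def by (intro compact_continuous_image \<open>compact A\<close> continuous_on_subset[OF f(2)]) auto
  have C0: "0 \<notin> C"
  proof
    assume "0 \<in> C"
    then obtain z where "z \<in> A" "f z = 0" unfolding C_def by auto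
    then have "z = 0" "r / 2 \<le> supn z" using f(1) by (auto simp: A_def)
    then show False using r by simp
  qed
  have SC: "f z \<in> C" if "z \<in> S" for z
    unfolding C_def by (rule imageI) (use that in \<open>auto simp: A_def S_def csq_def sq_def\<close>)
  have f0: "f z \<noteq> 0" if "z \<in> S" for z using SC[OF that] C0 by metis
  let ?\<psi> = "\<lambda>x. sqstep ((x - m) / (M - m)) / (M - m)" and ?\<psi>' = "\<lambda>x. (smoothstep' ((x - m) / (M - m)) / (M - m))\<^sup>2"
  define tot where "tot = (6/5) / (M - m)"
  have D1: "(?\<psi> has_real_derivative ?\<psi>' x) (at x)" for x
  proof -
    have "((\<lambda>x. (x - m) / (M - m)) has_real_derivative 1 / (M - m)) (at x)"
      using mM by (auto intro!: derivative_eq_intros)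
    from DERIV_cdivide[OF DERIV_chain2[OF DERIV_sqstep this], of "M - m"] show ?thesis
      by (simp add: power_divide power2_eq_square)
  qed
  have c1: "continuous_on UNIV ?\<psi>'" using mM by (intro continuous_intros) auto
  have D2: "((\<lambda>x. smoothstep ((x - m) / (M - m))) has_real_derivative smoothstep' ((x - m) / (M - m)) / (M - m)) (at x)" for x
  proof -
    have "((\<lambda>x. (x - m) / (M - m)) has_real_derivative 1 / (M - m)) (at x)"
      using mM by (auto intro!: derivative_eq_intros)
    from DERIV_chain2[OF DERIV_smoothstep this] show ?thesis by simp
  qed
  have c2: "continuous_on UNIV (\<lambda>x. smoothstep' ((x - m) / (M - m)) / (M - m))" using mM by (intro continuous_intros) auto
  show v: "sob S (\<lambda>z. of_real (smoothstep (t z))) v1 v2"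
    unfolding t_def v1_def v2_def by (rule sob_of_ln_norm[OF fS C C0 SC D2 c2])
  show iv: "integrable (lborel_on S) (\<lambda>z. (norm (v1 z))\<^sup>2 + (norm (v2 z))\<^sup>2)"
    by (intro Bochner_Integration.integrable_add sob_square_integrable[OF v])
  define \<psi> \<psi>' where "\<psi> z = sqstep (t z) / (M - m)" and "\<psi>' z = (smoothstep' (t z) / (M - m))\<^sup>2" for z
  have \<psi>: "sob S (\<lambda>z. of_real (\<psi> z)) (\<lambda>z. of_real (\<psi>' z * Re (p z / f z))) (\<lambda>z. of_real (\<psi>' z * Re (q z / f z)))"
    unfolding t_def \<psi>_def \<psi>'_def by (rule sob_of_ln_norm[OF fS C C0 SC D1 c1])
  have sub: "C \<subseteq> - {0}" "open (- {0 :: complex})" using C0 by auto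
  have inv0: "C1on (- {0}) inverse (\<lambda>w. - inverse (w\<^sup>2)) (\<lambda>w. \<i> * - inverse (w\<^sup>2 :: complex))"
    by (rule C1on_holomorphic) (auto intro!: derivative_eq_intros continuous_intros simp: power2_eq_square)
  have inv: "sob S (\<lambda>z. inverse (f z)) (\<lambda>z. - inverse ((f z)\<^sup>2) * p z) (\<lambda>z. - inverse ((f z)\<^sup>2) * q z)"
    using sob_compose[OF fS C sub SC inv0] by (simp only: rlin_mult)
  have cb: "0 \<le> cut 1 2 z" "cut 1 2 z \<le> 1" "\<bar>cutx 1 2 z\<bar> \<le> 3" "\<bar>cuty 1 2 z\<bar> \<le> 3" for z
    using cut_props[of 1 2 z] by auto
  have eta: "sob S (\<lambda>z. of_real tot * of_real (cut 1 2 z) + (- of_real tot)) (\<lambda>z. of_real tot * of_real (cutx 1 2 z)) (\<lambda>z. of_real tot * of_real (cuty 1 2 z))"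
  proof (rule sob_C1on[OF S C1on_affine[OF C1on_cut], where B = "3 * \<bar>tot\<bar>"])
    fix z
    have "norm (of_real tot * of_real (cut 1 2 z) + (- of_real tot) :: complex) = \<bar>tot * (cut 1 2 z - 1)\<bar>"
      by (metis norm_of_real of_real_mult of_real_diff of_real_1 right_diff_distrib mult_1_right diff_conv_add_uminus)
    also have "\<dots> \<le> \<bar>tot\<bar> * 3" unfolding abs_mult by (rule mult_left_mono) (use cb(1,2)[of z] in auto)
    finally show "norm (of_real tot * of_real (cut 1 2 z) + (- of_real tot) :: complex) \<le> 3 * \<bar>tot\<bar>" by simp
    show "norm (of_real tot * of_real (cutx 1 2 z) :: complex) \<le> 3 * \<bar>tot\<bar>" "norm (of_real tot * of_real (cuty 1 2 z) :: complex) \<le> 3 * \<bar>tot\<bar>"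
      using mult_left_mono[OF cb(3)[of z], of "\<bar>tot\<bar>"] mult_left_mono[OF cb(4)[of z], of "\<bar>tot\<bar>"] by (simp_all add: norm_mult)
  qed
  \<comment> \<open>\<open>\<psi>\<close> rises from 0 near the inner boundary to \<open>tot\<close>
    near the outer one. Subtracting \<open>tot * (1 - cut 1 2 z)\<close>, which has the same
    boundary values, gives compact support in the ring. The correction is fixed up to the factor
    \<open>tot\<close> and is the source of the flux \<open>\<kappa>\<close>.\<close>
  define \<alpha> \<alpha>1 \<alpha>2 where "\<alpha> z = \<psi> z + tot * (cut 1 2 z - 1)" and "\<alpha>1 z = \<psi>' z * Re (p z / f z) + tot * cutx 1 2 z"
    and "\<alpha>2 z = \<psi>' z * Re (q z / f z) + tot * cuty 1 2 z" for z
  have \<alpha>: "sob S (\<lambda>z. of_real (\<alpha> z)) (\<lambda>z. of_real (\<alpha>1 z)) (\<lambda>z. of_real (\<alpha>2 z))"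
    using sob_add[OF \<psi> eta] by (simp add: \<alpha>_def \<alpha>1_def \<alpha>2_def algebra_simps)
  \<comment> \<open>The ring is not simply connected and \<open>f\<close> may wind around 0, so a
    global logarithm of \<open>f\<close> is avoided. In the Jacobian of \<open>\<alpha> / f\<close>
    and \<open>f\<close>, the derivative of 1 / f is a multiple of that of \<open>f\<close> and
    cancels, which leaves the differential of \<open>\<alpha>\<close> paired with df / f.\<close>
  note a = sob_mult[OF \<alpha> inv]
  have zero: "\<alpha> z = 0 \<and> \<alpha>1 z = 0 \<and> \<alpha>2 z = 0" if "z \<in> S" "supn z < 2 * r \<or> \<rho> / 2 < supn z" for z
    using that(2)
  proof
    assume z: "supn z < 2 * r"
    then have "z \<noteq> 0" using that r by (auto simp: S_def)
    then have "t z \<le> 0" using lo[of z] z mM by (simp add: t_def divide_nonpos_pos)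
    moreover have "supn z \<le> 1" using z r by simp
    ultimately show ?thesis using cut_props(1)[of 1 2 z] by (simp add: \<alpha>_def \<alpha>1_def \<alpha>2_def \<psi>_def \<psi>'_def)
  next
    assume z: "\<rho> / 2 < supn z"
    then have "t z \<ge> 1" using hi[of z] mM by (simp add: t_def)
    moreover have "supn z \<ge> 2" using z \<rho> by simp
    ultimately show ?thesis using cut_props(2)[of 1 2 z] mM by (simp add: \<alpha>_def \<alpha>1_def \<alpha>2_def \<psi>_def \<psi>'_def tot_def)
  qed
  let ?c1 = "\<lambda>z. (-1) * complex_of_real (cut r (2 * r) z) + 1" and ?c2 = "\<lambda>z. complex_of_real (cut (\<rho> / 2) \<rho> z)"
  \<comment> \<open>A C1 cut-off equal to 1 wherever \<open>\<alpha>\<close> is nonzero, so the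
    integrand of \<open>sob_null_lagrangian\<close> is unaffected by it.\<close>
  define \<phi> \<phi>1 \<phi>2 where "\<phi> z = ?c1 z * ?c2 z" and "\<phi>1 z = (-1) * complex_of_real (cutx r (2 * r) z) * ?c2 z + ?c1 z * complex_of_real (cutx (\<rho> / 2) \<rho> z)"
    and "\<phi>2 z = (-1) * complex_of_real (cuty r (2 * r) z) * ?c2 z + ?c1 z * complex_of_real (cuty (\<rho> / 2) \<rho> z)" for z
  have \<phi>: "C1on UNIV \<phi> \<phi>1 \<phi>2"
    unfolding \<phi>_def[abs_def] \<phi>1_def[abs_def] \<phi>2_def[abs_def] by (intro C1on_mult C1on_affine C1on_cut)
  define L where "L = csq \<rho> \<inter> {z. r \<le> supn z}"
  have L: "compact L" "L \<subseteq> S"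
    unfolding L_def by (intro compact_Int_closed compact_csq closed_Collect_le continuous_intros) (use r \<rho> in \<open>auto simp: S_def csq_def sq_def\<close>)
  have \<phi>0: "\<phi> z = 0 \<and> \<phi>1 z = 0 \<and> \<phi>2 z = 0" if "z \<notin> L" for z
  proof -
    have "supn z \<le> r \<or> supn z \<ge> \<rho>" using that by (auto simp: L_def csq_def not_le)
    then consider "supn z \<le> r" | "supn z \<ge> \<rho>" by blast
    then show ?thesis
    proof cases
      case 1
      then show ?thesis using cut_props(1)[of r "2 * r" z] cut_props(1)[of "\<rho> / 2" \<rho> z] r \<rho> by (simp add: \<phi>_def \<phi>1_def \<phi>2_def)
    next
      case 2
      then show ?thesis using cut_props(2)[of "\<rho> / 2" \<rho> z] r \<rho> by (simp add: \<phi>_def \<phi>1_def \<phi>2_def)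
    qed
  qed
  have mid: "\<phi> z = 1 \<and> \<phi>1 z = 0 \<and> \<phi>2 z = 0" if "2 * r \<le> supn z" "supn z \<le> \<rho> / 2" for z
    using cut_props(2)[of r "2 * r" z] cut_props(1)[of "\<rho> / 2" \<rho> z] that r \<rho> by (simp add: \<phi>_def \<phi>1_def \<phi>2_def)
  define J where "J z = Re (p z / f z) * Im (q z / f z) - Im (p z / f z) * Re (q z / f z)" for z
  define k where "k z = cutx 1 2 z * Im (q z / f z) - cuty 1 2 z * Im (p z / f z)" for z
  have N: "(LINT z|lborel_on S. of_real (\<alpha>1 z) * (q z / f z) - of_real (\<alpha>2 z) * (p z / f z)) = 0"
  proof (rule trans[OF integral_lborel_on_cong sob_null_lagrangian[OF S L \<phi> \<phi>0 a fS]])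
    fix z assume z: "z \<in> S"
    show "of_real (\<alpha>1 z) * (q z / f z) - of_real (\<alpha>2 z) * (p z / f z) =
      (\<phi> z * (of_real (\<alpha>1 z) * inverse (f z) + of_real (\<alpha> z) * (- inverse ((f z)\<^sup>2) * p z)) + \<phi>1 z * (of_real (\<alpha> z) * inverse (f z))) * q z
     - (\<phi> z * (of_real (\<alpha>2 z) * inverse (f z) + of_real (\<alpha> z) * (- inverse ((f z)\<^sup>2) * q z)) + \<phi>2 z * (of_real (\<alpha> z) * inverse (f z))) * p z"
    proof (cases "supn z < 2 * r \<or> \<rho> / 2 < supn z")
      case True
      then show ?thesis using zero[OF z] by simp
    next
      case False
      then show ?thesis using mid[of z] f0[OF z] by (simp add: field_simps power2_eq_square)
    qed
  qed
  have [measurable]: "p \<in> borel_measurable (lborel_on S)" "q \<in> borel_measurable (lborel_on S)"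
    using fS by (auto simp: sob_def)
  have [measurable]: "f \<in> borel_measurable (lborel_on S)"
    using sob_continuous[OF fS] by (rule continuous_on_measurable_lborel_on)
  have "(\<lambda>z. complex_of_real (cutx 1 2 z)) \<in> borel_measurable (lborel_on S)"
    "(\<lambda>z. complex_of_real (cuty 1 2 z)) \<in> borel_measurable (lborel_on S)"
    using C1on_cut[of S 1 2] by (auto simp: C1on_def intro!: continuous_on_measurable_lborel_on)
  from this[THEN measurable_compose[OF _ borel_measurable_Re]]
  have [measurable]: "cutx 1 2 \<in> borel_measurable (lborel_on S)" "cuty 1 2 \<in> borel_measurable (lborel_on S)"
    by simp_all
  have "continuous_on S (\<lambda>z. complex_of_real (\<psi>' z))"
    unfolding \<psi>'_def t_def using mM f0 by (intro continuous_intros sob_continuous[OF fS]) auto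
  from measurable_compose[OF continuous_on_measurable_lborel_on[OF this] borel_measurable_Re]
  have [measurable]: "\<psi>' \<in> borel_measurable (lborel_on S)" by simp
  obtain c where c: "c > 0" "\<And>z. z \<in> S \<Longrightarrow> c \<le> norm (f z)"
  proof (cases "C = {}")
    case True then show thesis using that[of 1] SC by auto
  next
    case False
    obtain y where "y \<in> C" "\<And>x. x \<in> C \<Longrightarrow> norm y \<le> norm x"
      using continuous_attains_inf[OF C False, of norm] by (auto intro: continuous_intros)
    then show thesis using that[of "norm y"] C0 SC by (metis zero_less_norm_iff)
  qed
  define E where "E z = (norm (p z / f z))\<^sup>2 + (norm (q z / f z))\<^sup>2" for z
  have iE: "integrable (lborel_on S) E"
  proof (rule Bochner_Integration.integrable_bound)
    show "integrable (lborel_on S) (\<lambda>z. ((norm (p z))\<^sup>2 + (norm (q z))\<^sup>2) / c\<^sup>2)"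
      using sob_square_integrable[OF fS] by simp
    have "norm (E z) \<le> norm (((norm (p z))\<^sup>2 + (norm (q z))\<^sup>2) / c\<^sup>2)" if "z \<in> S" for z
    proof -
      have "E z = ((norm (p z))\<^sup>2 + (norm (q z))\<^sup>2) / (norm (f z))\<^sup>2"
        by (simp add: E_def norm_divide power_divide add_divide_distrib)
      also have "\<dots> \<le> ((norm (p z))\<^sup>2 + (norm (q z))\<^sup>2) / c\<^sup>2"
        using c that by (intro divide_left_mono power_mono) (auto intro!: mult_pos_pos f0)
      finally show ?thesis by (simp add: E_def)
    qed
    then show "AE z in lborel_on S. norm (E z) \<le> norm (((norm (p z))\<^sup>2 + (norm (q z))\<^sup>2) / c\<^sup>2)"
      by (intro eventually_mono[OF AE_in_lborel_on]) auto
  qed (simp add: E_def[abs_def])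
  have i1: "integrable (lborel_on S) (\<lambda>z. B * (E z + 1))" for B
    using iE finite_measure.integrable_const[OF finite_measure_lborel_on[OF S], of "1::real"] by auto
  have Es: "E z = (Re (p z / f z))\<^sup>2 + (Im (p z / f z))\<^sup>2 + (Re (q z / f z))\<^sup>2 + (Im (q z / f z))\<^sup>2" for z
    unfolding E_def cmod_power2 by simp
  have Enn: "0 \<le> E z" for z by (simp add: E_def)
  have JE: "\<bar>J z\<bar> \<le> E z" for z
  proof -
    have "\<bar>a * d - b * e\<bar> \<le> a\<^sup>2 + b\<^sup>2 + e\<^sup>2 + d\<^sup>2" for a b d e :: real
      unfolding abs_le_iff
      using zero_le_power2[of "a - d"] zero_le_power2[of "b - e"] zero_le_power2[of "a + d"] zero_le_power2[of "b + e"]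
        zero_le_power2[of a] zero_le_power2[of b] zero_le_power2[of d] zero_le_power2[of e]
      unfolding power2_sum power2_diff by linarith
    then show ?thesis unfolding J_def Es .
  qed
  have \<psi>'0: "\<psi>' z \<ge> 0" for z by (simp add: \<psi>'_def)
  have \<psi>'B: "\<psi>' z \<le> (2 / (M - m))\<^sup>2" for z
    unfolding \<psi>'_def using smoothstep'_bounds mM by (intro power_mono divide_right_mono divide_nonneg_pos) auto
  have iJ: "integrable (lborel_on S) (\<lambda>z. \<psi>' z * J z)"
  proof (rule Bochner_Integration.integrable_bound[OF i1[of "(2 / (M - m))\<^sup>2"]])
    have "norm (\<psi>' z * J z) \<le> norm ((2 / (M - m))\<^sup>2 * (E z + 1))" for z
    proof -
      have "\<bar>\<psi>' z\<bar> * \<bar>J z\<bar> \<le> (2 / (M - m))\<^sup>2 * (E z + 1)"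
        by (rule mult_mono) (use \<psi>'0[of z] \<psi>'B[of z] JE[of z] in auto)
      then show ?thesis using Enn[of z] by (simp add: abs_mult)
    qed
    then show "AE z in lborel_on S. norm (\<psi>' z * J z) \<le> norm ((2 / (M - m))\<^sup>2 * (E z + 1))" by simp
  qed (unfold J_def[abs_def], measurable)
  have ik: "integrable (lborel_on S) k"
  proof (rule Bochner_Integration.integrable_bound[OF i1[of 3]])
    have "norm (k z) \<le> norm (3 * (E z + 1))" for z
    proof -
      have h: "\<bar>x\<bar> \<le> x\<^sup>2 + 1/4" for x :: real
        using zero_le_power2[of "\<bar>x\<bar> - 1/2"] by (simp add: power2_eq_square algebra_simps)
      have "\<bar>k z\<bar> \<le> \<bar>cutx 1 2 z\<bar> * \<bar>Im (q z / f z)\<bar> + \<bar>cuty 1 2 z\<bar> * \<bar>Im (p z / f z)\<bar>"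
        unfolding k_def abs_mult[symmetric] by (rule abs_triangle_ineq4)
      also have "\<dots> \<le> 3 * \<bar>Im (q z / f z)\<bar> + 3 * \<bar>Im (p z / f z)\<bar>"
        by (intro add_mono mult_right_mono cb) auto
      also have "\<dots> \<le> 3 * (E z + 1)"
      proof -
        have "3 * \<bar>a\<bar> + 3 * \<bar>b\<bar> \<le> 3 * (x\<^sup>2 + b\<^sup>2 + y\<^sup>2 + a\<^sup>2 + 1)" for a b x y :: real
          using h[of a] h[of b] zero_le_power2[of x] zero_le_power2[of y] unfolding distrib_left by linarith
        then show ?thesis unfolding Es .
      qed
      finally show ?thesis using Enn[of z] by simp
    qed
    then show "AE z in lborel_on S. norm (k z) \<le> norm (3 * (E z + 1))" by simp
  qed (unfold k_def[abs_def], measurable)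
  \<comment> \<open>The imaginary part of df / f is d(arg f). As \<open>\<psi>\<close> is a function
    of ln |f|, its part contributes \<open>\<psi>'\<close> times the Jacobian \<open>J\<close> of
    log f, and the correction contributes the flux density \<open>k\<close>.\<close>
  have eq: "Im (of_real (\<alpha>1 z) * (q z / f z) - of_real (\<alpha>2 z) * (p z / f z)) = \<psi>' z * J z + tot * k z" for z
  proof -
    have "Im (of_real (\<alpha>1 z) * (q z / f z) - of_real (\<alpha>2 z) * (p z / f z)) = \<alpha>1 z * Im (q z / f z) - \<alpha>2 z * Im (p z / f z)"
      by (simp only: minus_complex.sel times_complex.sel Re_complex_of_real Im_complex_of_real mult_zero_left add_0_right)
    then show ?thesis unfolding \<alpha>1_def \<alpha>2_def J_def k_def by (simp only:) (simp add: algebra_simps)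
  qed
  have iN: "integrable (lborel_on S) (\<lambda>z. of_real (\<alpha>1 z) * (q z / f z) - of_real (\<alpha>2 z) * (p z / f z))"
  proof (rule Bochner_Integration.integrable_bound[OF i1[of "2 * ((2 / (M - m))\<^sup>2 + 3 * \<bar>tot\<bar>)"]])
    define D where "D = (2 / (M - m))\<^sup>2 + 3 * \<bar>tot\<bar>"
    have "norm (of_real (\<alpha>1 z) * (q z / f z) - of_real (\<alpha>2 z) * (p z / f z)) \<le> 2 * D * (E z + 1)" for z
    proof -
      have D: "0 \<le> D" by (simp add: D_def)
      have b: "\<bar>\<psi>' z * x + tot * y\<bar> \<le> D * (n + 1)" if "\<bar>x\<bar> \<le> n" "\<bar>y\<bar> \<le> 3" for x y n
      proof -
        have "\<bar>\<psi>' z * x + tot * y\<bar> \<le> \<psi>' z * \<bar>x\<bar> + \<bar>tot\<bar> * \<bar>y\<bar>"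
          using abs_triangle_ineq[of "\<psi>' z * x" "tot * y"] \<psi>'0[of z] by (simp add: abs_mult)
        also have "\<dots> \<le> D * n + D * 1"
        proof (rule add_mono)
          show "\<psi>' z * \<bar>x\<bar> \<le> D * n" by (rule mult_mono) (use \<psi>'B[of z] that D in \<open>auto simp: D_def\<close>)
          have "\<bar>tot\<bar> * \<bar>y\<bar> \<le> \<bar>tot\<bar> * 3" by (rule mult_left_mono) (use that in auto)
          then show "\<bar>tot\<bar> * \<bar>y\<bar> \<le> D * 1" by (simp add: D_def add_increasing)
        qed
        finally show ?thesis by (simp add: algebra_simps)
      qed
      define np nq where "np = norm (p z / f z)" and "nq = norm (q z / f z)"
      have 1: "\<bar>\<alpha>1 z\<bar> \<le> D * (np + 1)" "\<bar>\<alpha>2 z\<bar> \<le> D * (nq + 1)"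
        unfolding \<alpha>1_def \<alpha>2_def np_def nq_def by (intro b abs_Re_le_cmod cb)+
      have "norm (of_real (\<alpha>1 z) * (q z / f z) - of_real (\<alpha>2 z) * (p z / f z)) \<le> \<bar>\<alpha>1 z\<bar> * nq + \<bar>\<alpha>2 z\<bar> * np"
        by (rule order_trans[OF norm_triangle_ineq4]) (simp only: norm_mult norm_of_real np_def nq_def order_refl)
      also have "\<dots> \<le> D * (np + 1) * nq + D * (nq + 1) * np"
        by (intro add_mono mult_right_mono 1) (auto simp: np_def nq_def)
      also have "\<dots> = D * (2 * np * nq + np + nq)" by (simp add: algebra_simps)
      also have "\<dots> \<le> D * (2 * (E z + 1))"
      proof (rule mult_left_mono[OF _ D])
        show "2 * np * nq + np + nq \<le> 2 * (E z + 1)"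
          using sum_squares_bound[of np nq] zero_le_power2[of "np - 1/2"] zero_le_power2[of "nq - 1/2"]
          unfolding E_def np_def[symmetric] nq_def[symmetric] by (simp add: power2_diff power_divide)
      qed
      finally show ?thesis by (simp only: mult_ac)
    qed
    moreover have "0 \<le> 2 * D * (E z + 1)" for z by (simp add: D_def E_def)
    ultimately show "AE z in lborel_on S. norm (of_real (\<alpha>1 z) * (q z / f z) - of_real (\<alpha>2 z) * (p z / f z)) \<le> norm (2 * ((2 / (M - m))\<^sup>2 + 3 * \<bar>tot\<bar>) * (E z + 1))"
      by (simp add: D_def)
  qed (unfold \<alpha>1_def[abs_def] \<alpha>2_def[abs_def], measurable)
  have "(LINT z|lborel_on S. \<psi>' z * J z + tot * k z) = 0"
    using integral_Im[OF iN] N by (simp only: eq) simp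
  then have sum0: "(LINT z|lborel_on S. \<psi>' z * J z) + tot * (LINT z|lborel_on S. k z) = 0"
    using iJ ik by simp
  have kS: "(LINT z|lborel_on S. k z) = \<kappa>"
  proof -
    \<comment> \<open>The gradient of \<open>cut 1 2\<close> lives between half-sides 1 and 2, a
      region inside \<open>S\<close> for all admissible \<open>r\<close> and \<open>\<rho>\<close>;
      the flux can therefore be integrated over the whole plane.\<close>
    have kz: "indicator S z *\<^sub>R k z = k z" for z
    proof (cases "z \<in> S")
      case False
      then have "supn z \<le> 1 \<or> 2 \<le> supn z" using r \<rho> by (auto simp: S_def sq_def)
      then have "k z = 0" using cut_props(1,2)[of 1 2 z] by (auto simp: k_def)
      then show ?thesis by simp
    qed simp
    have "(LINT z|lborel_on S. k z) = (LINT z|lborel. indicator S z *\<^sub>R k z)"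
      by (rule integral_restrict_space) (use S in auto)
    then show ?thesis unfolding kz by (simp only: \<kappa>_def k_def)
  qed
  have "(LINT z|lborel_on S. (norm (v1 z))\<^sup>2 + (norm (v2 z))\<^sup>2) \<le> (LINT z|lborel_on S. K * (\<psi>' z * J z))"
  proof (rule integral_mono_AE[OF iv])
    show "AE z in lborel_on S. (norm (v1 z))\<^sup>2 + (norm (v2 z))\<^sup>2 \<le> K * (\<psi>' z * J z)"
      using distortion_mult[OF dS, of "\<lambda>z. inverse (f z)"] unfolding distortion_def
    proof eventually_elim
      case (elim z)
      have "Im (cnj (inverse (f z) * p z) * (inverse (f z) * q z)) = J z"
        unfolding J_def divide_inverse times_complex.sel cnj.sel by (simp add: algebra_simps)
      then have EK: "E z \<le> K * J z" using elim by (simp add: E_def divide_inverse mult.commute)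
      have "(norm (v1 z))\<^sup>2 + (norm (v2 z))\<^sup>2 = \<psi>' z * ((Re (p z / f z))\<^sup>2 + (Re (q z / f z))\<^sup>2)"
        unfolding v1_def v2_def \<psi>'_def norm_of_real power2_abs by (simp only: power_mult_distrib distrib_left)
      also have "\<dots> \<le> \<psi>' z * E z" by (rule mult_left_mono[OF _ \<psi>'0]) (simp only: Es, simp)
      also have "\<dots> \<le> \<psi>' z * (K * J z)" by (rule mult_left_mono[OF EK \<psi>'0])
      finally show ?case by (simp only: mult.left_commute)
    qed
  qed (use iJ in simp)
  also have "\<dots> = - K * tot * \<kappa>"
  proof -
    have "(LINT z|lborel_on S. \<psi>' z * J z) = - tot * \<kappa>" using sum0 kS by simp
    then show ?thesis by simp
  qed
  also have "\<dots> \<le> K * tot * \<bar>\<kappa>\<bar>"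
  proof -
    have "K * tot \<ge> 0" using K mM by (simp add: tot_def)
    then have "(K * tot) * (- \<kappa>) \<le> (K * tot) * \<bar>\<kappa>\<bar>" by (intro mult_left_mono) auto
    then show ?thesis by simp
  qed
  also have "\<dots> = (6/5) * (K * \<bar>\<kappa>\<bar> / (M - m))" by (simp add: tot_def)
  also have "\<dots> \<le> 2 * (K * \<bar>\<kappa>\<bar> / (M - m))" using K mM by (intro mult_right_mono) auto
  finally show "(LINT z|lborel_on S. (norm (v1 z))\<^sup>2 + (norm (v2 z))\<^sup>2) \<le> 2 * K * \<bar>\<kappa>\<bar> / (M - m)" by simp
qed

text \<open>Suppose \<open>norm (f z1) < norm (f z2)\<close>. The preimage \<open>E0\<close> of the
  disc of radius \<open>norm (f z1)\<close> is connected and joins \<open>z1\<close> to 0; the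
  preimage \<open>E1\<close> of the exterior of radius \<open>norm (f z2)\<close> is connected and
  joins \<open>z2\<close> to points far away. Every square boundary around \<open>z1\<close> of
  half-side between \<open>d / 2\<close> and \<open>3/4 * d\<close> meets both, so a transition
  function of ln |f| oscillates by 1 on it. Length-area bounds its energy from below, while
  \<open>ring_energy\<close> bounds it from above by a multiple of
  \<open>1 / (M - m)\<close>.\<close>

lemma homeomorphism_harnack:
  assumes K: "K > 0" and f: "homeomorphism UNIV UNIV f g" "f 0 = 0"
    and sob: "\<And>R. R > 0 \<Longrightarrow> sob (sq R) f p q" and dist: "\<And>R. R > 0 \<Longrightarrow> distortion K (sq R) p q"
  shows "\<exists>C\<ge>1. \<forall>z1 z2. supn (z2 - z1) \<le> supn z1 / 2 \<longrightarrow> norm (f z2) \<le> C * norm (f z1)"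
proof -
  define \<kappa> where "\<kappa> = (LINT z|lborel. cutx 1 2 z * Im (q z / f z) - cuty 1 2 z * Im (p z / f z))"
  \<comment> \<open>Length-area gives 1/4 \<le> 384 I and the ring estimate I \<le> 2 K |\<kappa>| /
    (M - m); hence M - m \<le> 3072 K |\<kappa>|, rounded up here.\<close>
  define c where "c = 4000 * K * \<bar>\<kappa>\<bar>"
  have fc: "continuous_on UNIV f" and gc: "continuous_on UNIV g" and gf: "\<And>z. g (f z) = z" and fg: "\<And>w. f (g w) = w"
    using f(1) by (auto simp: homeomorphism_def)
  have f0: "f z \<noteq> 0" if "z \<noteq> 0" for z using that gf f(2) by metis
  have main: "ln (norm (f z2)) - ln (norm (f z1)) \<le> c"
    if z: "supn (z2 - z1) \<le> supn z1 / 2" "z1 \<noteq> 0" and lt: "norm (f z1) < norm (f z2)" for z1 z2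
  proof -
    define m M d where "m = ln (norm (f z1))" and "M = ln (norm (f z2))" and "d = supn z1"
    have d: "d > 0" using z(2) supn_bounds(3)[of z1] supn_eq_0(1)[of z1] by (auto simp: d_def less_le)
    have e: "exp m = norm (f z1)" "exp M = norm (f z2)" using lt f0[OF z(2)] by (auto simp: m_def M_def)
    have mM: "m < M" using lt e by (metis exp_less_cancel_iff)
    have "isCont f 0" using fc by (simp add: continuous_on_eq_continuous_at)
    then obtain r0 where r0: "r0 > 0" "\<And>z. norm z < r0 \<Longrightarrow> norm (f z) < exp m"
      using f(2) exp_gt_zero[of m] unfolding continuous_at_eps_delta by (metis dist_0_norm dist_commute)
    \<comment> \<open>Small enough for continuity at 0 to give \<open>norm (f z) < exp m\<close> on
      the inner square. Being at most \<open>d / 4\<close>, it also lets \<open>S\<close> contain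
      the ring around \<open>z1\<close>, whose points have
      \<open>supn z \<ge> d / 4\<close>.\<close>
    define r where "r = min (r0 / 8) (min (1/4) (d / 4))"
    have r: "0 < r" "r \<le> 1/4" "r \<le> r0 / 8" "r \<le> d / 4" using r0 d by (auto simp: r_def)
    have lo: "ln (norm (f z)) \<le> m" if "supn z \<le> 2 * r" "z \<noteq> 0" for z
    proof -
      have "norm z < r0" using that r r0 supn_bounds(2)[of z] by linarith
      then have "ln (norm (f z)) \<le> ln (exp m)" using r0(2)[of z] f0[OF that(2)] by (subst ln_le_cancel_iff) auto
      then show ?thesis by simp
    qed
    have "compact (g ` cball 0 (exp M))" by (intro compact_continuous_image continuous_on_subset[OF gc]) auto
    then obtain B where B: "\<And>w. norm w \<le> exp M \<Longrightarrow> norm (g w) \<le> B"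
      using compact_imp_bounded by (force simp: bounded_iff)
    \<comment> \<open>\<open>B\<close> bounds the preimage of the disc of radius
      \<open>exp M\<close>, so \<open>f\<close> has left that disc from half-side
      \<open>\<rho> / 2\<close> on. The term \<open>4 * d\<close> puts the ring around
      \<open>z1\<close> inside \<open>S\<close> and the point \<open>\<rho>\<close> beyond that
      ring.\<close>
    define \<rho> where "\<rho> = max 4 (2 * (\<bar>B\<bar> + 1) + 4 * d)"
    have \<rho>: "\<rho> \<ge> 4" "\<rho> \<ge> 2 * (\<bar>B\<bar> + 1)" "\<rho> \<ge> 4 * d" using d by (auto simp: \<rho>_def)
    have big: "exp M < norm (f z)" if "\<rho> / 2 \<le> supn z" for z
    proof (rule ccontr)
      assume "\<not> ?thesis"
      then have "norm z \<le> B" using B[of "f z"] gf by simp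
      then show False using that supn_bounds(1)[of z] \<rho> abs_ge_self[of B] by argo
    qed
    have hi: "M \<le> ln (norm (f z))" if "\<rho> / 2 \<le> supn z" for z
    proof -
      have "ln (exp M) \<le> ln (norm (f z))" using big[OF that] by (intro ln_mono) (auto intro: less_trans[OF exp_gt_zero])
      then show ?thesis by simp
    qed
    define S where "S = {z. r / 2 < supn z} \<inter> sq (2 * \<rho>)"
    have S: "open S" unfolding S_def by (intro open_Int open_Collect_less continuous_intros open_sq)
    define v where "v z = smoothstep ((ln (norm (f z)) - m) / (M - m))" for z
    define v1 v2 where "v1 z = complex_of_real (smoothstep' ((ln (norm (f z)) - m) / (M - m)) / (M - m) * Re (p z / f z))"
      and "v2 z = complex_of_real (smoothstep' ((ln (norm (f z)) - m) / (M - m)) / (M - m) * Re (q z / f z))" for z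
    have E: "sob S (\<lambda>z. of_real (v z)) v1 v2" "integrable (lborel_on S) (\<lambda>z. (norm (v1 z))\<^sup>2 + (norm (v2 z))\<^sup>2)"
      "(LINT z|lborel_on S. (norm (v1 z))\<^sup>2 + (norm (v2 z))\<^sup>2) \<le> 2 * K * \<bar>\<kappa>\<bar> / (M - m)"
      using ring_energy[OF K f0 fc sob dist mM r(1,2) \<rho>(1) lo hi]
      unfolding S_def v_def v1_def[abs_def] v2_def[abs_def] \<kappa>_def by blast+
    define E0 E1 where "E0 = g ` cball 0 (exp m)" and "E1 = g ` (- ball 0 (exp M))"
    have E0: "connected E0" "0 \<in> E0" "z1 \<in> E0"
    proof -
      show "connected E0" unfolding E0_def by (intro connected_continuous_image continuous_on_subset[OF gc] convex_connected convex_cball) auto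
      show "0 \<in> E0" unfolding E0_def using gf[of 0] f(2) by (intro image_eqI[of _ _ 0]) auto
      show "z1 \<in> E0" unfolding E0_def by (intro image_eqI[of _ _ "f z1"]) (auto simp: gf e)
    qed
    have E1: "connected E1" "z2 \<in> E1" "of_real \<rho> \<in> E1"
    proof -
      have "connected (- ball (0::complex) (exp M))"
        by (rule connected_complement_bounded_convex) auto
      then show "connected E1" unfolding E1_def by (intro connected_continuous_image continuous_on_subset[OF gc]) auto
      show "z2 \<in> E1" unfolding E1_def by (intro image_eqI[of _ _ "f z2"]) (auto simp: gf e)
      have "exp M < norm (f (of_real \<rho>))" by (rule big) (use \<rho> in \<open>simp add: supn_def\<close>)
      then show "of_real \<rho> \<in> E1" unfolding E1_def by (intro image_eqI[of _ _ "f (of_real \<rho>)"]) (auto simp: gf)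
    qed
    have v0: "v z = 0" if "z \<in> E0" "z \<noteq> 0" for z
    proof -
      have "norm (f z) \<le> exp m" using that by (auto simp: E0_def fg)
      then have "ln (norm (f z)) \<le> ln (exp m)" using f0[OF that(2)] by (subst ln_le_cancel_iff) auto
      then have "ln (norm (f z)) \<le> m" by simp
      then show ?thesis using mM by (simp add: v_def divide_nonpos_pos)
    qed
    have v1': "v z = 1" if "z \<in> E1" for z
    proof -
      have "exp M \<le> norm (f z)" using that by (auto simp: E1_def fg)
      then have "ln (exp M) \<le> ln (norm (f z))" by (intro ln_mono) (auto intro: less_le_trans[OF exp_gt_zero])
      then have "M \<le> ln (norm (f z))" by simp
      then show ?thesis using mM by (simp add: v_def)
    qed
    have LA: "1\<^sup>2 * (3/4 * d - d/2) \<le> 512 * (3/4 * d) * (LINT z|lborel_on S. indicator (sq_annulus z1 (d/2) (3/4 * d)) z * ((norm (v1 z))\<^sup>2 + (norm (v2 z))\<^sup>2))"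
    proof (rule length_area[OF S E(1)])
      show "sq_annulus z1 (d/2) (3/4 * d) \<subseteq> S"
      proof
        fix z assume "z \<in> sq_annulus z1 (d/2) (3/4 * d)"
        then have zz: "supn (z - z1) \<le> 3/4 * d" by (simp add: sq_annulus_def)
        have "d \<le> supn (z1 - z) + supn z" using supn_triangle[of "z1 - z" z] by (simp add: d_def)
        then have "d / 4 \<le> supn z" using zz by (simp add: supn_minus(1))
        moreover have "supn z \<le> supn (z - z1) + d" using supn_triangle[of "z - z1" z1] by (simp add: d_def)
        ultimately show "z \<in> S" using zz r d \<rho> by (auto simp: S_def sq_def)
      qed
      fix s assume s: "d / 2 < s" "s < 3/4 * d"
      obtain x where x: "x \<in> E0" "supn (x - z1) = s"
        using sphere_meets_connected[OF E0(1) E0(3) E0(2), of z1 s] s d by (auto simp: d_def supn_minus)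
      have "\<rho> \<le> supn (of_real \<rho> - z1) + d"
      proof -
        have "supn (of_real \<rho>) = \<rho>" using \<rho> by (simp add: supn_def)
        then show ?thesis using supn_triangle[of "of_real \<rho> - z1" z1] by (simp add: d_def)
      qed
      then obtain y where y: "y \<in> E1" "supn (y - z1) = s"
        using sphere_meets_connected[OF E1(1) E1(2) E1(3), of z1 s] s d z(1) \<rho> by (auto simp: d_def)
      have "x \<noteq> 0" using x(2) s d by (auto simp: d_def supn_minus)
      then have "1 \<le> norm (complex_of_real (v x) - of_real (v y))" using v0[OF x(1)] v1'[OF y(1)] by simp
      then show "\<exists>z z'. supn (z - z1) = s \<and> supn (z' - z1) = s \<and> 1 \<le> norm (complex_of_real (v z) - of_real (v z'))"
        using x y by blast
    qed (use d in auto)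
    define I where "I = (LINT z|lborel_on S. indicator (sq_annulus z1 (d/2) (3/4 * d)) z * ((norm (v1 z))\<^sup>2 + (norm (v2 z))\<^sup>2))"
    have "I \<le> 2 * K * \<bar>\<kappa>\<bar> / (M - m)"
      unfolding I_def
    proof (rule order_trans[OF integral_mono' E(3)])
      show "integrable (lborel_on S) (\<lambda>z. (norm (v1 z))\<^sup>2 + (norm (v2 z))\<^sup>2)" by (rule E(2))
    qed (auto simp: indicator_def)
    moreover have "d * (1/4) \<le> d * (384 * I)" using LA[folded I_def] by simp
    then have "1/4 \<le> 384 * I" using d by (rule mult_left_le_imp_le)
    ultimately have "1/4 \<le> 384 * (2 * K * \<bar>\<kappa>\<bar> / (M - m))" by linarith
    then have "M - m \<le> 4 * 768 * (K * \<bar>\<kappa>\<bar>)" using mM by (simp add: field_simps)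
    also have "\<dots> \<le> c" unfolding c_def using K by (simp add: mult_right_mono)
    finally show ?thesis by (simp add: m_def M_def)
  qed
  show ?thesis
  proof (intro exI[of _ "exp c"] conjI allI impI)
    show "1 \<le> exp c" using K by (simp add: c_def)
    fix z1 z2 assume z: "supn (z2 - z1) \<le> supn z1 / 2"
    show "norm (f z2) \<le> exp c * norm (f z1)"
    proof (cases "z1 = 0")
      case True
      then have "supn (z2 - z1) = 0" using z supn_bounds(3)[of z2] by simp
      then show ?thesis using True f(2) by simp
    next
      case False
      show ?thesis
      proof (cases "norm (f z1) < norm (f z2)")
        case True
        have p: "norm (f z1) > 0" "norm (f z2) > 0" using True f0[OF False] by auto
        have "norm (f z2) = exp (ln (norm (f z2)))" using p by simp
        also have "\<dots> \<le> exp (c + ln (norm (f z1)))" using main[OF z False True] by simp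
        also have "\<dots> = exp c * norm (f z1)" using p by (simp add: exp_add)
        finally show ?thesis .
      next
        case ge: False
        have "1 * norm (f z1) \<le> exp c * norm (f z1)" using K by (intro mult_right_mono) (auto simp: c_def)
        then show ?thesis using ge by linarith
      qed
    qed
  qed
qed

text \<open>One use of the assumed inequality passes from a point w to 3/2 w, and four uses cover
  the factor 4, because (3/2)^4 > 4.\<close>

lemma homeomorphism_growth:
  assumes f: "continuous_on UNIV f" and C: "C \<ge> 1" "\<And>z1 z2. supn (z2 - z1) \<le> supn z1 / 2 \<Longrightarrow> norm (f z2) \<le> C * norm (f z1)"
  shows "\<exists>D>0. \<forall>n z. z \<in> csq (4 ^ n) \<longrightarrow> norm (f z) \<le> D * (C ^ 4) ^ n"
proof -
  have "compact (f ` csq 1)" by (intro compact_continuous_image continuous_on_subset[OF f]) auto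
  then obtain D0 where D0: "\<And>z. z \<in> csq 1 \<Longrightarrow> norm (f z) \<le> D0"
    using compact_imp_bounded by (force simp: bounded_iff)
  have shrink: "norm (f z) \<le> C ^ j * norm (f ((2/3) ^ j *\<^sub>R z))" for z j
  proof (induction j)
    case (Suc j)
    let ?w = "(2/3) ^ Suc j *\<^sub>R z"
    have "(2/3) ^ j *\<^sub>R z - ?w = (1/2) *\<^sub>R ?w" by (simp add: scaleR_left_diff_distrib[symmetric])
    then have "supn ((2/3) ^ j *\<^sub>R z - ?w) \<le> supn ?w / 2" by (simp only: supn_scaleR)
    from C(2)[OF this] have "C ^ j * norm (f ((2/3) ^ j *\<^sub>R z)) \<le> C ^ j * (C * norm (f ?w))"
      using C(1) by (intro mult_left_mono) auto
    with Suc show ?case by (simp add: mult.assoc mult.left_commute)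
  qed simp
  show ?thesis
  proof (intro exI[of _ "\<bar>D0\<bar> + 1"] conjI allI impI)
    fix n z assume z: "z \<in> csq (4 ^ n)"
    have "supn ((2/3) ^ (4 * n) *\<^sub>R z) \<le> ((2/3) ^ 4) ^ n * 4 ^ n"
      unfolding supn_scaleR power_mult[symmetric] using z by (intro mult_mono) (auto simp: csq_def supn_bounds)
    also have "\<dots> = ((2/3) ^ 4 * 4) ^ n" by (simp only: power_mult_distrib)
    also have "\<dots> \<le> 1" by (rule power_le_one) (auto simp: power4_eq_xxxx)
    finally have "norm (f ((2/3) ^ (4 * n) *\<^sub>R z)) \<le> \<bar>D0\<bar> + 1" using D0[of "(2/3) ^ (4 * n) *\<^sub>R z"] by (force simp: csq_def)
    then have "C ^ (4 * n) * norm (f ((2/3) ^ (4 * n) *\<^sub>R z)) \<le> C ^ (4 * n) * (\<bar>D0\<bar> + 1)"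
      using C(1) by (intro mult_left_mono) auto
    then show "norm (f z) \<le> (\<bar>D0\<bar> + 1) * (C ^ 4) ^ n"
      using shrink[of z "4 * n"] by (simp add: power_mult[symmetric] mult.commute)
  qed simp
qed

section \<open>Mollifiers and convolutions\<close>

text \<open>The index \<open>j\<close> closes the family under differentiation: starting from exp
  (-1/t), a derivative is always a linear combination of the members with indices
  \<open>j + 1\<close> and \<open>j + 2\<close>.\<close>

definition bexp :: "nat \<Rightarrow> real \<Rightarrow> real" where
  "bexp j t = (if t \<le> 0 then 0 else exp (- inverse t) * inverse t ^ j)"

lemma power_over_fact_le_exp:
  fixes x :: real assumes "x \<ge> 0" shows "x ^ n / fact n \<le> exp x"
proof -
  have "sum (\<lambda>n. x ^ n /\<^sub>R fact n) {n} \<le> (\<Sum>n. x ^ n /\<^sub>R fact n)"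
    by (rule sum_le_suminf[OF sums_summable[OF exp_converges]]) (use assms in auto)
  also have "\<dots> = exp x" using exp_converges[of x] by (simp add: sums_iff)
  finally show ?thesis by (simp add: divide_inverse mult.commute)
qed

text \<open>From x^n / n! \<le> exp x with x = 1/t and n = j + 2. Quadratic decay at 0 is what makes
  the extension by 0 differentiable there.\<close>

lemma bexp_bound: "\<bar>bexp j t\<bar> \<le> fact (j + 2) * t\<^sup>2"
proof (cases "t \<le> 0")
  case False
  define x where "x = inverse t"
  have x: "x > 0" "t = inverse x" using False by (auto simp: x_def)
  have "x ^ (j + 2) / fact (j + 2) \<le> exp x" using x by (intro power_over_fact_le_exp) auto
  then have "x ^ (j + 2) \<le> fact (j + 2) * exp x" by (simp add: divide_le_eq mult.commute)
  then have "x ^ (j + 2) * (exp (- x) * inverse x ^ 2) \<le> fact (j + 2) * exp x * (exp (- x) * inverse x ^ 2)"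
    using x by (intro mult_right_mono) auto
  moreover have "x ^ (j + 2) * (exp (- x) * inverse x ^ 2) = exp (- x) * x ^ j"
    using x by (simp add: power_add power2_eq_square field_simps)
  moreover have "fact (j + 2) * exp x * (exp (- x) * inverse x ^ 2) = fact (j + 2) * inverse x ^ 2"
    by (simp add: exp_minus)
  ultimately have "exp (- x) * x ^ j \<le> fact (j + 2) * t\<^sup>2" unfolding x(2) by (simp only:)
  moreover have "bexp j t = exp (- x) * x ^ j" using False by (simp add: bexp_def x_def)
  moreover have "0 \<le> exp (- x) * x ^ j" using x by simp
  ultimately show ?thesis by (simp only: abs_of_nonneg)
qed (simp add: bexp_def)

lemma DERIV_bexp: "(bexp j has_real_derivative bexp (j + 2) t - real j * bexp (j + 1) t) (at t)"
proof -
  consider "t > 0" | "t < 0" | "t = 0" by linarith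
  then show ?thesis
  proof cases
    case 1
    have "((\<lambda>t. exp (- inverse t) * inverse t ^ j) has_real_derivative
       exp (- inverse t) * (inverse t ^ 2) * inverse t ^ j - real j * (exp (- inverse t) * inverse t ^ (j + 1))) (at t)"
    proof -
      have D: "(inverse has_real_derivative - (inverse t ^ Suc (Suc 0))) (at t)" using 1 by (intro DERIV_inverse) auto
      have "((\<lambda>t. inverse t ^ j) has_real_derivative - (real j * inverse t ^ (j + 1))) (at t)"
        by (rule DERIV_cong[OF DERIV_power[OF D, of j]]) (cases j; simp add: mult_ac)
      moreover have "((\<lambda>t. exp (- inverse t)) has_real_derivative exp (- inverse t) * (inverse t ^ 2)) (at t)"
        using DERIV_fun_exp[OF DERIV_minus[OF D]] by (simp add: power2_eq_square)
      ultimately have "((\<lambda>t. exp (- inverse t) * inverse t ^ j) has_real_derivative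
          exp (- inverse t) * (inverse t ^ 2) * inverse t ^ j + - (real j * inverse t ^ (j + 1)) * exp (- inverse t)) (at t)"
        by (intro DERIV_mult)
      then show ?thesis by (rule DERIV_cong) (simp add: algebra_simps)
    qed
    then have "(bexp j has_real_derivative
       exp (- inverse t) * (inverse t ^ 2) * inverse t ^ j - real j * (exp (- inverse t) * inverse t ^ (j + 1))) (at t)"
      by (rule has_field_derivative_transform_within_open[where S = "{0<..}"]) (use 1 in \<open>auto simp: bexp_def\<close>)
    then show ?thesis using 1 by (simp add: bexp_def power_add power2_eq_square mult_ac)
  next
    case 2
    have "((\<lambda>t. 0) has_real_derivative 0) (at t)" by simp
    then have "(bexp j has_real_derivative 0) (at t)"
      by (rule has_field_derivative_transform_within_open[where S = "{..<0}"]) (use 2 in \<open>auto simp: bexp_def\<close>)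
    then show ?thesis using 2 by (simp add: bexp_def)
  next
    case 3
    define F :: real where "F = fact (j + 2)"
    have F: "F > 0" by (simp add: F_def)
    have "\<bar>bexp j y\<bar> \<le> e * \<bar>y\<bar>" if "\<bar>y\<bar> < e / F" "e > 0" for y e
    proof -
      have "\<bar>bexp j y\<bar> \<le> (F * \<bar>y\<bar>) * \<bar>y\<bar>" using bexp_bound[of j y] by (simp add: F_def power2_eq_square mult.assoc)
      also have "\<dots> \<le> e * \<bar>y\<bar>" using that F by (intro mult_right_mono) (auto simp: field_simps)
      finally show ?thesis .
    qed
    then have "\<forall>e>0. \<exists>d>0. \<forall>y. \<bar>y\<bar> < d \<longrightarrow> \<bar>bexp j y\<bar> \<le> e * \<bar>y\<bar>"
      using F by (metis divide_pos_pos)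
    then show ?thesis unfolding has_field_derivative_def has_derivative_at_alt 3
      by (simp add: bexp_def flip: lambda_zero)
  qed
qed

lemma continuous_on_bexp [continuous_intros]:
  "continuous_on S f \<Longrightarrow> continuous_on S (\<lambda>x. bexp j (f x))"
  by (rule continuous_on_compose2[of UNIV "bexp j"])
     (auto simp: continuous_on_eq_continuous_at intro: DERIV_isCont[OF DERIV_bexp])

text \<open>Closure under partial derivatives gives smoothness without computing higher derivatives.\<close>

inductive bump_alg :: "real \<Rightarrow> complex \<Rightarrow> (complex \<Rightarrow> real) \<Rightarrow> bool" for s c where
  const: "bump_alg s c (\<lambda>_. a)"
| Re: "bump_alg s c (\<lambda>z. Re (z - c))"
| Im: "bump_alg s c (\<lambda>z. Im (z - c))"
| bexp: "bump_alg s c (\<lambda>z. bexp j (1 - s * ((Re (z - c))\<^sup>2 + (Im (z - c))\<^sup>2)))"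
| add: "bump_alg s c \<phi> \<Longrightarrow> bump_alg s c \<psi> \<Longrightarrow> bump_alg s c (\<lambda>z. \<phi> z + \<psi> z)"
| mult: "bump_alg s c \<phi> \<Longrightarrow> bump_alg s c \<psi> \<Longrightarrow> bump_alg s c (\<lambda>z. \<phi> z * \<psi> z)"

lemma has_derivative_bexp_radial:
  "((\<lambda>z. bexp j (1 - s * ((Re (z - c))\<^sup>2 + (Im (z - c))\<^sup>2))) has_derivative
    (\<lambda>h. (bexp (j + 2) (1 - s * ((Re (z - c))\<^sup>2 + (Im (z - c))\<^sup>2)) - real j * bexp (j + 1) (1 - s * ((Re (z - c))\<^sup>2 + (Im (z - c))\<^sup>2)))
       * ((-2 * s) * (Re (z - c) * Re h + Im (z - c) * Im h)))) (at z)"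
proof -
  have "((\<lambda>z. 1 - s * ((Re (z - c))\<^sup>2 + (Im (z - c))\<^sup>2)) has_derivative (\<lambda>h. (-2 * s) * (Re (z - c) * Re h + Im (z - c) * Im h))) (at z)"
    by (auto intro!: derivative_eq_intros simp: fun_eq_iff algebra_simps)
  from has_derivative_compose[OF this DERIV_bexp[of j, unfolded has_field_derivative_def]] show ?thesis .
qed

lemma bump_alg_derivative:
  assumes "bump_alg s c \<phi>"
  shows "\<exists>D. (\<forall>z. (\<phi> has_derivative D z) (at z)) \<and> (\<forall>v. bump_alg s c (\<lambda>z. D z v))"
  using assms
proof induction
  case (const a)
  show ?case by (intro exI[of _ "\<lambda>_ _. 0"]) (auto intro: bump_alg.const)
next
  case Re
  show ?case by (intro exI[of _ "\<lambda>_ v. Re v"]) (auto intro!: bump_alg.const derivative_eq_intros)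
next
  case Im
  show ?case by (intro exI[of _ "\<lambda>_ v. Im v"]) (auto intro!: bump_alg.const derivative_eq_intros)
next
  case (bexp j)
  have "bump_alg s c (\<lambda>z. (bexp (j + 2) (1 - s * ((Re (z - c))\<^sup>2 + (Im (z - c))\<^sup>2)) + (- real j) * bexp (j + 1) (1 - s * ((Re (z - c))\<^sup>2 + (Im (z - c))\<^sup>2)))
       * ((-2 * s) * (Re (z - c) * Re v + Im (z - c) * Im v)))" for v
    by (intro bump_alg.intros)
  then show ?case using has_derivative_bexp_radial[of j s c]
    by (intro exI[of _ "\<lambda>z h. (bexp (j + 2) (1 - s * ((Re (z - c))\<^sup>2 + (Im (z - c))\<^sup>2)) - real j * bexp (j + 1) (1 - s * ((Re (z - c))\<^sup>2 + (Im (z - c))\<^sup>2)))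
       * ((-2 * s) * (Re (z - c) * Re h + Im (z - c) * Im h))"]) simp
next
  case (add \<phi> \<psi>)
  then obtain D E where "\<forall>z. (\<phi> has_derivative D z) (at z)" "\<forall>v. bump_alg s c (\<lambda>z. D z v)"
    "\<forall>z. (\<psi> has_derivative E z) (at z)" "\<forall>v. bump_alg s c (\<lambda>z. E z v)" by blast
  then show ?case by (intro exI[of _ "\<lambda>z h. D z h + E z h"]) (auto intro: bump_alg.add has_derivative_add)
next
  case (mult \<phi> \<psi>)
  then obtain D E where "\<forall>z. (\<phi> has_derivative D z) (at z)" "\<forall>v. bump_alg s c (\<lambda>z. D z v)"
    "\<forall>z. (\<psi> has_derivative E z) (at z)" "\<forall>v. bump_alg s c (\<lambda>z. E z v)" by blast
  with mult show ?case
    by (intro exI[of _ "\<lambda>z h. \<phi> z * E z h + D z h * \<psi> z"]) (auto intro!: bump_alg.intros has_derivative_mult)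
qed

lemma bump_alg_C_k: "bump_alg s c \<phi> \<Longrightarrow> C_k n \<phi>"
proof (induction n arbitrary: \<phi>)
  case 0
  then obtain D where "\<forall>z. (\<phi> has_derivative D z) (at z)" using bump_alg_derivative by blast
  then show ?case by (auto simp: continuous_on_eq_continuous_at intro: has_derivative_continuous)
next
  case (Suc n)
  then obtain D where D: "\<forall>z. (\<phi> has_derivative D z) (at z)" "\<forall>v. bump_alg s c (\<lambda>z. D z v)" using bump_alg_derivative by blast
  have "frechet_derivative \<phi> (at z) = D z" for z using D(1) frechet_derivative_at by metis
  then show ?case using D Suc.IH by (auto simp: differentiable_on_def differentiable_def intro: has_derivative_at_withinI)
qed

lemma continuous_compact_support_integrable:
  fixes f :: "complex \<Rightarrow> real"
  assumes "continuous_on UNIV f" "\<And>w. e \<le> norm w \<Longrightarrow> f w = 0"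
  shows "integrable lborel f"
proof -
  have "integrable lborel (\<lambda>w. indicator (cball 0 e) w *\<^sub>R f w)"
    by (rule borel_integrable_compact) (auto intro: continuous_on_subset[OF assms(1)])
  moreover have "(\<lambda>w. indicator (cball 0 e) w *\<^sub>R f w) = f"
    using assms(2) by (auto simp: indicator_def fun_eq_iff)
  ultimately show ?thesis by simp
qed

text \<open>A normalized radial bump. Radial symmetry makes the kernel even, so that it has mass 1
  in either variable of \<open>k (w - z)\<close>; the partials \<open>kx\<close> and
  \<open>ky\<close> are named because convolutions are differentiated through them.\<close>

lemma mollifier_exists:
  assumes "e > 0"
  obtains k kx ky :: "complex \<Rightarrow> real" where
    "\<And>z. test_function (\<lambda>w. k (w - z))" "\<And>w. k w \<ge> 0"
    "\<And>w. e \<le> norm w \<Longrightarrow> k w = 0 \<and> kx w = 0 \<and> ky w = 0" "integral\<^sup>L lborel k = 1" "\<And>w. k (- w) = k w"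
    "\<And>w. (k has_derivative (\<lambda>h. Re h * kx w + Im h * ky w)) (at w)" "continuous_on UNIV kx" "continuous_on UNIV ky"
proof -
  \<comment> \<open>The bump is positive where s |w|^2 < 1, that is inside radius
    \<open>e\<close>.\<close>
  define s where "s = 1 / e\<^sup>2"
  define k0 where "k0 w = bexp 0 (1 - s * ((Re w)\<^sup>2 + (Im w)\<^sup>2))" for w
  have s: "s > 0" using assms by (simp add: s_def)
  have out: "1 - s * ((Re w)\<^sup>2 + (Im w)\<^sup>2) \<le> 0" if "e \<le> norm w" for w
  proof -
    have "e\<^sup>2 \<le> (norm w)\<^sup>2" using that assms by (intro power_mono) auto
    then have "e\<^sup>2 \<le> (Re w)\<^sup>2 + (Im w)\<^sup>2" by (simp add: cmod_power2)
    then show ?thesis using assms by (simp add: s_def field_simps)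
  qed
  have k00: "k0 w = 0" if "e \<le> norm w" for w using out[OF that] by (simp add: k0_def bexp_def)
  have ck: "continuous_on UNIV k0" unfolding k0_def by (intro continuous_intros)
  have int: "integrable lborel k0" using ck k00 by (rule continuous_compact_support_integrable)
  have nn: "k0 w \<ge> 0" for w by (simp add: k0_def bexp_def)
  define I where "I = integral\<^sup>L lborel k0"
  have "I \<noteq> 0"
  proof
    assume "I = 0"
    then have "AE w in lborel. k0 w = 0" using integral_nonneg_eq_0_iff_AE[OF int] nn by (simp add: I_def)
    then have "AE w in lborel_on UNIV. k0 w = 0" by (simp add: AE_lborel_on_iff)
    moreover have "open {w \<in> UNIV. \<not> k0 w = 0}" using open_Collect_neq[OF ck continuous_on_const, of 0] by simp
    ultimately have "k0 0 = 0" by (intro AE_lborel_on_open_imp[where S = UNIV and P = "\<lambda>w. k0 w = 0"]) auto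
    then show False by (simp add: k0_def bexp_def)
  qed
  moreover have "I \<ge> 0" unfolding I_def using nn by simp
  ultimately have I: "I > 0" by simp
  define k where "k w = inverse I * k0 w" for w
  define kx where "kx w = inverse I * (bexp 2 (1 - s * ((Re w)\<^sup>2 + (Im w)\<^sup>2)) * ((-2 * s) * Re w))" for w
  define ky where "ky w = inverse I * (bexp 2 (1 - s * ((Re w)\<^sup>2 + (Im w)\<^sup>2)) * ((-2 * s) * Im w))" for w
  show thesis
  proof (rule that[of k kx ky])
    fix z
    have "bump_alg s z (\<lambda>w. inverse I * bexp 0 (1 - s * ((Re (w - z))\<^sup>2 + (Im (w - z))\<^sup>2)))"
      by (intro bump_alg.intros)
    then have "C_k n (\<lambda>w. k (w - z))" for n using bump_alg_C_k by (simp add: k_def k0_def)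
    moreover have "{w. k (w - z) \<noteq> 0} \<subseteq> cball z e"
      using k00 by (force simp: k_def dist_norm norm_minus_commute)
    then have "bounded {w. k (w - z) \<noteq> 0}" by (rule bounded_subset[OF bounded_cball])
    ultimately show "test_function (\<lambda>w. k (w - z))" by (simp add: test_function_def compact_closure)
  next
    fix w
    show "k w \<ge> 0" using I nn by (simp add: k_def)
    show "e \<le> norm w \<Longrightarrow> k w = 0 \<and> kx w = 0 \<and> ky w = 0" using k00 out[of w] by (simp add: k_def kx_def ky_def bexp_def)
    show "k (- w) = k w" by (simp add: k_def k0_def)
    have "(k0 has_derivative (\<lambda>h. bexp 2 (1 - s * ((Re w)\<^sup>2 + (Im w)\<^sup>2)) * ((-2 * s) * (Re w * Re h + Im w * Im h)))) (at w)"
      using has_derivative_bexp_radial[of 0 s 0 w] by (simp add: k0_def[abs_def] numeral_2_eq_2)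
    from has_derivative_mult_right[OF this, of "inverse I"]
    show "(k has_derivative (\<lambda>h. Re h * kx w + Im h * ky w)) (at w)"
      unfolding k_def[abs_def] kx_def ky_def by (rule has_derivative_eq_rhs) (simp add: fun_eq_iff algebra_simps)
  next
    show "integral\<^sup>L lborel k = 1" using I by (simp add: k_def[abs_def] I_def)
    show "continuous_on UNIV kx" "continuous_on UNIV ky" unfolding kx_def[abs_def] ky_def[abs_def] by (intro continuous_intros)+
  qed
qed

section \<open>Convolution with continuous kernels of compact support\<close>

definition loc_integrable :: "(complex \<Rightarrow> complex) \<Rightarrow> bool" where
  "loc_integrable h \<longleftrightarrow> h \<in> borel_measurable borel \<and> (\<forall>K. compact K \<longrightarrow> integrable lborel (\<lambda>w. indicator K w * norm (h w)))"

lemma uniformly_continuous_compact_support: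
  fixes g :: "complex \<Rightarrow> real"
  assumes g: "continuous_on UNIV g" "\<And>w. e \<le> norm w \<Longrightarrow> g w = 0" and d: "d > 0"
  shows "\<exists>r>0. \<forall>x y. dist x y < r \<longrightarrow> dist (g x) (g y) < d"
proof -
  have "uniformly_continuous_on (cball 0 (\<bar>e\<bar> + 1)) g"
    by (intro compact_uniformly_continuous continuous_on_subset[OF g(1)]) auto
  then obtain r where r: "r > 0" "\<And>x y. norm x \<le> \<bar>e\<bar> + 1 \<Longrightarrow> norm y \<le> \<bar>e\<bar> + 1 \<Longrightarrow> dist y x < r \<Longrightarrow> dist (g y) (g x) < d"
    using d unfolding uniformly_continuous_on_def by (metis dist_0_norm mem_cball)
  show ?thesis
  proof (intro exI[of _ "min r 1"] conjI allI impI)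
    fix x y :: complex assume xy: "dist x y < min r 1"
    show "dist (g x) (g y) < d"
    proof (cases "norm x \<le> \<bar>e\<bar> + 1 \<and> norm y \<le> \<bar>e\<bar> + 1")
      case True then show ?thesis using r(2)[of y x] xy by simp
    next
      case False
      \<comment> \<open>Of two points less than 1 apart, if one lies outside radius |e| + 1 then
        both lie outside radius \<open>e\<close>, where \<open>g\<close> vanishes.\<close>
      have "\<bar>norm x - norm y\<bar> < 1" using norm_triangle_ineq3[of x y] xy by (simp add: dist_norm)
      then have "e \<le> norm x" "e \<le> norm y" using False by linarith+
      then show ?thesis using g(2) d by simp
    qed
  qed (use r in auto)
qed

lemma integrable_kernel_mult:
  fixes g :: "complex \<Rightarrow> real"
  assumes h: "loc_integrable h" and g: "continuous_on UNIV g" "\<And>w. e \<le> norm w \<Longrightarrow> g w = 0"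
  shows "integrable lborel (\<lambda>w. g (w - z) *\<^sub>R h w)"
proof -
  obtain B where B: "\<And>w. \<bar>g w\<bar> \<le> B"
  proof -
    have "compact (g ` cball 0 e)" by (intro compact_continuous_image continuous_on_subset[OF g(1)]) auto
    then obtain B where "\<And>w. norm w \<le> e \<Longrightarrow> \<bar>g w\<bar> \<le> B" using compact_imp_bounded by (force simp: bounded_iff)
    then have "\<bar>g w\<bar> \<le> \<bar>B\<bar>" for w using g(2)[of w] abs_ge_self[of B] by (cases "norm w \<le> e") (force, simp)
    then show thesis by (rule that)
  qed
  have [measurable]: "g \<in> borel_measurable borel" "h \<in> borel_measurable borel"
    using h borel_measurable_continuous_onI[OF g(1)] by (auto simp: loc_integrable_def)
  show ?thesis
  proof (rule Bochner_Integration.integrable_bound)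
    show "integrable lborel (\<lambda>w. B * (indicator (cball z e) w * norm (h w)))"
      using h by (auto simp: loc_integrable_def)
    have "norm (g (w - z) *\<^sub>R h w) \<le> norm (B * (indicator (cball z e) w * norm (h w)))" for w
    proof (cases "w \<in> cball z e")
      case True
      have "\<bar>g (w - z)\<bar> * norm (h w) \<le> \<bar>B\<bar> * norm (h w)" using B[of "w - z"] by (intro mult_right_mono) auto
      then show ?thesis using True by (simp add: abs_mult)
    next
      case False
      then have "g (w - z) = 0" by (intro g(2)) (simp add: dist_norm norm_minus_commute)
      then show ?thesis by simp
    qed
    then show "AE w in lborel. norm (g (w - z) *\<^sub>R h w) \<le> norm (B * (indicator (cball z e) w * norm (h w)))" by simp
  qed measurable
qed

lemma norm_kernel_integral_le:
  fixes G :: "complex \<Rightarrow> real"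
  assumes h: "loc_integrable h" and G: "\<And>w. \<bar>G w\<bar> \<le> C * indicator (cball z r) w" "C \<ge> 0"
  shows "norm (LINT w|lborel. G w *\<^sub>R h w) \<le> C * (LINT w|lborel. indicator (cball z r) w * norm (h w))"
proof -
  have "norm (LINT w|lborel. G w *\<^sub>R h w) \<le> (LINT w|lborel. norm (G w *\<^sub>R h w))" by (rule integral_norm_bound)
  also have "\<dots> \<le> (LINT w|lborel. C * (indicator (cball z r) w * norm (h w)))"
  proof (rule integral_mono')
    show "integrable lborel (\<lambda>w. C * (indicator (cball z r) w * norm (h w)))" using h by (auto simp: loc_integrable_def)
    show "norm (G w *\<^sub>R h w) \<le> C * (indicator (cball z r) w * norm (h w))" for w
      using mult_right_mono[OF G(1)[of w] norm_ge_zero[of "h w"]] by (simp add: mult.assoc)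
  qed (use G(2) in simp)
  finally show ?thesis by simp
qed

lemma continuous_on_convolution:
  fixes g :: "complex \<Rightarrow> real"
  assumes h: "loc_integrable h" and g: "continuous_on UNIV g" "\<And>w. e \<le> norm w \<Longrightarrow> g w = 0" and e: "e \<ge> 0"
  shows "continuous_on UNIV (\<lambda>z. LINT w|lborel. g (w - z) *\<^sub>R h w)"
  unfolding continuous_on_iff
proof (intro ballI allI impI)
  fix z :: complex and d :: real assume d: "d > 0"
  define H where "H = (LINT w|lborel. indicator (cball z (e + 1)) w * norm (h w))"
  have H: "H \<ge> 0" unfolding H_def by simp
  obtain r where r: "r > 0" "\<And>x y. dist x y < r \<Longrightarrow> dist (g x) (g y) < d / (H + 1)"
    using uniformly_continuous_compact_support[OF g(1), of e "d / (H + 1)"] g(2) d H by auto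
  have "dist (LINT w|lborel. g (w - y) *\<^sub>R h w) (LINT w|lborel. g (w - z) *\<^sub>R h w) < d" if y: "dist y z < min r 1" for y
  proof -
    have "(LINT w|lborel. g (w - y) *\<^sub>R h w) - (LINT w|lborel. g (w - z) *\<^sub>R h w) = (LINT w|lborel. (g (w - y) - g (w - z)) *\<^sub>R h w)"
      by (simp add: scaleR_diff_left Bochner_Integration.integral_diff integrable_kernel_mult[OF h g])
    also have "norm \<dots> \<le> d / (H + 1) * H"
      unfolding H_def
    proof (rule norm_kernel_integral_le[OF h])
      show "\<bar>g (w - y) - g (w - z)\<bar> \<le> d / ((LINT w|lborel. indicator (cball z (e + 1)) w * norm (h w)) + 1) * indicator (cball z (e + 1)) w" for w
      proof (cases "w \<in> cball z (e + 1)")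
        case True
        have "dist (w - y) (w - z) < r" using y by (simp add: dist_norm norm_minus_commute)
        then show ?thesis using r(2)[of "w - y" "w - z"] True by (simp add: dist_norm H_def)
      next
        case False
        then have "e + 1 < norm (w - z)" by (simp add: dist_norm norm_minus_commute)
        moreover have "norm (w - z) \<le> norm (w - y) + norm (y - z)" using norm_triangle_ineq[of "w - y" "y - z"] by simp
        ultimately have "e \<le> norm (w - z)" "e \<le> norm (w - y)" using y by (auto simp: dist_norm)
        then show ?thesis using g(2) False by simp
      qed
      show "0 \<le> d / ((LINT w|lborel. indicator (cball z (e + 1)) w * norm (h w)) + 1)" using d H by (simp add: H_def)
    qed
    also have "\<dots> < d" using d H by (simp add: field_simps)
    finally show ?thesis by (simp add: dist_norm)
  qed
  then show "\<exists>\<delta>>0. \<forall>y\<in>UNIV. dist y z < \<delta> \<longrightarrow> dist (LINT w|lborel. g (w - y) *\<^sub>R h w) (LINT w|lborel. g (w - z) *\<^sub>R h w) < d"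
    using r by (intro exI[of _ "min r 1"]) auto
qed

text \<open>Differentiation under the integral sign. Uniform continuity of \<open>kx\<close> and
  \<open>ky\<close> bounds the linearization error of the kernel uniformly, and this error lives in
  a fixed ball, so its integral against \<open>h\<close> is o(|y - z|). The minus signs come from
  the argument \<open>w - z\<close> of the kernel.\<close>

lemma C1on_convolution:
  fixes k kx ky :: "complex \<Rightarrow> real"
  assumes h: "loc_integrable h" and e: "e \<ge> 0" and k0: "\<And>w. e \<le> norm w \<Longrightarrow> k w = 0 \<and> kx w = 0 \<and> ky w = 0"
    and D: "\<And>w. (k has_derivative (\<lambda>h. Re h * kx w + Im h * ky w)) (at w)" and c: "continuous_on UNIV kx" "continuous_on UNIV ky"
  shows "C1on UNIV (\<lambda>z. LINT w|lborel. k (w - z) *\<^sub>R h w) (\<lambda>z. - (LINT w|lborel. kx (w - z) *\<^sub>R h w)) (\<lambda>z. - (LINT w|lborel. ky (w - z) *\<^sub>R h w))"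
proof -
  have ck: "continuous_on UNIV k" using D by (auto simp: continuous_on_eq_continuous_at intro: has_derivative_continuous)
  note ik = integrable_kernel_mult[OF h ck, of e] integrable_kernel_mult[OF h c(1), of e] integrable_kernel_mult[OF h c(2), of e]
  have int: "integrable lborel (\<lambda>w. k (w - z) *\<^sub>R h w)" "integrable lborel (\<lambda>w. kx (w - z) *\<^sub>R h w)" "integrable lborel (\<lambda>w. ky (w - z) *\<^sub>R h w)" for z
    using k0 by (auto intro!: ik)
  let ?U = "\<lambda>z. LINT w|lborel. k (w - z) *\<^sub>R h w"
  have "(?U has_derivative rlin (- (LINT w|lborel. kx (w - z) *\<^sub>R h w)) (- (LINT w|lborel. ky (w - z) *\<^sub>R h w))) (at z)" for z
    unfolding has_derivative_at_alt
  proof (intro conjI allI impI bounded_linear_rlin)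
    fix d :: real assume d: "d > 0"
    define H where "H = (LINT w|lborel. indicator (cball z (e + 1)) w * norm (h w))"
    have H: "H \<ge> 0" unfolding H_def by simp
    \<comment> \<open>The factor 2 accounts for the two partials; adding 1 to \<open>H\<close>
      avoids division by zero.\<close>
    define d1 where "d1 = d / (2 * (H + 1))"
    have d1: "d1 > 0" using d H by (simp add: d1_def)
    obtain r1 where r1: "r1 > 0" "\<And>x y. dist x y < r1 \<Longrightarrow> dist (kx x) (kx y) < d1"
      using uniformly_continuous_compact_support[OF c(1) _ d1] k0 by metis
    obtain r2 where r2: "r2 > 0" "\<And>x y. dist x y < r2 \<Longrightarrow> dist (ky x) (ky y) < d1"
      using uniformly_continuous_compact_support[OF c(2) _ d1] k0 by metis
    have "norm (?U y - ?U z - rlin (- (LINT w|lborel. kx (w - z) *\<^sub>R h w)) (- (LINT w|lborel. ky (w - z) *\<^sub>R h w)) (y - z)) \<le> d * norm (y - z)"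
      if y: "norm (y - z) < min (min r1 r2) 1" for y
    proof -
      define G where "G w = k (w - y) - k (w - z) + (Re (y - z) * kx (w - z) + Im (y - z) * ky (w - z))" for w
      have Gb: "\<bar>G w\<bar> \<le> (2 * d1 * norm (y - z)) * indicator (cball z (e + 1)) w" for w
      proof (cases "w \<in> cball z (e + 1)")
        case True
        have "norm (k (w - y) - k (w - z) - (\<lambda>x h. Re h * kx x + Im h * ky x) (w - z) ((w - y) - (w - z))) \<le> norm ((w - y) - (w - z)) * (2 * d1)"
        proof (rule differentiable_bound_linearization[where S = "ball (w - z) (min r1 r2)"])
          show "w - z + t *\<^sub>R (w - y - (w - z)) \<in> ball (w - z) (min r1 r2)" if "t \<in> {0..1}" for t
          proof -
            have "norm (t *\<^sub>R (w - y - (w - z))) \<le> norm (y - z)"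
              using that by (simp add: norm_minus_commute mult_left_le_one_le)
            then have "dist (w - z) (w - z + t *\<^sub>R (w - y - (w - z))) \<le> norm (y - z)" unfolding dist_norm by simp
            then show ?thesis using y unfolding mem_ball by linarith
          qed
          show "(k has_derivative (\<lambda>h. Re h * kx x + Im h * ky x)) (at x within ball (w - z) (min r1 r2))" for x
            by (rule has_derivative_at_withinI[OF D])
          show "w - z \<in> ball (w - z) (min r1 r2)" using r1 r2 by simp
          fix x assume x: "x \<in> ball (w - z) (min r1 r2)"
          show "onorm ((\<lambda>h. Re h * kx x + Im h * ky x) - (\<lambda>h. Re h * kx (w - z) + Im h * ky (w - z))) \<le> 2 * d1"
          proof (rule onorm_le)
            fix v
            have "\<bar>kx x - kx (w - z)\<bar> \<le> d1" "\<bar>ky x - ky (w - z)\<bar> \<le> d1"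
              using r1(2)[of x "w - z"] r2(2)[of x "w - z"] x by (auto simp: dist_commute dist_real_def)
            then have "\<bar>Re v * (kx x - kx (w - z))\<bar> \<le> norm v * d1" "\<bar>Im v * (ky x - ky (w - z))\<bar> \<le> norm v * d1"
              unfolding abs_mult by (auto intro!: mult_mono abs_Re_le_cmod abs_Im_le_cmod)
            moreover have "((\<lambda>h. Re h * kx x + Im h * ky x) - (\<lambda>h. Re h * kx (w - z) + Im h * ky (w - z))) v = Re v * (kx x - kx (w - z)) + Im v * (ky x - ky (w - z))"
              by (simp add: algebra_simps)
            ultimately show "norm (((\<lambda>h. Re h * kx x + Im h * ky x) - (\<lambda>h. Re h * kx (w - z) + Im h * ky (w - z))) v) \<le> 2 * d1 * norm v"
              using abs_triangle_ineq[of "Re v * (kx x - kx (w - z))" "Im v * (ky x - ky (w - z))"] by (simp add: algebra_simps)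
          qed
        qed
        moreover have "k (w - y) - k (w - z) - (\<lambda>x h. Re h * kx x + Im h * ky x) (w - z) ((w - y) - (w - z)) = G w"
          by (simp add: G_def algebra_simps)
        ultimately show ?thesis using True by (simp add: norm_minus_commute mult.commute)
      next
        case False
        then have "e + 1 < norm (w - z)" by (simp add: dist_norm norm_minus_commute)
        moreover have "norm (w - z) \<le> norm (w - y) + norm (y - z)" using norm_triangle_ineq[of "w - y" "y - z"] by simp
        ultimately have "e \<le> norm (w - z)" "e \<le> norm (w - y)" using y by (auto simp: dist_norm)
        then have "G w = 0" using k0[of "w - z"] k0[of "w - y"] by (simp add: G_def)
        then show ?thesis using False by simp
      qed
      have "(LINT w|lborel. G w *\<^sub>R h w) = (LINT w|lborel. k (w - y) *\<^sub>R h w - k (w - z) *\<^sub>R h w + (Re (y - z) *\<^sub>R (kx (w - z) *\<^sub>R h w) + Im (y - z) *\<^sub>R (ky (w - z) *\<^sub>R h w)))"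
        by (rule Bochner_Integration.integral_cong) (simp_all add: G_def scaleR_add_left scaleR_diff_left algebra_simps)
      also have "\<dots> = ?U y - ?U z - rlin (- (LINT w|lborel. kx (w - z) *\<^sub>R h w)) (- (LINT w|lborel. ky (w - z) *\<^sub>R h w)) (y - z)"
        unfolding rlin_def using int by (simp only: Bochner_Integration.integral_add Bochner_Integration.integral_diff integral_scaleR_right integrable_scaleR_right Bochner_Integration.integrable_add Bochner_Integration.integrable_diff) simp
      finally have "norm (?U y - ?U z - rlin (- (LINT w|lborel. kx (w - z) *\<^sub>R h w)) (- (LINT w|lborel. ky (w - z) *\<^sub>R h w)) (y - z)) = norm (LINT w|lborel. G w *\<^sub>R h w)"
        by simp
      also have "\<dots> \<le> (2 * d1 * norm (y - z)) * H" unfolding H_def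
        by (rule norm_kernel_integral_le[OF h Gb]) (use d1 in simp)
      also have "\<dots> = (2 * d1 * H) * norm (y - z)" by simp
      also have "\<dots> \<le> d * norm (y - z)"
        by (rule mult_right_mono) (use d H in \<open>auto simp: d1_def field_simps\<close>)
      finally show ?thesis .
    qed
    then show "\<exists>r>0. \<forall>y. norm (y - z) < r \<longrightarrow> norm (?U y - ?U z - rlin (- (LINT w|lborel. kx (w - z) *\<^sub>R h w)) (- (LINT w|lborel. ky (w - z) *\<^sub>R h w)) (y - z)) \<le> d * norm (y - z)"
      using r1 r2 by (intro exI[of _ "min (min r1 r2) 1"]) auto
  qed
  moreover have "continuous_on UNIV (\<lambda>z. - (LINT w|lborel. kx (w - z) *\<^sub>R h w))" "continuous_on UNIV (\<lambda>z. - (LINT w|lborel. ky (w - z) *\<^sub>R h w))"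
    using k0 by (auto intro!: continuous_on_minus continuous_on_convolution[OF h _ _ e] c)
  ultimately show ?thesis unfolding C1on_def by simp
qed

lemma kernel_integral_eq_1:
  fixes k :: "complex \<Rightarrow> real"
  assumes "integral\<^sup>L lborel k = 1" "k \<in> borel_measurable borel"
  shows "(LINT w|lborel. k (w - z)) = 1"
  using integral_lborel_shift[OF assms(2), of "-z"] assms by simp

text \<open>The convolution at \<open>z\<close> is an average of \<open>h\<close> against a
  probability density supported in the ball of radius \<open>e\<close> around
  \<open>z\<close>.\<close>

lemma norm_convolution_diff_le:
  fixes k :: "complex \<Rightarrow> real"
  assumes h: "loc_integrable h" and k: "continuous_on UNIV k" "\<And>w. k w \<ge> 0" "\<And>w. e \<le> norm w \<Longrightarrow> k w = 0" "integral\<^sup>L lborel k = 1"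
    and d: "\<And>w. dist w z < e \<Longrightarrow> norm (h w - c) \<le> d"
  shows "norm ((LINT w|lborel. k (w - z) *\<^sub>R h w) - c) \<le> d"
proof -
  have km: "k \<in> borel_measurable borel" by (rule borel_measurable_continuous_onI[OF k(1)])
  have ik: "integrable lborel (\<lambda>w. k (w - z))"
    using integrable_lborel_shift[OF continuous_compact_support_integrable[OF k(1,3)], where w = "-z"] by simp
  have k1: "(LINT w|lborel. k (w - z)) = 1" by (rule kernel_integral_eq_1[OF k(4) km])
  have ih: "integrable lborel (\<lambda>w. k (w - z) *\<^sub>R h w)" by (rule integrable_kernel_mult[OF h k(1,3)])
  have "(LINT w|lborel. k (w - z) *\<^sub>R h w) - c = (LINT w|lborel. k (w - z) *\<^sub>R h w) - (LINT w|lborel. k (w - z) *\<^sub>R c)"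
  proof -
    have "(LINT w|lborel. k (w - z) *\<^sub>R c) = (LINT w|lborel. k (w - z)) *\<^sub>R c"
      by (rule integral_scaleR_left) (rule ik)
    then show ?thesis using k1 by simp
  qed
  also have "\<dots> = (LINT w|lborel. k (w - z) *\<^sub>R (h w - c))"
    using ih ik by (simp add: scaleR_diff_right Bochner_Integration.integral_diff)
  also have "norm \<dots> \<le> (LINT w|lborel. norm (k (w - z) *\<^sub>R (h w - c)))" by (rule integral_norm_bound)
  also have "\<dots> \<le> (LINT w|lborel. d * k (w - z))"
  proof (rule integral_mono')
    show b: "norm (k (w - z) *\<^sub>R (h w - c)) \<le> d * k (w - z)" for w
    proof (cases "dist w z < e")
      case True
      then show ?thesis using mult_right_mono[OF d[OF True] k(2)[of "w - z"]] k(2)[of "w - z"] by (simp add: mult.commute)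
    next
      case False
      then show ?thesis using k(3)[of "w - z"] by (simp add: dist_norm)
    qed
    show "0 \<le> d * k (w - z)" for w by (rule order_trans[OF norm_ge_zero b])
  qed (use ik in auto)
  also have "\<dots> = d" using k1 by simp
  finally show ?thesis .
qed

section \<open>Approximation in L2 by mollification\<close>

definition loc_square_integrable :: "(complex \<Rightarrow> complex) \<Rightarrow> bool" where
  "loc_square_integrable h \<longleftrightarrow> h \<in> borel_measurable borel \<and> (\<forall>K. compact K \<longrightarrow> integrable lborel (\<lambda>w. indicator K w * (norm (h w))\<^sup>2))"

lemma loc_square_integrableD:
  assumes "loc_square_integrable h"
  shows "loc_integrable h" "loc_integrable (\<lambda>w. of_real ((norm (h w))\<^sup>2))"
proof -
  have [measurable]: "h \<in> borel_measurable borel" using assms by (simp add: loc_square_integrable_def)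
  have sq: "integrable lborel (\<lambda>w. indicator K w * (norm (h w))\<^sup>2)" if "compact K" for K
    using assms that by (simp add: loc_square_integrable_def)
  then show "loc_integrable (\<lambda>w. of_real ((norm (h w))\<^sup>2))" by (simp add: loc_integrable_def norm_power)
  have "integrable lborel (\<lambda>w. indicator K w * norm (h w))" if K: "compact K" for K
  proof (rule Bochner_Integration.integrable_bound)
    have [measurable]: "K \<in> sets borel" using K by (simp add: borel_compact)
    show "(\<lambda>w. indicator K w * norm (h w)) \<in> borel_measurable lborel" by measurable
    have "integrable lborel (indicator K :: complex \<Rightarrow> real)"
      using K by (intro integrable_real_indicator emeasure_compact_finite) (auto simp: borel_compact)
    then show "integrable lborel (\<lambda>w. indicator K w + indicator K w * (norm (h w))\<^sup>2)" using sq[OF K] by simp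
    have "x \<le> 1 + x\<^sup>2" for x :: real using zero_le_power2[of "x - 1/2"] by (simp add: power2_eq_square algebra_simps)
    then show "AE w in lborel. norm (indicator K w * norm (h w)) \<le> norm (indicator K w + indicator K w * (norm (h w))\<^sup>2)"
      by (auto simp: indicator_def)
  qed
  then show "loc_integrable h" by (simp add: loc_integrable_def)
qed

lemma continuous_imp_loc_square_integrable:
  assumes "continuous_on UNIV h" shows "loc_square_integrable h"
  unfolding loc_square_integrable_def
proof (intro conjI allI impI)
  show "h \<in> borel_measurable borel" by (rule borel_measurable_continuous_onI[OF assms])
  fix K :: "complex set" assume "compact K"
  then have "integrable lborel (\<lambda>w. indicator K w *\<^sub>R (norm (h w))\<^sup>2)"
    by (intro borel_integrable_compact) (auto intro!: continuous_intros continuous_on_subset[OF assms])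
  then show "integrable lborel (\<lambda>w. indicator K w * (norm (h w))\<^sup>2)" by simp
qed

lemma loc_square_integrable_diff:
  assumes "loc_square_integrable f" "loc_square_integrable g"
  shows "loc_square_integrable (\<lambda>w. f w - g w)"
  unfolding loc_square_integrable_def
proof (intro conjI allI impI)
  have [measurable]: "f \<in> borel_measurable borel" "g \<in> borel_measurable borel" using assms by (auto simp: loc_square_integrable_def)
  show "(\<lambda>w. f w - g w) \<in> borel_measurable borel" by measurable
  fix K :: "complex set" assume K: "compact K"
  then have [measurable]: "K \<in> sets borel" by (simp add: borel_compact)
  show "integrable lborel (\<lambda>w. indicator K w * (norm (f w - g w))\<^sup>2)"
  proof (rule Bochner_Integration.integrable_bound)
    show "integrable lborel (\<lambda>w. 2 * (indicator K w * (norm (f w))\<^sup>2) + 2 * (indicator K w * (norm (g w))\<^sup>2))"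
      using assms K by (auto simp: loc_square_integrable_def)
    have "(norm (a - b))\<^sup>2 \<le> 2 * (norm a)\<^sup>2 + 2 * (norm b)\<^sup>2" for a b :: complex
    proof -
      have "(norm (a - b))\<^sup>2 \<le> (norm a + norm b)\<^sup>2" by (intro power_mono norm_triangle_ineq4) auto
      also have "\<dots> \<le> 2 * (norm a)\<^sup>2 + 2 * (norm b)\<^sup>2" using sum_squares_bound[of "norm a" "norm b"] by (simp add: power2_sum)
      finally show ?thesis .
    qed
    then show "AE w in lborel. norm (indicator K w * (norm (f w - g w))\<^sup>2) \<le> norm (2 * (indicator K w * (norm (f w))\<^sup>2) + 2 * (indicator K w * (norm (g w))\<^sup>2))"
      by (auto simp: indicator_def)
  qed measurable
qed

text \<open>Jensen's inequality for the probability density \<open>k (w - z)\<close>, obtained by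
  expanding the nonnegative variance of \<open>norm (h w)\<close> around its mean
  \<open>t\<close>.\<close>

lemma convolution_square_le:
  fixes k :: "complex \<Rightarrow> real"
  assumes h: "loc_square_integrable h" and k: "continuous_on UNIV k" "\<And>w. k w \<ge> 0" "\<And>w. e \<le> norm w \<Longrightarrow> k w = 0" "integral\<^sup>L lborel k = 1"
  shows "ennreal ((norm (LINT w|lborel. k (w - z) *\<^sub>R h w))\<^sup>2) \<le> (\<integral>\<^sup>+w. ennreal (k (w - z) * (norm (h w))\<^sup>2) \<partial>lborel)"
proof -
  note h12 = loc_square_integrableD[OF h]
  have km: "k \<in> borel_measurable borel" by (rule borel_measurable_continuous_onI[OF k(1)])
  have i0: "integrable lborel (\<lambda>w. k (w - z))"
    using integrable_lborel_shift[OF continuous_compact_support_integrable[OF k(1,3)], where w = "-z"] by simp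
  have i1: "integrable lborel (\<lambda>w. k (w - z) * norm (h w))"
    using integrable_norm[OF integrable_kernel_mult[OF h12(1) k(1,3), where z = z]] k(2) by simp
  have i2: "integrable lborel (\<lambda>w. k (w - z) * (norm (h w))\<^sup>2)"
    using integrable_norm[OF integrable_kernel_mult[OF h12(2) k(1,3), where z = z]] k(2) by (simp add: norm_power)
  have k1: "(LINT w|lborel. k (w - z)) = 1" by (rule kernel_integral_eq_1[OF k(4) km])
  define t where "t = (LINT w|lborel. k (w - z) * norm (h w))"
  have "norm (LINT w|lborel. k (w - z) *\<^sub>R h w) \<le> (LINT w|lborel. norm (k (w - z) *\<^sub>R h w))" by (rule integral_norm_bound)
  also have "\<dots> = t" using k(2) by (simp add: t_def)
  finally have nt: "norm (LINT w|lborel. k (w - z) *\<^sub>R h w) \<le> t" .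
  have "0 \<le> (LINT w|lborel. k (w - z) * (norm (h w) - t)\<^sup>2)" using k(2) by (intro Bochner_Integration.integral_nonneg) simp
  also have "\<dots> = (LINT w|lborel. k (w - z) * (norm (h w))\<^sup>2 - (2 * t) * (k (w - z) * norm (h w)) + t\<^sup>2 * k (w - z))"
    by (rule Bochner_Integration.integral_cong) (simp_all add: power2_diff algebra_simps)
  also have "\<dots> = (LINT w|lborel. k (w - z) * (norm (h w))\<^sup>2) - (2 * t) * t + t\<^sup>2 * 1"
    unfolding t_def using i0 i1 i2 k1
    by (simp add: Bochner_Integration.integral_add Bochner_Integration.integral_diff)
  finally have "t\<^sup>2 \<le> (LINT w|lborel. k (w - z) * (norm (h w))\<^sup>2)" by (simp add: power2_eq_square)
  moreover have "(norm (LINT w|lborel. k (w - z) *\<^sub>R h w))\<^sup>2 \<le> t\<^sup>2" by (rule power_mono[OF nt]) simp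
  ultimately have "(norm (LINT w|lborel. k (w - z) *\<^sub>R h w))\<^sup>2 \<le> (LINT w|lborel. k (w - z) * (norm (h w))\<^sup>2)" by simp
  moreover have "(\<integral>\<^sup>+w. ennreal (k (w - z) * (norm (h w))\<^sup>2) \<partial>lborel) = ennreal (LINT w|lborel. k (w - z) * (norm (h w))\<^sup>2)"
    by (rule nn_integral_eq_integral[OF i2]) (use k(2) in simp)
  ultimately show ?thesis by (simp add: ennreal_leI)
qed

text \<open>Jensen pointwise, then Tonelli: as \<open>k\<close> is even, it has integral 1 in
  \<open>z\<close> for fixed \<open>w\<close> as well. The sets \<open>A\<close> and
  \<open>B\<close> localize the contraction, because values at \<open>z\<close> depend on
  \<open>h\<close> within distance \<open>e\<close> only.\<close>

lemma convolution_L2_le: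
  fixes k :: "complex \<Rightarrow> real"
  assumes h: "loc_square_integrable h" and k: "continuous_on UNIV k" "\<And>w. k w \<ge> 0" "\<And>w. e \<le> norm w \<Longrightarrow> k w = 0" "integral\<^sup>L lborel k = 1" "\<And>w. k (- w) = k w"
    and AB: "A \<in> sets borel" "B \<in> sets borel" "\<And>z w. z \<in> A \<Longrightarrow> norm (w - z) < e \<Longrightarrow> w \<in> B"
  shows "(\<integral>\<^sup>+z. indicator A z * ennreal ((norm (LINT w|lborel. k (w - z) *\<^sub>R h w))\<^sup>2) \<partial>lborel)
     \<le> (\<integral>\<^sup>+w. indicator B w * ennreal ((norm (h w))\<^sup>2) \<partial>lborel)"
proof -
  have [measurable]: "h \<in> borel_measurable borel" using h by (simp add: loc_square_integrable_def)
  note [measurable] = AB(1,2) borel_measurable_continuous_onI[OF k(1)]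
  have "(\<integral>\<^sup>+z. indicator A z * ennreal ((norm (LINT w|lborel. k (w - z) *\<^sub>R h w))\<^sup>2) \<partial>lborel)
    \<le> (\<integral>\<^sup>+z. indicator A z * (\<integral>\<^sup>+w. ennreal (k (w - z) * (norm (h w))\<^sup>2) \<partial>lborel) \<partial>lborel)"
    by (intro nn_integral_mono mult_left_mono convolution_square_le[OF h k(1-4)]) auto
  also have "\<dots> = (\<integral>\<^sup>+z. \<integral>\<^sup>+w. indicator A z * ennreal (k (w - z) * (norm (h w))\<^sup>2) \<partial>lborel \<partial>lborel)"
    by (intro nn_integral_cong nn_integral_cmult[symmetric]) measurable
  also have "\<dots> = (\<integral>\<^sup>+w. \<integral>\<^sup>+z. indicator A z * ennreal (k (w - z) * (norm (h w))\<^sup>2) \<partial>lborel \<partial>lborel)"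
    by (rule lborel_pair.Fubini'[symmetric]) measurable
  also have "\<dots> \<le> (\<integral>\<^sup>+w. \<integral>\<^sup>+z. (indicator B w * ennreal ((norm (h w))\<^sup>2)) * ennreal (k (w - z)) \<partial>lborel \<partial>lborel)"
  proof (intro nn_integral_mono)
    fix z w
    show "indicator A z * ennreal (k (w - z) * (norm (h w))\<^sup>2) \<le> (indicator B w * ennreal ((norm (h w))\<^sup>2)) * ennreal (k (w - z))"
    proof (cases "z \<in> A \<and> norm (w - z) < e")
      case True
      then show ?thesis using AB(3)[of z w] k(2) by (simp add: ennreal_mult mult.commute)
    next
      case False
      then show ?thesis using k(3)[of "w - z"] by (auto simp: indicator_def not_less)
    qed
  qed
  also have "\<dots> = (\<integral>\<^sup>+w. (indicator B w * ennreal ((norm (h w))\<^sup>2)) * (\<integral>\<^sup>+z. ennreal (k (w - z)) \<partial>lborel) \<partial>lborel)"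
    by (intro nn_integral_cong nn_integral_cmult) measurable
  also have "\<dots> = (\<integral>\<^sup>+w. indicator B w * ennreal ((norm (h w))\<^sup>2) \<partial>lborel)"
  proof -
    have "(\<integral>\<^sup>+z. ennreal (k (w - z)) \<partial>lborel) = 1" for w
    proof -
      have i0: "integrable lborel (\<lambda>z. k (z - w))"
        using integrable_lborel_shift[OF continuous_compact_support_integrable[OF k(1,3)], where w = "-w"] by simp
      have "k (w - z) = k (z - w)" for z using k(5)[of "z - w"] by simp
      then have "(\<integral>\<^sup>+z. ennreal (k (w - z)) \<partial>lborel) = (\<integral>\<^sup>+z. ennreal (k (z - w)) \<partial>lborel)" by simp
      also have "\<dots> = ennreal (LINT z|lborel. k (z - w))" by (rule nn_integral_eq_integral[OF i0]) (use k(2) in simp)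
      finally show ?thesis using kernel_integral_eq_1[OF k(4)] by simp
    qed
    then show ?thesis by simp
  qed
  finally show ?thesis .
qed

text \<open>Truncating values by the nearest-point projection \<open>T\<close> onto a disc reduces
  to bounded functions. Measurability supplies continuous \<open>g n\<close> converging to
  \<open>p\<close> almost everywhere; truncating them by the same continuous projection makes
  dominated convergence applicable.\<close>

lemma continuous_dense_L2:
  assumes p: "loc_square_integrable p" and e: "e > 0"
  shows "\<exists>c. continuous_on UNIV c \<and> (\<integral>\<^sup>+z. indicator (csq R) z * ennreal ((norm (p z - c z))\<^sup>2) \<partial>lborel) \<le> ennreal e"
proof -
  let ?M = "restrict_space lborel (csq R)"
  have pm[measurable]: "p \<in> borel_measurable borel" and pi: "integrable lborel (\<lambda>w. indicator (csq R) w * (norm (p w))\<^sup>2)"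
    using p by (auto simp: loc_square_integrable_def)
  have restr: "(\<integral>\<^sup>+z. indicator (csq R) z * ennreal (g z) \<partial>lborel) = (\<integral>\<^sup>+z. ennreal (g z) \<partial>?M)" for g
    by (subst nn_integral_restrict_space) (auto simp: mult.commute)
  have fin: "finite_measure ?M"
    by (rule finite_measureI) (use emeasure_compact_finite[OF compact_csq[of R]] in \<open>auto simp: emeasure_restrict_space\<close>)
  have pi': "integrable ?M (\<lambda>w. (norm (p w))\<^sup>2)" using pi by (simp add: integrable_restrict_space)
  have pmM[measurable]: "p \<in> borel_measurable ?M" by (rule measurable_restrict_space1) simp
  define T where "T n = closest_point (cball (0::complex) (real n))" for n
  have cT: "continuous_on UNIV (T n)" for n unfolding T_def by (rule continuous_on_closest_point) auto
  have Tn: "norm (T n w) \<le> real n" for n w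
    using closest_point_in_set[of "cball (0::complex) (real n)" w] unfolding T_def by simp
  have Tle: "norm (w - T n w) \<le> norm w" for n w
    using closest_point_le[of "cball (0::complex) (real n)" 0 w] unfolding T_def by (simp add: dist_norm)
  have Tself: "T n w = w" if "norm w \<le> real n" for n w
    unfolding T_def using that by (intro closest_point_self) simp
  have [measurable]: "T n \<in> borel_measurable borel" for n by (rule borel_measurable_continuous_onI[OF cT])
  have "(\<lambda>n. LINT z|?M. (norm (p z - T n (p z)))\<^sup>2) \<longlonglongrightarrow> (LINT z|?M. 0)"
  proof (rule integral_dominated_convergence[OF _ _ pi'])
    show "AE z in ?M. (\<lambda>n. (norm (p z - T n (p z)))\<^sup>2) \<longlonglongrightarrow> 0"
    proof (rule AE_I2)
      fix z
      obtain N :: nat where N: "norm (p z) \<le> real N" using real_arch_simple by blast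
      have "eventually (\<lambda>n. (norm (p z - T n (p z)))\<^sup>2 = 0) sequentially"
        using eventually_ge_at_top[of N] by eventually_elim (use N Tself in auto)
      then show "(\<lambda>n. (norm (p z - T n (p z)))\<^sup>2) \<longlonglongrightarrow> 0" by (rule tendsto_eventually)
    qed
    show "AE z in ?M. norm ((norm (p z - T n (p z)))\<^sup>2) \<le> (norm (p z))\<^sup>2" for n
      using Tle by (auto intro!: power_mono)
    show "(\<lambda>z. (norm (p z - T n (p z)))\<^sup>2) \<in> borel_measurable ?M" for n
      by (rule measurable_restrict_space1) measurable
  qed simp
  \<comment> \<open>Two errors below \<open>e / 4\<close>, doubled by (a + b)^2 \<le> 2 a^2 + 2 b^2,
    add up to at most \<open>e\<close>.\<close>
  then have "eventually (\<lambda>n. (LINT z|?M. (norm (p z - T n (p z)))\<^sup>2) < e / 4) sequentially"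
    using e by (intro order_tendstoD(2)[of _ 0]) auto
  then obtain m where m: "(LINT z|?M. (norm (p z - T m (p z)))\<^sup>2) < e / 4" by (auto simp: eventually_sequentially)
  have "p \<in> borel_measurable lebesgue" using pm by (simp add: measurable_completion)
  then have "p measurable_on UNIV" by (rule lebesgue_measurable_imp_measurable_on) auto
  then obtain N g where g: "negligible N" "\<And>n::nat. continuous_on UNIV (g n)" "\<And>x. x \<notin> N \<Longrightarrow> (\<lambda>n. g n x) \<longlonglongrightarrow> p x"
    unfolding measurable_on_def by auto
  have AEg: "AE z in lborel. (\<lambda>n. g n z) \<longlonglongrightarrow> p z"
  proof -
    have "AE z in lebesgue. (\<lambda>n. g n z) \<longlonglongrightarrow> p z"
      using g(1,3) by (intro AE_I'[of N]) (auto simp: negligible_iff_null_sets)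
    then show ?thesis by (simp add: AE_completion_iff)
  qed
  have cTg: "continuous_on UNIV (\<lambda>z. T m (g n z))" for n
    by (rule continuous_on_compose2[OF cT g(2)]) auto
  have [measurable]: "(\<lambda>z. T m (g n z)) \<in> borel_measurable borel" for n by (rule borel_measurable_continuous_onI[OF cTg])
  have bnd: "norm ((norm (T m (p z) - T m (g n z)))\<^sup>2) \<le> (2 * real m)\<^sup>2" for z n
  proof -
    have "norm (T m (p z) - T m (g n z)) \<le> 2 * real m"
      using norm_triangle_ineq4[of "T m (p z)" "T m (g n z)"] Tn[of m "p z"] Tn[of m "g n z"] by linarith
    from power_mono[OF this norm_ge_zero, of 2] show ?thesis by simp
  qed
  have "(\<lambda>n. LINT z|?M. (norm (T m (p z) - T m (g n z)))\<^sup>2) \<longlonglongrightarrow> (LINT z|?M. 0)"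
  proof (rule integral_dominated_convergence)
    show "integrable ?M (\<lambda>_. (2 * real m)\<^sup>2)" by (rule finite_measure.integrable_const[OF fin])
    have "AE z in lborel. z \<in> csq R \<longrightarrow> (\<lambda>n. (norm (T m (p z) - T m (g n z)))\<^sup>2) \<longlonglongrightarrow> 0"
      using AEg
    proof eventually_elim
      case (elim z)
      have "isCont (T m) (p z)" using cT by (simp add: continuous_on_eq_continuous_at)
      then have "(\<lambda>n. T m (g n z)) \<longlonglongrightarrow> T m (p z)" using elim isCont_tendsto_compose by blast
      then have "(\<lambda>n. (norm (T m (p z) - T m (g n z)))\<^sup>2) \<longlonglongrightarrow> (norm (T m (p z) - T m (p z)))\<^sup>2"
        by (intro tendsto_intros)
      then show ?case by simp
    qed
    then show "AE z in ?M. (\<lambda>n. (norm (T m (p z) - T m (g n z)))\<^sup>2) \<longlonglongrightarrow> 0" by (simp add: AE_restrict_space_iff)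
    show "(\<lambda>z. (norm (T m (p z) - T m (g n z)))\<^sup>2) \<in> borel_measurable ?M" for n
      by (rule measurable_restrict_space1) measurable
  qed (use bnd in auto)
  then have "eventually (\<lambda>n. (LINT z|?M. (norm (T m (p z) - T m (g n z)))\<^sup>2) < e / 4) sequentially"
    using e by (intro order_tendstoD(2)[of _ 0]) auto
  then obtain n where n: "(LINT z|?M. (norm (T m (p z) - T m (g n z)))\<^sup>2) < e / 4" by (auto simp: eventually_sequentially)
  have i1: "integrable ?M (\<lambda>z. (norm (p z - T m (p z)))\<^sup>2)"
  proof (rule Bochner_Integration.integrable_bound[OF pi'])
    show "(\<lambda>z. (norm (p z - T m (p z)))\<^sup>2) \<in> borel_measurable ?M" by (rule measurable_restrict_space1) measurable
  qed (use Tle in \<open>auto intro!: power_mono\<close>)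
  have i2: "integrable ?M (\<lambda>z. (norm (T m (p z) - T m (g n z)))\<^sup>2)"
  proof (rule finite_measure.integrable_const_bound[OF fin])
    show "(\<lambda>z. (norm (T m (p z) - T m (g n z)))\<^sup>2) \<in> borel_measurable ?M" by (rule measurable_restrict_space1) measurable
  qed (use bnd in auto)
  have "(\<integral>\<^sup>+z. indicator (csq R) z * ennreal ((norm (p z - T m (g n z)))\<^sup>2) \<partial>lborel) = (\<integral>\<^sup>+z. ennreal ((norm (p z - T m (g n z)))\<^sup>2) \<partial>?M)"
    by (rule restr)
  also have "\<dots> \<le> (\<integral>\<^sup>+z. ennreal (2 * (norm (p z - T m (p z)))\<^sup>2 + 2 * (norm (T m (p z) - T m (g n z)))\<^sup>2) \<partial>?M)"
  proof (intro nn_integral_mono ennreal_leI)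
    fix z
    have "norm (p z - T m (g n z)) \<le> norm (p z - T m (p z)) + norm (T m (p z) - T m (g n z))"
      using norm_triangle_ineq[of "p z - T m (p z)" "T m (p z) - T m (g n z)"] by simp
    then have "(norm (p z - T m (g n z)))\<^sup>2 \<le> (norm (p z - T m (p z)) + norm (T m (p z) - T m (g n z)))\<^sup>2" by (rule power_mono) simp
    also have "\<dots> \<le> 2 * (norm (p z - T m (p z)))\<^sup>2 + 2 * (norm (T m (p z) - T m (g n z)))\<^sup>2"
      using sum_squares_bound[of "norm (p z - T m (p z))" "norm (T m (p z) - T m (g n z))"] by (simp add: power2_sum)
    finally show "(norm (p z - T m (g n z)))\<^sup>2 \<le> 2 * (norm (p z - T m (p z)))\<^sup>2 + 2 * (norm (T m (p z) - T m (g n z)))\<^sup>2" .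
  qed
  also have "\<dots> = ennreal (LINT z|?M. 2 * (norm (p z - T m (p z)))\<^sup>2 + 2 * (norm (T m (p z) - T m (g n z)))\<^sup>2)"
    by (rule nn_integral_eq_integral) (use i1 i2 in auto)
  also have "\<dots> \<le> ennreal e" using i1 i2 m n by (intro ennreal_leI) simp
  finally show ?thesis using cTg by blast
qed

text \<open>With a continuous \<open>c\<close> close to \<open>p\<close> in L2, the error splits
  into the convolution of \<open>p - c\<close>, the convolution error of \<open>c\<close>, and
  \<open>p - c\<close>. The first is controlled by \<open>convolution_L2_le\<close> on the square
  enlarged by 1, the second by uniform continuity of \<open>c\<close>.\<close>

lemma convolution_L2_tendsto:
  fixes k :: "nat \<Rightarrow> complex \<Rightarrow> real"
  assumes p: "loc_square_integrable p" and k: "\<And>n. continuous_on UNIV (k n)" "\<And>n w. k n w \<ge> 0" "\<And>n w. 1 / real (Suc n) \<le> norm w \<Longrightarrow> k n w = 0"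
     "\<And>n. integral\<^sup>L lborel (k n) = 1" "\<And>n w. k n (- w) = k n w"
    and e: "e > 0"
  shows "eventually (\<lambda>n. (\<integral>\<^sup>+z. indicator (csq R) z * ennreal ((norm ((LINT w|lborel. k n (w - z) *\<^sub>R p w) - p z))\<^sup>2) \<partial>lborel) \<le> ennreal e) sequentially"
proof -
  \<comment> \<open>Three terms, each contributing at most \<open>d\<close> after integration, times
    the factor 3 from (a + b + f)^2 \<le> 3 (a^2 + b^2 + f^2).\<close>
  define d where "d = e / 9"
  have d: "d > 0" using e by (simp add: d_def)
  obtain c where c: "continuous_on UNIV c" and pc: "(\<integral>\<^sup>+z. indicator (csq (R + 1)) z * ennreal ((norm (p z - c z))\<^sup>2) \<partial>lborel) \<le> ennreal d"
    using continuous_dense_L2[OF p d] by blast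
  have lc: "loc_square_integrable c" by (rule continuous_imp_loc_square_integrable[OF c])
  have lr: "loc_square_integrable (\<lambda>w. p w - c w)" by (rule loc_square_integrable_diff[OF p lc])
  define V where "V = 4 * R\<^sup>2 + 1"
  have V: "V > 0" "emeasure lborel (csq R) \<le> ennreal V"
  proof -
    show "V > 0" by (simp add: V_def add_nonneg_pos)
    show "emeasure lborel (csq R) \<le> ennreal V"
    proof (cases "R \<ge> 0")
      case True then show ?thesis using measure_csq_le(1)[OF True] order_trans[OF _ ennreal_leI[of "4 * R\<^sup>2" V]] by (simp add: V_def)
    next
      case False
      then have "z \<notin> csq R" for z using supn_bounds(3)[of z] by (simp add: csq_def)
      then have "csq R = {}" by blast
      then show ?thesis by simp
    qed
  qed
  define s where "s = sqrt (d / V)"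
  have s: "s > 0" "s\<^sup>2 = d / V" using d V by (simp_all add: s_def)
  have "uniformly_continuous_on (csq (R + 1)) c"
    by (intro compact_uniformly_continuous continuous_on_subset[OF c] compact_csq) auto
  then obtain r where r: "r > 0" "\<And>x y. x \<in> csq (R + 1) \<Longrightarrow> y \<in> csq (R + 1) \<Longrightarrow> dist y x < r \<Longrightarrow> dist (c y) (c x) < s"
    using s unfolding uniformly_continuous_on_def by metis
  obtain m :: nat where m: "1 / r < real m" using reals_Archimedean2 by blast
  have near: "w \<in> csq (R + 1)" if "z \<in> csq R" "norm (w - z) < 1 / real (Suc n)" for z w n
  proof -
    have "1 / real (Suc n) \<le> 1" by simp
    then have "supn (w - z) \<le> 1" using supn_bounds(1)[of "w - z"] that by linarith
    then show ?thesis using supn_triangle[of "w - z" z] that by (simp add: csq_def)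
  qed
  have split3: "ennreal (3 * x + (y + 3 * w)) = ennreal 3 * ennreal x + (ennreal y + ennreal 3 * ennreal w)" if "x \<ge> 0" "y \<ge> 0" "w \<ge> 0" for x y w
    using that by (simp add: ennreal_mult')
  show ?thesis
  proof (rule eventually_mono[OF eventually_ge_at_top[of m]])
    fix n assume "n \<ge> m"
    then have "1 / r < real (Suc n)" using m by linarith
    then have er: "1 / real (Suc n) < r" using r by (simp add: field_simps)
    note kn = k(1-4)[of n]
    let ?C = "\<lambda>h z. LINT w|lborel. k n (w - z) *\<^sub>R h w"
    have int: "integrable lborel (\<lambda>w. k n (w - z) *\<^sub>R h w)" if "loc_square_integrable h" for h z
      using integrable_kernel_mult[OF loc_square_integrableD(1)[OF that] kn(1,3)] by blast
    have [measurable]: "p \<in> borel_measurable borel" "c \<in> borel_measurable borel"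
      using p lc by (auto simp: loc_square_integrable_def)
    have [measurable]: "?C h \<in> borel_measurable borel" if "loc_square_integrable h" for h
      by (intro borel_measurable_continuous_onI continuous_on_convolution[OF loc_square_integrableD(1)[OF that] kn(1,3)]) auto
    note [measurable] = this[OF lr]
    have pt: "indicator (csq R) z * ennreal ((norm (?C p z - p z))\<^sup>2) \<le>
       ennreal 3 * (indicator (csq R) z * ennreal ((norm (?C (\<lambda>w. p w - c w) z))\<^sup>2)) + (ennreal (3 * s\<^sup>2) * indicator (csq R) z + ennreal 3 * (indicator (csq (R + 1)) z * ennreal ((norm (p z - c z))\<^sup>2)))" for z
    proof (cases "z \<in> csq R")
      case True
      have z1: "z \<in> csq (R + 1)" using True by (simp add: csq_def)
      have cz: "norm (?C c z - c z) \<le> s"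
      proof (rule norm_convolution_diff_le[OF loc_square_integrableD(1)[OF lc] kn])
        fix w assume "dist w z < 1 / real (Suc n)"
        then show "norm (c w - c z) \<le> s"
          using r(2)[OF z1 near[OF True, of w n]] er by (simp add: dist_norm less_imp_le)
      qed
      have split: "?C p z - p z = ?C (\<lambda>w. p w - c w) z + (?C c z - c z) - (p z - c z)"
        using int[OF p] int[OF lc] by (simp add: scaleR_diff_right Bochner_Integration.integral_diff)
      have tri: "norm (x + y - w) \<le> norm x + norm y + norm w" for x y w :: complex
        using norm_triangle_ineq4[of "x + y" w] norm_triangle_ineq[of x y] by linarith
      have "norm (?C p z - p z) \<le> norm (?C (\<lambda>w. p w - c w) z) + norm (?C c z - c z) + norm (p z - c z)"
        unfolding split by (rule tri)
      also have "\<dots> \<le> norm (?C (\<lambda>w. p w - c w) z) + s + norm (p z - c z)" using cz by simp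
      finally have "(norm (?C p z - p z))\<^sup>2 \<le> (norm (?C (\<lambda>w. p w - c w) z) + s + norm (p z - c z))\<^sup>2" by (rule power_mono) simp
      also have "\<dots> \<le> 3 * (norm (?C (\<lambda>w. p w - c w) z))\<^sup>2 + (3 * s\<^sup>2 + 3 * (norm (p z - c z))\<^sup>2)"
      proof -
        have "(a + b + f)\<^sup>2 \<le> 3 * a\<^sup>2 + (3 * b\<^sup>2 + 3 * f\<^sup>2)" for a b f :: real
          using sum_squares_bound[of a b] sum_squares_bound[of a f] sum_squares_bound[of b f] by (simp add: power2_eq_square algebra_simps)
        then show ?thesis .
      qed
      finally have "ennreal ((norm (?C p z - p z))\<^sup>2) \<le> ennreal (3 * (norm (?C (\<lambda>w. p w - c w) z))\<^sup>2 + (3 * s\<^sup>2 + 3 * (norm (p z - c z))\<^sup>2))"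
        by (rule ennreal_leI)
      also have "\<dots> = ennreal 3 * ennreal ((norm (?C (\<lambda>w. p w - c w) z))\<^sup>2) + (ennreal (3 * s\<^sup>2) + ennreal 3 * ennreal ((norm (p z - c z))\<^sup>2))"
        by (rule split3) auto
      finally show ?thesis using True z1 by simp
    qed simp
    have "(\<integral>\<^sup>+z. indicator (csq R) z * ennreal ((norm (?C p z - p z))\<^sup>2) \<partial>lborel)
      \<le> (\<integral>\<^sup>+z. ennreal 3 * (indicator (csq R) z * ennreal ((norm (?C (\<lambda>w. p w - c w) z))\<^sup>2)) + (ennreal (3 * s\<^sup>2) * indicator (csq R) z + ennreal 3 * (indicator (csq (R + 1)) z * ennreal ((norm (p z - c z))\<^sup>2))) \<partial>lborel)"
      by (rule nn_integral_mono) (rule pt)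
    also have "\<dots> = ennreal 3 * (\<integral>\<^sup>+z. indicator (csq R) z * ennreal ((norm (?C (\<lambda>w. p w - c w) z))\<^sup>2) \<partial>lborel) + (ennreal (3 * s\<^sup>2) * emeasure lborel (csq R) + ennreal 3 * (\<integral>\<^sup>+z. indicator (csq (R + 1)) z * ennreal ((norm (p z - c z))\<^sup>2) \<partial>lborel))"
      by (simp add: nn_integral_add nn_integral_cmult nn_integral_cmult_indicator)
    also have "\<dots> \<le> ennreal 3 * ennreal d + (ennreal (3 * s\<^sup>2) * ennreal V + ennreal 3 * ennreal d)"
    proof (intro add_mono mult_left_mono V(2) pc)
      show "(\<integral>\<^sup>+z. indicator (csq R) z * ennreal ((norm (?C (\<lambda>w. p w - c w) z))\<^sup>2) \<partial>lborel) \<le> ennreal d"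
        by (rule order_trans[OF convolution_L2_le[OF lr kn k(5) _ _ near] pc]) auto
    qed auto
    also have "\<dots> = ennreal (3 * d + (3 * s\<^sup>2 * V + 3 * d))"
      by (subst split3) (use d V in \<open>auto simp: ennreal_mult\<close>)
    also have "3 * d + (3 * s\<^sup>2 * V + 3 * d) = e" using V unfolding s(2) d_def by simp
    finally show "(\<integral>\<^sup>+z. indicator (csq R) z * ennreal ((norm (?C p z - p z))\<^sup>2) \<partial>lborel) \<le> ennreal e" .
  qed
qed

text \<open>Testing the weak derivative with the translated kernel itself gives the classical
  partials of the mollified \<open>f\<close>; the sign from the argument \<open>w - z\<close>
  matches the one in the definition of a weak derivative. The last conclusion, that constant
  increments are inherited, serves to identify the weak derivatives of an additive map.\<close>

lemma weak_derivative_mollification: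
  assumes f: "continuous_on UNIV f" and p: "loc_square_integrable p" and q: "loc_square_integrable q"
    and weakp: "\<And>\<phi>. test_function \<phi> \<Longrightarrow> (LINT z|lborel. frechet_derivative \<phi> (at z) 1 *\<^sub>R f z) = - (LINT z|lborel. \<phi> z *\<^sub>R p z)"
    and weakq: "\<And>\<phi>. test_function \<phi> \<Longrightarrow> (LINT z|lborel. frechet_derivative \<phi> (at z) \<i> *\<^sub>R f z) = - (LINT z|lborel. \<phi> z *\<^sub>R q z)"
  obtains U P Q :: "nat \<Rightarrow> complex \<Rightarrow> complex" where "\<And>n. C1on UNIV (U n) (P n) (Q n)" "\<And>R. uniform_limit (csq R) U f sequentially"
    "\<And>R e. e > 0 \<Longrightarrow> eventually (\<lambda>n. (\<integral>\<^sup>+z. indicator (csq R) z * ennreal ((norm (P n z - p z))\<^sup>2) \<partial>lborel) \<le> ennreal e) sequentially"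
    "\<And>R e. e > 0 \<Longrightarrow> eventually (\<lambda>n. (\<integral>\<^sup>+z. indicator (csq R) z * ennreal ((norm (Q n z - q z))\<^sup>2) \<partial>lborel) \<le> ennreal e) sequentially"
    "\<And>n z h c. \<forall>w. f (w + h) - f w = c \<Longrightarrow> U n (z + h) - U n z = c"
proof -
  have "\<forall>n. \<exists>k kx ky :: complex \<Rightarrow> real.
    (\<forall>z. test_function (\<lambda>w. k (w - z))) \<and> (\<forall>w. k w \<ge> 0) \<and>
    (\<forall>w. 1 / real (Suc n) \<le> norm w \<longrightarrow> k w = 0 \<and> kx w = 0 \<and> ky w = 0) \<and> integral\<^sup>L lborel k = 1 \<and> (\<forall>w. k (- w) = k w) \<and>
    (\<forall>w. (k has_derivative (\<lambda>h. Re h * kx w + Im h * ky w)) (at w)) \<and> continuous_on UNIV kx \<and> continuous_on UNIV ky"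
  proof
    fix n :: nat
    have "1 / real (Suc n) > 0" by simp
    then show "\<exists>k kx ky :: complex \<Rightarrow> real.
    (\<forall>z. test_function (\<lambda>w. k (w - z))) \<and> (\<forall>w. k w \<ge> 0) \<and>
    (\<forall>w. 1 / real (Suc n) \<le> norm w \<longrightarrow> k w = 0 \<and> kx w = 0 \<and> ky w = 0) \<and> integral\<^sup>L lborel k = 1 \<and> (\<forall>w. k (- w) = k w) \<and>
    (\<forall>w. (k has_derivative (\<lambda>h. Re h * kx w + Im h * ky w)) (at w)) \<and> continuous_on UNIV kx \<and> continuous_on UNIV ky"
      by (rule mollifier_exists) blast
  qed
  then obtain k kx ky :: "nat \<Rightarrow> complex \<Rightarrow> real" where
    "\<forall>n. (\<forall>z. test_function (\<lambda>w. k n (w - z))) \<and> (\<forall>w. k n w \<ge> 0) \<and>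
    (\<forall>w. 1 / real (Suc n) \<le> norm w \<longrightarrow> k n w = 0 \<and> kx n w = 0 \<and> ky n w = 0) \<and> integral\<^sup>L lborel (k n) = 1 \<and> (\<forall>w. k n (- w) = k n w) \<and>
    (\<forall>w. (k n has_derivative (\<lambda>h. Re h * kx n w + Im h * ky n w)) (at w)) \<and> continuous_on UNIV (kx n) \<and> continuous_on UNIV (ky n)"
    unfolding choice_iff by blast
  then have k: "\<And>n z. test_function (\<lambda>w. k n (w - z))" "\<And>n w. k n w \<ge> 0"
    "\<And>n w. 1 / real (Suc n) \<le> norm w \<Longrightarrow> k n w = 0 \<and> kx n w = 0 \<and> ky n w = 0" "\<And>n. integral\<^sup>L lborel (k n) = 1" "\<And>n w. k n (- w) = k n w"
    "\<And>n w. (k n has_derivative (\<lambda>h. Re h * kx n w + Im h * ky n w)) (at w)" "\<And>n. continuous_on UNIV (kx n)" "\<And>n. continuous_on UNIV (ky n)"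
    by blast+
  have ck: "continuous_on UNIV (k n)" for n using k(6) by (auto simp: continuous_on_eq_continuous_at intro: has_derivative_continuous)
  have k0: "k n w = 0" if "1 / real (Suc n) \<le> norm w" for n w using k(3)[OF that] by simp
  have lf: "loc_square_integrable f" by (rule continuous_imp_loc_square_integrable[OF f])
  note lf' = loc_square_integrableD(1)[OF lf]
  define U where "U n z = (LINT w|lborel. k n (w - z) *\<^sub>R f w)" for n z
  define P where "P n z = (LINT w|lborel. k n (w - z) *\<^sub>R p w)" for n z
  define Q where "Q n z = (LINT w|lborel. k n (w - z) *\<^sub>R q w)" for n z
  have fr: "frechet_derivative (\<lambda>w. k n (w - z)) (at w) = (\<lambda>h. Re h * kx n (w - z) + Im h * ky n (w - z))" for n z w
  proof -
    have "((\<lambda>w. w - z) has_derivative (\<lambda>h. h)) (at w)" by (auto intro!: derivative_eq_intros)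
    from has_derivative_compose[OF this k(6)[of n "w - z"]] show ?thesis by (rule frechet_derivative_at[symmetric])
  qed
  have PQ: "P n z = - (LINT w|lborel. kx n (w - z) *\<^sub>R f w)" "Q n z = - (LINT w|lborel. ky n (w - z) *\<^sub>R f w)" for n z
    using weakp[OF k(1), of n z] weakq[OF k(1), of n z] by (simp_all add: fr P_def Q_def)
  show thesis
  proof (rule that[of U P Q])
    show "C1on UNIV (U n) (P n) (Q n)" for n
      unfolding U_def[abs_def] PQ[abs_def]
      by (rule C1on_convolution[where e = "1 / real (Suc n)", OF lf' _ _ k(6,7,8)]) (simp, rule k(3))
    show "uniform_limit (csq R) U f sequentially" for R
      unfolding uniform_limit_iff
    proof (intro allI impI)
      fix s :: real assume s: "s > 0"
      have "uniformly_continuous_on (csq (R + 1)) f"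
        by (intro compact_uniformly_continuous continuous_on_subset[OF f] compact_csq) auto
      then obtain r where r: "r > 0" "\<And>x y. x \<in> csq (R + 1) \<Longrightarrow> y \<in> csq (R + 1) \<Longrightarrow> dist y x < r \<Longrightarrow> dist (f y) (f x) < s / 2"
        using s unfolding uniformly_continuous_on_def by (metis half_gt_zero)
      obtain m :: nat where m: "1 / r < real m" using reals_Archimedean2 by blast
      show "eventually (\<lambda>n. \<forall>z\<in>csq R. dist (U n z) (f z) < s) sequentially"
      proof (rule eventually_mono[OF eventually_ge_at_top[of m]], intro ballI)
        fix n z assume "n \<ge> m" and z: "z \<in> csq R"
        then have "1 / r < real (Suc n)" using m by linarith
        then have er: "1 / real (Suc n) < r" using r by (simp add: field_simps)
        have "norm (U n z - f z) \<le> s / 2" unfolding U_def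
        proof (rule norm_convolution_diff_le[OF lf' ck k(2) k0 k(4)])
          fix w assume w: "dist w z < 1 / real (Suc n)"
          have "1 / real (Suc n) \<le> 1" by simp
          then have "supn (w - z) \<le> 1" using supn_bounds(1)[of "w - z"] w unfolding dist_norm by linarith
          then have "w \<in> csq (R + 1)" using supn_triangle[of "w - z" z] z by (simp add: csq_def)
          moreover have "z \<in> csq (R + 1)" using z by (simp add: csq_def)
          ultimately show "norm (f w - f z) \<le> s / 2" using r(2)[of z w] w er by (simp add: dist_norm less_imp_le)
        qed
        then show "dist (U n z) (f z) < s" using s by (simp add: dist_norm)
      qed
    qed
    show "eventually (\<lambda>n. (\<integral>\<^sup>+z. indicator (csq R) z * ennreal ((norm (P n z - p z))\<^sup>2) \<partial>lborel) \<le> ennreal e) sequentially" if "e > 0" for R e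
      unfolding P_def by (rule convolution_L2_tendsto[OF p ck k(2) k0 k(4,5) that])
    show "eventually (\<lambda>n. (\<integral>\<^sup>+z. indicator (csq R) z * ennreal ((norm (Q n z - q z))\<^sup>2) \<partial>lborel) \<le> ennreal e) sequentially" if "e > 0" for R e
      unfolding Q_def by (rule convolution_L2_tendsto[OF q ck k(2) k0 k(4,5) that])
    show "U n (z + h) - U n z = c" if h: "\<forall>w. f (w + h) - f w = c" for n z h c
    proof -
      have fm: "f \<in> borel_measurable borel" "k n \<in> borel_measurable borel" using f ck by (auto intro: borel_measurable_continuous_onI)
      have ih: "integrable lborel (\<lambda>w. k n (w - z) *\<^sub>R f w)"
        by (rule integrable_kernel_mult[OF lf' ck k0])
      have "U n (z + h) = (LINT w|lborel. k n ((w + h) - (z + h)) *\<^sub>R f (w + h))"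
        unfolding U_def using integral_lborel_shift[of "\<lambda>w. k n (w - (z + h)) *\<^sub>R f w" h] fm by simp
      also have "\<dots> = (LINT w|lborel. k n (w - z) *\<^sub>R f (w + h))" by simp
      also have "\<dots> = (LINT w|lborel. k n (w - z) *\<^sub>R f w + k n (w - z) *\<^sub>R c)"
      proof (rule Bochner_Integration.integral_cong[OF refl])
        fix w show "k n (w - z) *\<^sub>R f (w + h) = k n (w - z) *\<^sub>R f w + k n (w - z) *\<^sub>R c"
          using h[rule_format, of w] by (metis add.commute diff_add_cancel scaleR_add_right)
      qed
      also have "\<dots> = U n z + (LINT w|lborel. k n (w - z) *\<^sub>R c)"
      proof -
        have "integrable lborel (\<lambda>w. k n (w - z) *\<^sub>R c)"
          using integrable_lborel_shift[OF continuous_compact_support_integrable[OF ck k0], where w = "-z"] by simp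
        then show ?thesis using ih by (simp add: U_def)
      qed
      also have "(LINT w|lborel. k n (w - z) *\<^sub>R c) = c"
      proof -
        have "integrable lborel (\<lambda>w. k n (w - z))"
          using integrable_lborel_shift[OF continuous_compact_support_integrable[OF ck k0], where w = "-z"] by simp
        then have "(LINT w|lborel. k n (w - z) *\<^sub>R c) = (LINT w|lborel. k n (w - z)) *\<^sub>R c"
          by (intro integral_scaleR_left)
        then show ?thesis using kernel_integral_eq_1[OF k(4) fm(2)] by simp
      qed
      finally show ?thesis by simp
    qed
  qed
qed

text \<open>The Riesz-Fischer argument. Along a subsequence whose squared L2 errors are at most
  2^-i, the squared errors have an integrable sum \<open>s\<close>. Finiteness of \<open>s\<close>
  gives almost everywhere convergence, and |p| + |q| + sqrt s is a square integrable
  majorant.\<close>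

lemma sob_of_L2_limit:
  fixes U P Q :: "nat \<Rightarrow> complex \<Rightarrow> complex"
  assumes C: "\<And>n. C1on UNIV (U n) (P n) (Q n)" and f: "continuous_on UNIV f" "\<And>R. uniform_limit (csq R) U f sequentially"
    and p: "loc_square_integrable p" "\<And>R e. e > 0 \<Longrightarrow> eventually (\<lambda>n. (\<integral>\<^sup>+z. indicator (csq R) z * ennreal ((norm (P n z - p z))\<^sup>2) \<partial>lborel) \<le> ennreal e) sequentially"
    and q: "loc_square_integrable q" "\<And>R e. e > 0 \<Longrightarrow> eventually (\<lambda>n. (\<integral>\<^sup>+z. indicator (csq R) z * ennreal ((norm (Q n z - q z))\<^sup>2) \<partial>lborel) \<le> ennreal e) sequentially"
  shows "sob (sq R) f p q"
proof -
  let ?M = "lborel_on (sq R)"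
  have [measurable]: "p \<in> borel_measurable borel" "q \<in> borel_measurable borel"
    using p(1) q(1) by (auto simp: loc_square_integrable_def)
  have cPQ: "continuous_on UNIV (P n)" "continuous_on UNIV (Q n)" for n using C[of n] by (auto simp: C1on_def)
  have [measurable]: "P n \<in> borel_measurable borel" "Q n \<in> borel_measurable borel" for n
    using cPQ by (auto intro: borel_measurable_continuous_onI)
  define D where "D n z = (norm (P n z - p z))\<^sup>2 + (norm (Q n z - q z))\<^sup>2" for n z
  have Dm[measurable]: "D n \<in> borel_measurable ?M" for n
    by (rule measurable_restrict_space1) (unfold D_def, measurable)
  have npq[measurable]: "(\<lambda>z. norm (p z)) \<in> borel_measurable ?M" "(\<lambda>z. norm (q z)) \<in> borel_measurable ?M"
    by (rule measurable_restrict_space1, measurable)+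
  have ev: "eventually (\<lambda>n. (\<integral>\<^sup>+z. ennreal (D n z) \<partial>?M) \<le> ennreal e) sequentially" if "e > 0" for e
  proof -
    have e2: "e / 2 > 0" using that by simp
    show ?thesis using p(2)[OF e2, of R] q(2)[OF e2, of R]
    proof eventually_elim
      case (elim n)
      have "(\<integral>\<^sup>+z. ennreal (D n z) \<partial>?M) = (\<integral>\<^sup>+z. ennreal (D n z) * indicator (sq R) z \<partial>lborel)"
        by (rule nn_integral_restrict_space) simp
      also have "\<dots> \<le> (\<integral>\<^sup>+z. indicator (csq R) z * ennreal ((norm (P n z - p z))\<^sup>2) + indicator (csq R) z * ennreal ((norm (Q n z - q z))\<^sup>2) \<partial>lborel)"
        using sq_subset_csq[of R] by (intro nn_integral_mono) (auto simp: D_def indicator_def)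
      also have "\<dots> = (\<integral>\<^sup>+z. indicator (csq R) z * ennreal ((norm (P n z - p z))\<^sup>2) \<partial>lborel) + (\<integral>\<^sup>+z. indicator (csq R) z * ennreal ((norm (Q n z - q z))\<^sup>2) \<partial>lborel)"
        by (rule nn_integral_add) measurable
      also have "\<dots> \<le> ennreal (e / 2) + ennreal (e / 2)" by (rule add_mono[OF elim])
      also have "\<dots> = ennreal e" using that by (simp add: ennreal_plus[symmetric] del: ennreal_plus)
      finally show ?case .
    qed
  qed
  have "\<exists>m. \<forall>i. m i \<ge> i \<and> (\<integral>\<^sup>+z. ennreal (D (m i) z) \<partial>?M) \<le> ennreal ((1/2) ^ i)"
  proof (rule choice, rule allI)
    fix i :: nat
    have "eventually (\<lambda>n. n \<ge> i \<and> (\<integral>\<^sup>+z. ennreal (D n z) \<partial>?M) \<le> ennreal ((1/2) ^ i)) sequentially"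
      by (intro eventually_conj eventually_ge_at_top ev) simp
    then show "\<exists>n\<ge>i. (\<integral>\<^sup>+z. ennreal (D n z) \<partial>?M) \<le> ennreal ((1/2) ^ i)" by (auto simp: eventually_sequentially)
  qed
  then obtain m where m: "\<And>i. m i \<ge> i" "\<And>i. (\<integral>\<^sup>+z. ennreal (D (m i) z) \<partial>?M) \<le> ennreal ((1/2) ^ i)" by blast
  define s where "s z = (\<Sum>i. ennreal (D (m i) z))" for z
  have sm[measurable]: "s \<in> borel_measurable ?M" unfolding s_def by measurable
  have "(\<integral>\<^sup>+z. s z \<partial>?M) = (\<Sum>i. \<integral>\<^sup>+z. ennreal (D (m i) z) \<partial>?M)" unfolding s_def by (rule nn_integral_suminf) measurable
  also have "\<dots> \<le> (\<Sum>i. ennreal ((1/2) ^ i))" by (intro suminf_le m) auto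
  also have "\<dots> < \<infinity>"
    by (subst suminf_ennreal_eq[of _ 2]) (use geometric_sums[of "1/2::real"] in auto)
  finally have sfin: "(\<integral>\<^sup>+z. s z \<partial>?M) < \<infinity>" .
  then have sAE: "AE z in ?M. s z \<noteq> \<infinity>" by (intro nn_integral_PInf_AE sm) auto
  define h where "h z = 1 * ((norm (p z) + norm (q z)) + sqrt (enn2real (s z)))" for z
  have good: "(\<lambda>i. P (m i) z) \<longlonglongrightarrow> p z" "(\<lambda>i. Q (m i) z) \<longlonglongrightarrow> q z" "norm (P (m i) z) \<le> h z" "norm (Q (m i) z) \<le> h z"
    if "s z \<noteq> \<infinity>" for z i
  proof -
    have D0: "0 \<le> D n z" for n by (simp add: D_def)
    have "summable (\<lambda>i. D (m i) z)" using that D0 unfolding s_def by (intro summable_suminf_not_top) auto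
    then have D_lim: "(\<lambda>i. D (m i) z) \<longlonglongrightarrow> 0" by (rule summable_LIMSEQ_zero)
    have le: "norm (P n z - p z) \<le> sqrt (D n z)" "norm (Q n z - q z) \<le> sqrt (D n z)" for n
      by (auto intro!: real_le_rsqrt simp: D_def)
    have sq0: "(\<lambda>i. sqrt (D (m i) z)) \<longlonglongrightarrow> 0" using tendsto_real_sqrt[OF D_lim] by simp
    show "(\<lambda>i. P (m i) z) \<longlonglongrightarrow> p z"
      by (rule LIM_zero_cancel, rule Lim_null_comparison[OF _ sq0]) (use le in auto)
    show "(\<lambda>i. Q (m i) z) \<longlonglongrightarrow> q z"
      by (rule LIM_zero_cancel, rule Lim_null_comparison[OF _ sq0]) (use le in auto)
    have "ennreal (D (m i) z) \<le> s z"
      using sum_le_suminf[of "\<lambda>i. ennreal (D (m i) z)" "{i}"] by (simp add: s_def)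
    then have "D (m i) z \<le> enn2real (s z)" using that D0 enn2real_mono[of "ennreal (D (m i) z)" "s z"] by (simp add: top.not_eq_extremum)
    then have "sqrt (D (m i) z) \<le> sqrt (enn2real (s z))" by simp
    then have "norm (P (m i) z - p z) \<le> sqrt (enn2real (s z))" "norm (Q (m i) z - q z) \<le> sqrt (enn2real (s z))"
      using le[of "m i"] order_trans by blast+
    then show "norm (P (m i) z) \<le> h z" "norm (Q (m i) z) \<le> h z"
      using norm_triangle_sub[of "P (m i) z" "p z"] norm_triangle_sub[of "Q (m i) z" "q z"]
      by (simp_all add: h_def add_increasing add_increasing2) (smt (verit) norm_ge_zero)+
  qed
  have sub: "integrable ?M (\<lambda>z. (norm (g z))\<^sup>2)" if g: "loc_square_integrable g" for g
  proof -
    have "integrable lborel (\<lambda>z. indicator (csq R) z *\<^sub>R (norm (g z))\<^sup>2)" using g by (simp add: loc_square_integrable_def)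
    then have "set_integrable lborel (sq R) (\<lambda>z. (norm (g z))\<^sup>2)"
      using set_integrable_subset[of lborel "csq R" "\<lambda>z. (norm (g z))\<^sup>2" "sq R"] sq_subset_csq[of R] by (simp add: set_integrable_def)
    then show ?thesis by (simp add: integrable_restrict_space set_integrable_def)
  qed
  have i1: "integrable ?M (\<lambda>z. (1 * (norm (p z) + norm (q z)))\<^sup>2)"
    by (rule integrable_square_add[OF _ _ sub[OF p(1)] sub[OF q(1)]]) measurable
  have i2: "integrable ?M (\<lambda>z. (sqrt (enn2real (s z)))\<^sup>2)"
  proof -
    have "(\<integral>\<^sup>+z. ennreal (enn2real (s z)) \<partial>?M) \<le> (\<integral>\<^sup>+z. s z \<partial>?M)"
      by (intro nn_integral_mono) (metis ennreal_enn2real_if order_refl zero_le)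
    then have "integrable ?M (\<lambda>z. enn2real (s z))" using sfin by (intro integrableI_nonneg) auto
    then show ?thesis by simp
  qed
  obtain B where B: "\<And>z. z \<in> csq R \<Longrightarrow> norm (f z) \<le> B"
    using compact_imp_bounded[OF compact_continuous_image[OF continuous_on_subset[OF f(1) subset_UNIV] compact_csq[of R]]] by (auto simp: bounded_iff)
  have "eventually (\<lambda>n. \<forall>z\<in>csq R. dist (U n z) (f z) < 1) sequentially" using uniform_limitD[OF f(2), of 1 R] by simp
  then obtain N where N: "\<And>n z. n \<ge> N \<Longrightarrow> z \<in> csq R \<Longrightarrow> dist (U n z) (f z) < 1" by (auto simp: eventually_sequentially)
  \<comment> \<open>The shift by \<open>N\<close> starts the sequence where the uniform bound
    \<open>B + 1\<close> already holds.\<close>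
  define r where "r i = m (i + N)" for i
  have r: "r i \<ge> N" "r i \<ge> i" for i using m(1)[of "i + N"] by (auto simp: r_def)
  have cz: "z \<in> csq R" if "z \<in> sq R" for z using that sq_subset_csq by blast
  show ?thesis
  proof (rule sobI[of p "sq R" q h "\<lambda>i. U (r i)" "\<lambda>i. P (r i)" "\<lambda>i. Q (r i)" f "B + 1"])
    show "h \<in> borel_measurable ?M" unfolding h_def by measurable
    show "p \<in> borel_measurable ?M" "q \<in> borel_measurable ?M" by (rule measurable_restrict_space1, simp)+
    show "C1on (sq R) (U (r i)) (P (r i)) (Q (r i))" for i by (rule C1on_subset[OF C]) simp
    have "filterlim r at_top sequentially" by (rule filterlim_at_top_mono[OF filterlim_ident]) (use r in auto)
    then have "uniform_limit (csq R) (\<lambda>i. U (r i)) f sequentially" using f(2)[of R] unfolding uniform_limit_iff filterlim_iff by blast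
    then show "uniform_limit (sq R) (\<lambda>i. U (r i)) f sequentially" by (rule uniform_limit_on_subset) (rule sq_subset_csq)
    show "norm (U (r i) z) \<le> B + 1" if "z \<in> sq R" for i z
      using N[OF r(1)[of i] cz[OF that]] B[OF cz[OF that]] norm_triangle_sub[of "U (r i) z" "f z"] by (simp add: dist_norm)
    show "AE z in ?M. \<forall>i. norm (P (r i) z) \<le> h z \<and> norm (Q (r i) z) \<le> h z"
      using sAE by eventually_elim (auto simp: r_def intro: good)
    show "AE z in ?M. (\<lambda>i. P (r i) z) \<longlonglongrightarrow> p z \<and> (\<lambda>i. Q (r i) z) \<longlonglongrightarrow> q z"
      using sAE unfolding r_def by eventually_elim (intro conjI LIMSEQ_ignore_initial_segment[of "\<lambda>i. P (m i) _"] LIMSEQ_ignore_initial_segment[of "\<lambda>i. Q (m i) _"] good)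
    have "integrable ?M (\<lambda>z. (1 * (1 * (norm (p z) + norm (q z)) + sqrt (enn2real (s z))))\<^sup>2)"
      by (rule integrable_square_add[OF _ _ i1 i2]) measurable
    then show "integrable ?M (\<lambda>z. (h z)\<^sup>2)" by (simp add: h_def)
  qed
qed

text \<open>The increments \<open>F\<close> are additive, hence homogeneous for the factors 1 / n.
  The symmetric difference quotients of \<open>U\<close> along these factors are then constantly
  \<open>F h\<close>, and they converge to the differential, which is therefore the same at every
  point.\<close>

lemma C1on_additive_increment:
  assumes U: "C1on UNIV U P Q" and inc: "\<And>z h. U (z + h) - U z = F h"
  shows "F h = rlin (P z) (Q z) h"
proof -
  have add: "F (x + y) = F x + F y" for x y
    using inc[of 0 "x + y"] inc[of x y] inc[of 0 x] by (simp add: algebra_simps)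
  have mult: "F (real n *\<^sub>R x) = real n *\<^sub>R F x" for n x
  proof (induction n)
    case 0 show ?case using inc[of 0 0] by simp
  next
    case (Suc n)
    then show ?case using add[of x "real n *\<^sub>R x"] by (simp add: scaleR_add_left)
  qed
  define t where "t n = inverse (real (Suc n))" for n
  have t: "t \<longlonglongrightarrow> 0" "t n > 0" for n unfolding t_def by (rule LIMSEQ_inverse_real_of_nat, simp)
  have Fh: "F (t n *\<^sub>R h) = t n *\<^sub>R F h" for n
  proof -
    have "F h = F (real (Suc n) *\<^sub>R (t n *\<^sub>R h))" unfolding t_def scaleR_scaleR by simp
    also have "\<dots> = real (Suc n) *\<^sub>R F (t n *\<^sub>R h)" by (rule mult)
    finally show ?thesis unfolding t_def by (simp del: of_nat_Suc)
  qed
  have Fneg: "F (- x) = - F x" for x using add[of x "- x"] inc[of 0 0] by (simp add: eq_neg_iff_add_eq_0 add.commute)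
  have "(U (z + t n *\<^sub>R h) - U (z - t n *\<^sub>R h)) /\<^sub>R (2 * t n) = F h" for n
  proof -
    have "U (z + t n *\<^sub>R h) - U (z - t n *\<^sub>R h) = F (t n *\<^sub>R h) - F (- (t n *\<^sub>R h))"
      using inc[of z "t n *\<^sub>R h"] inc[of z "- (t n *\<^sub>R h)"] by (simp add: algebra_simps)
    also have "\<dots> = (2 * t n) *\<^sub>R F h" unfolding Fneg Fh by (simp add: scaleR_add_left[symmetric])
    finally show ?thesis using t(2)[of n] by simp
  qed
  moreover have "(\<lambda>n. (U (z + t n *\<^sub>R h) - U (z - t n *\<^sub>R h)) /\<^sub>R (2 * t n)) \<longlonglongrightarrow> rlin (P z) (Q z) h"
    by (rule symmetric_difference_quotient_tendsto[OF _ t]) (use U in \<open>auto simp: C1on_def\<close>)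
  ultimately show ?thesis by (simp add: LIMSEQ_const_iff)
qed

lemma AE_eq_const_of_L2_limit:
  fixes p :: "complex \<Rightarrow> complex"
  assumes p: "p \<in> borel_measurable borel"
    and le: "\<And>R e. e > 0 \<Longrightarrow> (\<integral>\<^sup>+z. indicator (csq R) z * ennreal ((norm (a - p z))\<^sup>2) \<partial>lborel) \<le> ennreal e"
  shows "AE z in lborel. p z = a"
proof -
  have "AE z in lborel. z \<in> csq (real n) \<longrightarrow> p z = a" for n
  proof -
    have "(\<integral>\<^sup>+z. indicator (csq (real n)) z * ennreal ((norm (a - p z))\<^sup>2) \<partial>lborel) \<le> 0"
      by (rule ennreal_le_epsilon) (use le in auto)
    then have "AE z in lborel. indicator (csq (real n)) z * ennreal ((norm (a - p z))\<^sup>2) = 0"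
      using p by (subst (asm) le_zero_eq, subst (asm) nn_integral_0_iff_AE) auto
    then show ?thesis by eventually_elim (auto simp: indicator_def)
  qed
  then have "AE z in lborel. \<forall>n. z \<in> csq (real n) \<longrightarrow> p z = a" unfolding AE_all_countable by (rule allI)
  then show ?thesis
  proof eventually_elim
    case (elim z)
    obtain n :: nat where "supn z \<le> real n" using real_arch_simple by blast
    then show ?case using elim by (auto simp: csq_def)
  qed
qed

section \<open>Solutions of the autonomous Beltrami equation\<close>

lemma AE_lborel_shift:
  assumes "AE z in lborel. P (z :: complex)"
  shows "AE z in lborel. P (z + h)"
proof -
  obtain N where N: "{z. \<not> P z} \<subseteq> N" "N \<in> null_sets lborel"
    using assms by (auto simp: eventually_ae_filter)
  then have [measurable]: "N \<in> sets borel" by auto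
  have "emeasure lborel ((+) h -` N) = emeasure (distr lborel borel ((+) h)) N"
    by (subst emeasure_distr) auto
  also have "\<dots> = 0" using N by (simp add: lborel_distr_plus null_setsD1)
  finally have "(+) h -` N \<in> null_sets lborel"
    using measurable_sets[of "(+) h" borel borel N] by (auto intro!: null_setsI)
  then show ?thesis using N(1) by (auto intro!: AE_I' simp: add.commute)
qed

lemma sob_shift:
  assumes u: "sob S u p q" and S: "open S"
  shows "sob {z. z + h \<in> S} (\<lambda>z. u (z + h)) (\<lambda>z. p (z + h)) (\<lambda>z. q (z + h))"
proof -
  obtain k U P Q B where 1: "p \<in> borel_measurable (lborel_on S)" "q \<in> borel_measurable (lborel_on S)"
    "(k::complex\<Rightarrow>real) \<in> borel_measurable (lborel_on S)" "\<And>n::nat. C1on S (U n) (P n) (Q n)"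
    "uniform_limit S U u sequentially"
    "\<And>n z. z \<in> S \<Longrightarrow> norm (U n z) \<le> B" "AE z in lborel_on S. \<forall>n. norm (P n z) \<le> k z \<and> norm (Q n z) \<le> k z"
    "AE z in lborel_on S. (\<lambda>n. P n z) \<longlonglongrightarrow> p z \<and> (\<lambda>n. Q n z) \<longlonglongrightarrow> q z"
    "integrable (lborel_on S) (\<lambda>z. (k z)\<^sup>2)" by (rule sobE[OF u]) blast
  define T where "T = {z. z + h \<in> S}"
  have T: "open T" unfolding T_def using open_vimage[OF S, of "\<lambda>z. z + h"] by (simp add: vimage_def continuous_intros)
  have sh: "(\<lambda>z. z + h) \<in> lborel_on T \<rightarrow>\<^sub>M lborel_on S"
    by (rule measurable_restrict_space3) (auto simp: T_def)
  have AEs: "AE z in lborel_on T. R (z + h)" if "AE z in lborel_on S. R z" for R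
    using AE_lborel_shift[of "\<lambda>z. z \<in> S \<longrightarrow> R z" h] that S T by (simp add: AE_lborel_on_iff) (simp add: T_def)
  have "sob T (\<lambda>z. u (z + h)) (\<lambda>z. p (z + h)) (\<lambda>z. q (z + h))"
  proof (rule sobI[of _ T _ "\<lambda>z. k (z + h)" "\<lambda>n z. U n (z + h)" "\<lambda>n z. P n (z + h)" "\<lambda>n z. Q n (z + h)" _ B])
    show "(\<lambda>z. p (z + h)) \<in> borel_measurable (lborel_on T)" "(\<lambda>z. q (z + h)) \<in> borel_measurable (lborel_on T)"
      "(\<lambda>z. k (z + h)) \<in> borel_measurable (lborel_on T)"
      using 1(1-3) sh by (auto intro: measurable_compose)
    show "C1on T (\<lambda>z. U n (z + h)) (\<lambda>z. P n (z + h)) (\<lambda>z. Q n (z + h))" for n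
      unfolding C1on_def
    proof (intro conjI ballI)
      fix z assume "z \<in> T"
      then have "(U n has_derivative rlin (P n (z + h)) (Q n (z + h))) (at (z + h))" using 1(4) by (auto simp: C1on_def T_def)
      moreover have "((\<lambda>z. z + h) has_derivative (\<lambda>x. x)) (at z)" by (auto intro!: derivative_eq_intros)
      ultimately show "((\<lambda>z. U n (z + h)) has_derivative rlin (P n (z + h)) (Q n (z + h))) (at z)"
        using has_derivative_compose by blast
    next
      have "continuous_on S (P n)" "continuous_on S (Q n)" using 1(4)[of n] by (auto simp: C1on_def)
      moreover have "continuous_on T (\<lambda>z. z + h)" "(\<lambda>z. z + h) ` T \<subseteq> S"
        by (auto intro!: continuous_intros simp: T_def)
      ultimately show "continuous_on T (\<lambda>z. P n (z + h))" "continuous_on T (\<lambda>z. Q n (z + h))"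
        using continuous_on_compose2 by blast+
    qed
    show "uniform_limit T (\<lambda>n z. U n (z + h)) (\<lambda>z. u (z + h)) sequentially"
      by (rule uniform_limit_compose'[OF 1(5)]) (auto simp: T_def)
    show "norm (U n (z + h)) \<le> B" if "z \<in> T" for n z using 1(6) that by (auto simp: T_def)
    show "AE z in lborel_on T. \<forall>n. norm (P n (z + h)) \<le> k (z + h) \<and> norm (Q n (z + h)) \<le> k (z + h)" by (rule AEs[OF 1(7)])
    show "AE z in lborel_on T. (\<lambda>n. P n (z + h)) \<longlonglongrightarrow> p (z + h) \<and> (\<lambda>n. Q n (z + h)) \<longlonglongrightarrow> q (z + h)" by (rule AEs[OF 1(8)])
    have "integrable lborel (\<lambda>z. indicator S z *\<^sub>R (k z)\<^sup>2)" using 1(9) S by (simp add: integrable_restrict_space)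
    from integrable_lborel_shift[OF this, of h] show "integrable (lborel_on T) (\<lambda>z. (k (z + h))\<^sup>2)"
      using T by (simp add: integrable_restrict_space indicator_def T_def)
  qed
  then show ?thesis by (simp add: T_def)
qed

text \<open>With \<open>E\<close> and the Jacobian \<open>J\<close> as below, |p + \<i> q|^2 = E - 2
  J and |p - \<i> q|^2 = E + 2 J. Squaring the hypothesis and solving for \<open>E\<close> gives the
  constant.\<close>

lemma distortion_pointwise:
  assumes k: "0 \<le> k" "k < 1" and le: "norm ((p + \<i> * q) / 2) \<le> k * norm ((p - \<i> * q) / 2)"
  shows "(norm p)\<^sup>2 + (norm q)\<^sup>2 \<le> (2 * (1 + k\<^sup>2) / (1 - k\<^sup>2)) * Im (cnj p * q)"
proof -
  define E J where "E = (norm p)\<^sup>2 + (norm q)\<^sup>2" and "J = Im (cnj p * q)"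
  have 1: "(norm (p + \<i> * q))\<^sup>2 = E - 2 * J" "(norm (p - \<i> * q))\<^sup>2 = E + 2 * J"
    unfolding E_def J_def cmod_power2 by (simp_all add: power2_eq_square algebra_simps)
  have "norm (p + \<i> * q) \<le> k * norm (p - \<i> * q)" using le by (simp add: norm_divide)
  then have "(norm (p + \<i> * q))\<^sup>2 \<le> (k * norm (p - \<i> * q))\<^sup>2" by (rule power_mono) simp
  then have "E - 2 * J \<le> k\<^sup>2 * (E + 2 * J)" by (simp add: 1 power_mult_distrib)
  then have "E * (1 - k\<^sup>2) \<le> 2 * (1 + k\<^sup>2) * J" by (simp add: algebra_simps)
  moreover have "k\<^sup>2 < 1" using k by (simp add: power_less_one_iff abs_square_less_1)
  ultimately have "E \<le> 2 * (1 + k\<^sup>2) * J / (1 - k\<^sup>2)" by (simp add: pos_le_divide_eq)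
  then show ?thesis unfolding E_def J_def by simp
qed

lemma test_function_continuous:
  assumes "test_function \<phi>"
  shows "continuous_on UNIV \<phi>" "continuous_on UNIV (\<lambda>z. frechet_derivative \<phi> (at z) v)"
proof -
  have "C_k 0 \<phi>" "C_k (Suc 0) \<phi>" using assms unfolding test_function_def by blast+
  then show "continuous_on UNIV \<phi>" "continuous_on UNIV (\<lambda>z. frechet_derivative \<phi> (at z) v)" by auto
qed

lemma borel_representative:
  fixes g :: "complex \<Rightarrow> complex"
  assumes "g \<in> borel_measurable lebesgue"
  obtains g' where "g' \<in> borel_measurable borel" "AE z in lebesgue. g z = g' z"
proof -
  have "(\<lambda>z. Re (g z)) \<in> borel_measurable lebesgue" "(\<lambda>z. Im (g z)) \<in> borel_measurable lebesgue" using assms by auto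
  from this[THEN completion_ex_borel_measurable_real]
  obtain r i where "r \<in> borel_measurable lborel" "AE z in lborel. Re (g z) = r z" "i \<in> borel_measurable lborel" "AE z in lborel. Im (g z) = i z"
    by blast
  then have "AE z in lborel. g z = Complex (r z) (i z)" by (auto elim!: eventually_elim2 simp: complex_eq_iff)
  moreover have "(\<lambda>z. Complex (r z) (i z)) \<in> borel_measurable borel"
    unfolding Complex_eq using \<open>r \<in> _\<close> \<open>i \<in> _\<close> by measurable
  ultimately show thesis using that by (simp add: AE_completion_iff)
qed

text \<open>Weak partials are given as Lebesgue measurable functions, whereas translation and
  Tonelli are applied to Borel functions on \<open>lborel\<close>; passing to a Borel representative
  changes none of the integrals.\<close>

lemma weak_partial_representative:
  assumes f: "continuous_on UNIV f" and W: "has_weak_partial f v g" and L: "g \<in> L2_loc"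
  obtains p where "loc_square_integrable p" "AE z in lborel. g z = p z"
    "\<And>\<phi>. test_function \<phi> \<Longrightarrow> (LINT z|lborel. frechet_derivative \<phi> (at z) v *\<^sub>R f z) = - (LINT z|lborel. \<phi> z *\<^sub>R p z)"
proof -
  have gm: "g \<in> borel_measurable lebesgue" using L by (simp add: L2_loc_def)
  obtain p where p[measurable]: "p \<in> borel_measurable borel" and AEp: "AE z in lebesgue. g z = p z"
    using borel_representative[OF gm] by blast
  have fm[measurable]: "f \<in> borel_measurable borel" by (rule borel_measurable_continuous_onI[OF f])
  show thesis
  proof (rule that[of p])
    show "AE z in lborel. g z = p z" using AEp by (simp add: AE_completion_iff)
    show "loc_square_integrable p"
      unfolding loc_square_integrable_def
    proof (intro conjI allI impI p)
      fix K :: "complex set" assume K: "compact K"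
      then have [measurable]: "K \<in> sets borel" by (simp add: borel_compact)
      have "integrable lebesgue (\<lambda>z. indicator K z *\<^sub>R (norm (g z))\<^sup>2)"
        using L K by (simp add: L2_loc_def set_integrable_def)
      moreover have "AE z in lebesgue. indicator K z *\<^sub>R (norm (g z))\<^sup>2 = indicator K z *\<^sub>R (norm (p z))\<^sup>2"
        using AEp by eventually_elim simp
      moreover have m: "(\<lambda>z. indicator K z *\<^sub>R (norm (p z))\<^sup>2) \<in> borel_measurable borel" by measurable
      moreover have "(\<lambda>z. indicator K z *\<^sub>R (norm (p z))\<^sup>2) \<in> borel_measurable lebesgue"
        by (rule measurable_completion) (use m in simp)
      ultimately have "integrable lebesgue (\<lambda>z. indicator K z *\<^sub>R (norm (p z))\<^sup>2)"
        using integrable_cong_AE_imp[of lebesgue "\<lambda>z. indicator K z *\<^sub>R (norm (g z))\<^sup>2" "\<lambda>z. indicator K z *\<^sub>R (norm (p z))\<^sup>2"]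
        by (auto elim: eventually_mono)
      then show "integrable lborel (\<lambda>z. indicator K z * (norm (p z))\<^sup>2)"
        using m by (simp add: integrable_completion)
    qed
    fix \<phi> assume \<phi>: "test_function \<phi>"
    note [measurable] = test_function_continuous[OF \<phi>, THEN borel_measurable_continuous_onI]
    have "(LINT z|lborel. frechet_derivative \<phi> (at z) v *\<^sub>R f z) = (LINT z|lebesgue. frechet_derivative \<phi> (at z) v *\<^sub>R f z)"
      by (rule integral_completion[symmetric]) measurable
    also have "\<dots> = - (LINT z|lebesgue. \<phi> z *\<^sub>R g z)" using W \<phi> by (simp add: has_weak_partial_def)
    also have "(LINT z|lebesgue. \<phi> z *\<^sub>R g z) = (LINT z|lebesgue. \<phi> z *\<^sub>R p z)"
    proof (rule integral_cong_AE)
      have m: "\<phi> \<in> borel_measurable lebesgue" "p \<in> borel_measurable lebesgue" by (rule measurable_completion, simp)+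
      show "(\<lambda>z. \<phi> z *\<^sub>R g z) \<in> borel_measurable lebesgue" "(\<lambda>z. \<phi> z *\<^sub>R p z) \<in> borel_measurable lebesgue"
        using m gm by (auto intro!: borel_measurable_scaleR)
      show "AE z in lebesgue. \<phi> z *\<^sub>R g z = \<phi> z *\<^sub>R p z" using AEp by eventually_elim simp
    qed
    also have "(LINT z|lebesgue. \<phi> z *\<^sub>R p z) = (LINT z|lborel. \<phi> z *\<^sub>R p z)"
      by (rule integral_completion) measurable
    finally show "(LINT z|lborel. frechet_derivative \<phi> (at z) v *\<^sub>R f z) = - (LINT z|lborel. \<phi> z *\<^sub>R p z)" .
  qed
qed

theorem theorem1p4:
  fixes H :: "complex \<Rightarrow> complex" and k :: real and f :: "complex \<Rightarrow> complex"
  assumes "k < 1"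
    and "k-lipschitz_on UNIV H"
    and "H 0 = 0"
    and "f \<in> W12_loc"
    and "\<exists>g. homeomorphism UNIV UNIV f g"
    and "AE z in lebesgue. weak_dzbar f z = H (weak_dz f z)"
  shows "\<exists>a. \<forall>z. f z = a * z + H a * cnj z + f 0"
proof -
  obtain finv where hom: "homeomorphism UNIV UNIV f finv" using assms(5) by blast
  have fc: "continuous_on UNIV f" and fc': "continuous_on UNIV finv" and inj: "\<And>z. finv (f z) = z" and surj: "\<And>w. f (finv w) = w"
    using hom by (auto simp: homeomorphism_def)
  have lip: "norm (H x - H y) \<le> k * norm (x - y)" for x y
    using assms(2) by (simp add: lipschitz_on_def dist_norm)
  have k: "0 \<le> k" "k < 1" using assms(1,2) by (auto simp: lipschitz_on_def)
  have W: "has_weak_partial f v (weak_partial f v)" "weak_partial f v \<in> L2_loc" if "v \<in> {1, \<i>}" for v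
  proof -
    have ex: "\<exists>g. has_weak_partial f v g" and "weak_partial f v \<in> L2_loc" using assms(4) that by (auto simp: W12_loc_def)
    then show "weak_partial f v \<in> L2_loc" by simp
    \<comment> \<open>Membership in \<open>W12_loc\<close> includes the existence of a weak
      derivative, so the choice made by \<open>weak_partial\<close> is a genuine weak
      derivative.\<close>
    show "has_weak_partial f v (weak_partial f v)" unfolding weak_partial_def by (rule someI_ex[OF ex])
  qed
  obtain p where p: "loc_square_integrable p" "AE z in lborel. weak_partial f 1 z = p z"
    "\<And>\<phi>. test_function \<phi> \<Longrightarrow> (LINT z|lborel. frechet_derivative \<phi> (at z) 1 *\<^sub>R f z) = - (LINT z|lborel. \<phi> z *\<^sub>R p z)"
    using weak_partial_representative[OF fc W(1)[of 1] W(2)[of 1]] by auto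
  obtain q where q: "loc_square_integrable q" "AE z in lborel. weak_partial f \<i> z = q z"
    "\<And>\<phi>. test_function \<phi> \<Longrightarrow> (LINT z|lborel. frechet_derivative \<phi> (at z) \<i> *\<^sub>R f z) = - (LINT z|lborel. \<phi> z *\<^sub>R q z)"
    using weak_partial_representative[OF fc W(1)[of \<i>] W(2)[of \<i>]] by auto
  have eq: "AE z in lborel. (p z + \<i> * q z) / 2 = H ((p z - \<i> * q z) / 2)"
  proof -
    have "AE z in lborel. weak_dzbar f z = H (weak_dz f z)" using assms(6) by (simp add: AE_completion_iff)
    then show ?thesis using p(2) q(2) by eventually_elim (simp add: weak_dzbar_def weak_dz_def)
  qed
  obtain U P Q where mol: "\<And>n::nat. C1on UNIV (U n) (P n) (Q n)" "\<And>R. uniform_limit (csq R) U f sequentially"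
    "\<And>R e. e > 0 \<Longrightarrow> eventually (\<lambda>n. (\<integral>\<^sup>+z. indicator (csq R) z * ennreal ((norm (P n z - p z))\<^sup>2) \<partial>lborel) \<le> ennreal e) sequentially"
    "\<And>R e. e > 0 \<Longrightarrow> eventually (\<lambda>n. (\<integral>\<^sup>+z. indicator (csq R) z * ennreal ((norm (Q n z - q z))\<^sup>2) \<partial>lborel) \<le> ennreal e) sequentially"
    "\<And>n z h c. \<forall>w. f (w + h) - f w = c \<Longrightarrow> U n (z + h) - U n z = c"
    by (rule weak_derivative_mollification[OF fc p(1) q(1) p(3) q(3)]) blast+
  have sf: "sob (sq R) f p q" for R by (rule sob_of_L2_limit[OF mol(1) fc mol(2) p(1) mol(3) q(1) mol(4)])
  define K where "K = 2 * (1 + k\<^sup>2) / (1 - k\<^sup>2)"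
  have "k\<^sup>2 < 1" using k by (simp add: power_less_one_iff abs_square_less_1)
  then have K: "K > 0" by (simp add: K_def add_pos_nonneg)
  have s_const: "sob (sq R) (\<lambda>z. u z + c) r t" if "sob (sq R) u r t" for R u r t c
  proof -
    have "sob (sq R) (\<lambda>_. c) (\<lambda>_. 0) (\<lambda>_. 0)"
      by (rule sob_C1on[where B = "norm c"]) (auto simp: C1on_def rlin_def[abs_def])
    from sob_add[OF that this] show ?thesis by simp
  qed
  define F where "F z = f z - f 0" for z
  have F: "homeomorphism UNIV UNIV F (\<lambda>w. finv (w + f 0))" "F 0 = 0" "continuous_on UNIV F"
  proof -
    show "F 0 = 0" by (simp add: F_def)
    show cF: "continuous_on UNIV F" unfolding F_def by (intro continuous_intros fc)
    show "homeomorphism UNIV UNIV F (\<lambda>w. finv (w + f 0))"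
      by (rule homeomorphismI) (use cF in \<open>auto simp: F_def inj surj intro!: continuous_on_compose2[OF fc'] continuous_intros\<close>)
  qed
  have sF: "sob (sq R) F p q" for R using s_const[OF sf, of R "- f 0"] by (simp add: F_def[abs_def])
  \<comment> \<open>Since \<open>H 0 = 0\<close>, the Lipschitz bound against 0 makes
    \<open>f\<close> itself quasiregular; the growth estimate rests on this.\<close>
  have dF: "distortion K (sq R) p q" for R
    unfolding distortion_def AE_lborel_on_iff[OF open_sq]
    using eq
  proof eventually_elim
    case (elim z)
    have "norm ((p z + \<i> * q z) / 2) \<le> k * norm ((p z - \<i> * q z) / 2)"
      using lip[of "(p z - \<i> * q z) / 2" 0] by (simp only: elim assms(3) diff_0_right)
    then show ?case unfolding K_def using distortion_pointwise[OF k] by blast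
  qed
  obtain C where C: "C \<ge> 1" "\<And>z1 z2. supn (z2 - z1) \<le> supn z1 / 2 \<Longrightarrow> norm (F z2) \<le> C * norm (F z1)"
    using homeomorphism_harnack[OF K F(1,2) sF dF] by blast
  obtain D where D: "D > 0" "\<And>n z. z \<in> csq (4 ^ n) \<Longrightarrow> norm (F z) \<le> D * (C ^ 4) ^ n"
    using homeomorphism_growth[OF F(3) C] by blast
  have inc: "f (z + h) - f z = F h" for z h
  proof (cases "h = 0")
    case True then show ?thesis by (simp add: F_def)
  next
    case False
    define g where "g z = f (z + h) - f z" for z
    define gp gq where "gp z = p (z + h) - p z" and "gq z = q (z + h) - q z" for z
    \<comment> \<open>Translation by \<open>h\<close> then costs at most \<open>m\<close> further
      levels of scale, uniformly in \<open>n\<close>.\<close>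
    obtain m :: nat where m: "1 + supn h < 4 ^ m" using real_arch_pow[of 4 "1 + supn h"] by auto
    have "g z = g 0"
    proof (rule quasiregular_liouville[OF K])
      show "continuous_on UNIV g" unfolding g_def
        by (intro continuous_intros fc continuous_on_compose2[OF fc]) auto
      show "g z \<noteq> 0" for z
      proof
        assume "g z = 0"
        then have "finv (f (z + h)) = finv (f z)" by (simp add: g_def)
        then show False using False by (simp add: inj)
      qed
      show "sob (sq R) g gp gq" if "R > 0" for R
      proof -
        have "sob (sq R) (\<lambda>z. f (z + h)) (\<lambda>z. p (z + h)) (\<lambda>z. q (z + h))"
        proof (rule sob_subset[OF sob_shift[OF sf open_sq]])
          show "sq R \<subseteq> {z. z + h \<in> sq (R + supn h)}"
            using order_le_less_trans[OF supn_triangle[of _ h]] by (auto simp: sq_def)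
          show "open {z. z + h \<in> sq (R + supn h)}"
            using open_vimage[OF open_sq, of "\<lambda>z. z + h"] by (simp add: vimage_def continuous_intros)
        qed simp
        moreover have "sob (sq R) (\<lambda>z. - 1 * f z) (\<lambda>z. - 1 * p z) (\<lambda>z. - 1 * q z)"
        proof -
          have "sob (sq R) (\<lambda>_. - 1) (\<lambda>_. 0) (\<lambda>_. 0)"
            by (rule sob_C1on[where B = 1]) (auto simp: C1on_def rlin_def[abs_def])
          from sob_mult[OF this sf] show ?thesis by simp
        qed
        ultimately show ?thesis unfolding g_def gp_def gq_def using sob_add by fastforce
      qed
      show "distortion K (sq R) gp gq" for R
        unfolding distortion_def AE_lborel_on_iff[OF open_sq]
        using eq AE_lborel_shift[OF eq, of h]
      proof eventually_elim
        case (elim z)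
        define x y where "x = (p (z + h) - \<i> * q (z + h)) / 2" and "y = (p z - \<i> * q z) / 2"
        have "(gp z + \<i> * gq z) / 2 = H x - H y" unfolding elim[folded x_def y_def, symmetric]
          by (simp add: gp_def gq_def diff_divide_distrib add_divide_distrib algebra_simps)
        moreover have "(gp z - \<i> * gq z) / 2 = x - y"
          by (simp add: gp_def gq_def x_def y_def diff_divide_distrib add_divide_distrib algebra_simps)
        ultimately have "norm ((gp z + \<i> * gq z) / 2) \<le> k * norm ((gp z - \<i> * gq z) / 2)" using lip by metis
        then show ?case unfolding K_def using distortion_pointwise[OF k] by blast
      qed
      show "norm (g z) \<le> (2 * D * (C ^ 4) ^ m) * (C ^ 4) ^ n" if z: "z \<in> csq (4 ^ n)" for n z
      proof -
        have "4 ^ n + supn h \<le> 4 ^ n * (1 + supn h)"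
          using mult_right_mono[of 1 "4 ^ n" "supn h"] supn_bounds(3)[of h] by (simp add: algebra_simps)
        also have "\<dots> \<le> 4 ^ n * 4 ^ m" using m by (intro mult_left_mono) auto
        finally have pw: "4 ^ n + supn h \<le> 4 ^ (n + m)" by (simp add: power_add)
        have "z + h \<in> csq (4 ^ (n + m))" "z \<in> csq (4 ^ (n + m))"
          using z pw supn_triangle[of z h] supn_bounds(3)[of h] by (auto simp: csq_def)
        from this[THEN D(2)] have "norm (F (z + h)) + norm (F z) \<le> 2 * (D * (C ^ 4) ^ (n + m))" by linarith
        moreover have "g z = F (z + h) - F z" by (simp add: g_def F_def)
        ultimately show ?thesis using norm_triangle_ineq4[of "F (z + h)" "F z"] by (simp add: power_add mult_ac)
      qed
      show "2 * D * (C ^ 4) ^ m > 0" "C ^ 4 \<ge> 1" using D(1) C(1) by (auto intro: one_le_power)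
    qed
    then show ?thesis by (simp add: g_def F_def)
  qed
  define a b where "a = F 1" and "b = F \<i>"
  \<comment> \<open>Mollification preserves the increments \<open>F\<close>, so all approximants
    have one and the same constant differential. This gives linearity of \<open>F\<close> and, in
    the L2 limit, also the values of the weak partials.\<close>
  have lin: "F h = rlin (P n z) (Q n z) h" for n z h
    by (rule C1on_additive_increment[OF mol(1)]) (rule mol(5), rule allI, rule inc)
  have PQ: "P n z = a" "Q n z = b" for n z using lin[of 1 n z] lin[of \<i> n z] by (simp_all add: a_def b_def)
  have pa: "AE z in lborel. p z = a"
    by (rule AE_eq_const_of_L2_limit) (use p(1) mol(3) in \<open>auto simp: loc_square_integrable_def PQ eventually_sequentially\<close>)
  have qb: "AE z in lborel. q z = b"
    by (rule AE_eq_const_of_L2_limit) (use q(1) mol(4) in \<open>auto simp: loc_square_integrable_def PQ eventually_sequentially\<close>)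
  \<comment> \<open>The relation between \<open>a\<close> and \<open>b\<close> does not involve
    \<open>z\<close>; holding almost everywhere it holds outright, because a set of full measure is
    nonempty.\<close>
  have "AE z in lborel. p z = a \<and> (a + \<i> * b) / 2 = H ((a - \<i> * b) / 2)"
    using eq pa qb by eventually_elim simp
  then have "\<exists>z. p z = a \<and> (a + \<i> * b) / 2 = H ((a - \<i> * b) / 2)" using eventually_happens[of _ "ae_filter (lborel :: complex measure)"] by (auto simp: ae_filter_eq_bot_iff)
  then have H: "H ((a - \<i> * b) / 2) = (a + \<i> * b) / 2" by simp
  have "f z = (a - \<i> * b) / 2 * z + H ((a - \<i> * b) / 2) * cnj z + f 0" for z
  proof -
    have "f z - f 0 = rlin a b z" using lin[of z 0 0] PQ by (simp add: F_def)
    also have "\<dots> = (a - \<i> * b) / 2 * z + (a + \<i> * b) / 2 * cnj z"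
      by (simp add: rlin_def complex_eq_iff field_simps)
    finally show ?thesis by (simp add: H algebra_simps)
  qed
  then show ?thesis by blast
qed

end
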